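(* Let $d,r$ be integers with $2\leq r\leq \frac{d+1}{2}$. Then $\dim(\mathrm{WE}_{1,r}^d)=2(r-1)$. In particular, $\mathrm{WE}_{1,r}^d$ is a codimension one subvariety of the secant variety $\sigma_r(V_1^d)$.
   Context: Work over $\mathbb{C}$ and identify $\mathrm{Sym}^d(\mathbb{C}^{n+1})$ with the space $\mathbb{C}[x_0,\dots,x_n]_d$ of degree-$d$ forms. A linear form $L=a_0x_0+\dots+a_nx_n$ is identified with its coefficient vector $(a_0,\dots,a_n)\in\mathbb{C}^{n+1}$. The Veronese variety $V_n^d\subset\mathbb{P}(\mathrm{Sym}^d(\mathbb{C}^{n+1}))$ is the set of $[L^d]$ with $L$ a nonzero linear form. Set $\sigma_r^\circ(V_n^d)=\bigcup_{p_1,\dots,p_r\in V_n^d}\langle p_1,\dots,p_r\rangle$ (unions of projective linear spans), and let $\sigma_r(V_n^d)$ be its Zariski closure. The Waring rank $\mathrm{rk}(F)$ of a form $F$ is the minimal $r$ such that $F=\sum_{i=1}^rL_i^d$ for linear forms $L_i$. The Waring locus $\mathcal{W}(F)$ is the set of $[L]\in\mathbb{P}(\mathrm{Sym}^1(\mathbb{C}^{n+1}))$ such that $F\in\langle L^d,L_2^d,\dots,L_r^d\rangle$ for some linear forms $L_2,\dots,L_r$, where $r=\mathrm{rk}(F)$. The eigenscheme $\mathrm{Eig}(F)\subset\mathbb{P}(\mathrm{Sym}^1(\mathbb{C}^{n+1}))$ is the scheme defined by the vanishing of the $2\times2$ minors of the $2\times(n+1)$ matrix with rows $\nabla F(x)$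 and $x$; its points are the $[L]$ with $\nabla F(L)=\lambda L$ for some $\lambda\in\mathbb{C}$ (eigenvectors of $F$). The critical Waring variety of rank-$r$ forms is the Zariski closure $$\mathrm{WE}_{n,r}^d=\overline{\{F\in\sigma_r^\circ(V_n^d)\mid \mathcal{W}(F)\cap\mathrm{Eig}(F)\neq\emptyset\}}\subset\mathbb{P}(\mathrm{Sym}^d(\mathbb{C}^{n+1})).$$ *)

theory Defs
  imports "HOL-Analysis.Analysis" "HOL-Library.Poly_Mapping"
begin

section \<open>Polynomials over the complex numbers\<close>

text \<open>
  Polynomials with variables indexed by an arbitrary type, as finitely supported functions from
  exponent vectors to coefficients; the ring structure is the one of \<^theory>\<open>HOL-Library.Poly_Mapping\<close>.
  Forms in x_0, ..., x_n use the variables 0, ..., n of type \<^typ>\<open>nat\<close>.  The polynomial functions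
  on the space of such forms have one variable for each exponent vector, that is, for each
  coefficient of a form.
\<close>

type_synonym 'v cpoly = "('v \<Rightarrow>\<^sub>0 nat) \<Rightarrow>\<^sub>0 complex"

type_synonym form = "nat cpoly"

definition scale :: "complex \<Rightarrow> 'v cpoly \<Rightarrow> 'v cpoly" where
  "scale c F = Poly_Mapping.single 0 c * F"

global_interpretation cpoly: vector_space "scale :: complex \<Rightarrow> 'v cpoly \<Rightarrow> 'v cpoly"
  by unfold_locales
    (simp_all add: scale_def algebra_simps single_add mult_single flip: mult.assoc)

definition eval_at :: "('v \<Rightarrow> complex) \<Rightarrow> 'v cpoly \<Rightarrow> complex" where
  "eval_at a F =
     (\<Sum>m\<in>Poly_Mapping.keys F. Poly_Mapping.lookup F m *
        (\<Prod>v\<in>Poly_Mapping.keys m. a v ^ Poly_Mapping.lookup m v))"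

definition monom_degree :: "('v \<Rightarrow>\<^sub>0 nat) \<Rightarrow> nat" where
  "monom_degree m = (\<Sum>v\<in>Poly_Mapping.keys m. Poly_Mapping.lookup m v)"

definition homogeneous :: "nat \<Rightarrow> 'v cpoly \<Rightarrow> bool" where
  "homogeneous d F \<longleftrightarrow> (\<forall>m\<in>Poly_Mapping.keys F. monom_degree m = d)"

definition partial_deriv :: "'v \<Rightarrow> 'v cpoly \<Rightarrow> 'v cpoly" where
  "partial_deriv v F =
     (\<Sum>m\<in>Poly_Mapping.keys F.
        Poly_Mapping.single (m - Poly_Mapping.single v 1)
          (of_nat (Poly_Mapping.lookup m v) * Poly_Mapping.lookup F m))"

definition forms :: "nat \<Rightarrow> nat \<Rightarrow> form set" where
  "forms n d = {F. homogeneous d F \<and> (\<forall>m\<in>Poly_Mapping.keys F. Poly_Mapping.keys m \<subseteq> {..n})}"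

text \<open>The coefficient of x_i in a linear form; the identification of linear forms with vectors.\<close>

definition lin_coeff :: "form \<Rightarrow> nat \<Rightarrow> complex" where
  "lin_coeff L i = Poly_Mapping.lookup L (Poly_Mapping.single i 1)"


section \<open>Projective spaces of forms and their Zariski topology\<close>

text \<open>The points of P(V) are the lines in V through the origin (each with the origin included).\<close>

abbreviation proj_pt :: "'v cpoly \<Rightarrow> 'v cpoly set" where
  "proj_pt F \<equiv> cpoly.span {F}"

definition proj_space :: "nat \<Rightarrow> nat \<Rightarrow> form set set" where
  "proj_space n d = proj_pt ` (forms n d - {0})"

text \<open>
  The common zeros of a set of homogeneous polynomials in the coefficients of forms.  As all
  polynomials in S are homogeneous, vanishing on the whole line p and vanishing at one nonzero
  vector of p are the same.
\<close>

definition zero_locus :: "nat \<Rightarrow> nat \<Rightarrow> (nat \<Rightarrow>\<^sub>0 nat) cpoly set \<Rightarrow> form set set" where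
  "zero_locus n d S =
     {p \<in> proj_space n d. \<forall>F\<in>p. \<forall>G\<in>S. eval_at (Poly_Mapping.lookup F) G = 0}"

definition zariski :: "nat \<Rightarrow> nat \<Rightarrow> form set topology" where
  "zariski n d =
     topology (\<lambda>U. \<exists>S. (\<forall>G\<in>S. \<exists>k. homogeneous k G) \<and> U = proj_space n d - zero_locus n d S)"


section \<open>Krull dimension of a topological space\<close>

definition irreducible_space :: "'a topology \<Rightarrow> bool" where
  "irreducible_space X \<longleftrightarrow>
     topspace X \<noteq> {} \<and>
     (\<forall>A B. closedin X A \<and> closedin X B \<and> A \<union> B = topspace X
        \<longrightarrow> A = topspace X \<or> B = topspace X)"

text \<open>
  The supremum of the lengths k of chains of irreducible closed sets
  Z 0 \<subset> ... \<subset> Z k.  It is 0 for the empty space.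
\<close>

definition krull_dim :: "'a topology \<Rightarrow> enat" where
  "krull_dim X =
     Sup {enat k | k. \<exists>Z.
            (\<forall>i\<le>k. closedin X (Z i) \<and> irreducible_space (subtopology X (Z i))) \<and>
            (\<forall>i<k. Z i \<subset> Z (Suc i))}"

definition zariski_dim :: "nat \<Rightarrow> nat \<Rightarrow> form set set \<Rightarrow> enat" where
  "zariski_dim n d Y = krull_dim (subtopology (zariski n d) Y)"


section \<open>Veronese and secant varieties\<close>

definition veronese :: "nat \<Rightarrow> nat \<Rightarrow> form set set" where
  "veronese n d = {proj_pt (L ^ d) | L. L \<in> forms n 1 - {0}}"

text \<open>The projective span of points consists of the lines contained in the sum of these lines.\<close>

definition open_secant :: "nat \<Rightarrow> nat \<Rightarrow> nat \<Rightarrow> form set set" where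
  "open_secant n d r =
     {q \<in> proj_space n d.
        \<exists>p. (\<forall>i\<in>{1..r}. p i \<in> veronese n d) \<and> q \<subseteq> cpoly.span (\<Union>i\<in>{1..r}. p i)}"

definition secant_variety :: "nat \<Rightarrow> nat \<Rightarrow> nat \<Rightarrow> form set set" where
  "secant_variety n d r = (zariski n d) closure_of (open_secant n d r)"


section \<open>Waring rank, Waring locus and eigenvectors\<close>

definition waring_rank :: "nat \<Rightarrow> nat \<Rightarrow> form \<Rightarrow> nat" where
  "waring_rank n d F =
     (LEAST r. \<exists>L. (\<forall>i\<in>{1..r}. L i \<in> forms n 1) \<and> F = (\<Sum>i\<in>{1..r}. L i ^ d))"

definition waring_locus :: "nat \<Rightarrow> nat \<Rightarrow> form \<Rightarrow> form set set" where
  "waring_locus n d F =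
     {proj_pt L | L. L \<in> forms n 1 - {0} \<and>
        (\<exists>M. (\<forall>i\<in>{2..waring_rank n d F}. M i \<in> forms n 1) \<and>
             F \<in> cpoly.span (insert (L ^ d) ((\<lambda>i. M i ^ d) ` {2..waring_rank n d F})))}"

text \<open>
  The points of the eigenscheme, given by the vanishing of the 2 x 2 minors of the matrix whose
  rows are the gradient of F at x and x itself, where x is the coefficient vector of L.
\<close>

definition eigenpoints :: "nat \<Rightarrow> form \<Rightarrow> form set set" where
  "eigenpoints n F =
     {proj_pt L | L. L \<in> forms n 1 - {0} \<and>
        (\<forall>i\<le>n. \<forall>j\<le>n.
           eval_at (lin_coeff L) (partial_deriv i F) * lin_coeff L j
         = eval_at (lin_coeff L) (partial_deriv j F) * lin_coeff L i)}"


section \<open>The critical Waring variety\<close>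

definition critical_waring_variety :: "nat \<Rightarrow> nat \<Rightarrow> nat \<Rightarrow> form set set" where
  "critical_waring_variety n d r =
     (zariski n d) closure_of
       {proj_pt F | F. F \<in> forms n d - {0} \<and> proj_pt F \<in> open_secant n d r \<and>
          waring_locus n d F \<inter> eigenpoints n F \<noteq> {}}"


section \<open>Consistency of the definitions\<close>

lemma poly_expand: "F = (\<Sum>m\<in>Poly_Mapping.keys F. Poly_Mapping.single m (Poly_Mapping.lookup F m))"
  by (rule poly_mapping_eqI)
    (auto simp: lookup_sum lookup_single when_def in_keys_iff sum.delta)

lemma eval_at_superset:
  assumes "finite A" "Poly_Mapping.keys F \<subseteq> A"
  shows "eval_at a F =
    (\<Sum>m\<in>A. Poly_Mapping.lookup F m * (\<Prod>v\<in>Poly_Mapping.keys m. a v ^ Poly_Mapping.lookup m v))"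
  unfolding eval_at_def
  by (rule sum.mono_neutral_left) (use assms in \<open>auto simp: in_keys_iff\<close>)

lemma eval_at_0 [simp]: "eval_at a 0 = 0"
  by (simp add: eval_at_def)

lemma eval_at_1 [simp]: "eval_at a 1 = 1"
  by (simp add: eval_at_def)

lemma eval_at_add: "eval_at a (F + G) = eval_at a F + eval_at a G"
proof -
  let ?A = "Poly_Mapping.keys F \<union> Poly_Mapping.keys G"
  have "Poly_Mapping.keys (F + G) \<subseteq> ?A"
    by (rule keys_add)
  then show ?thesis
    by (simp add: eval_at_superset[of ?A] lookup_add sum.distrib distrib_right)
qed

lemma eval_at_sum: "eval_at a (sum f A) = (\<Sum>i\<in>A. eval_at a (f i))"
  by (induction A rule: infinite_finite_induct) (auto simp: eval_at_add)

lemma monom_value_add: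
  fixes a :: "'v \<Rightarrow> complex"
  shows "(\<Prod>v\<in>Poly_Mapping.keys (m + m'). a v ^ Poly_Mapping.lookup (m + m') v) =
    (\<Prod>v\<in>Poly_Mapping.keys m. a v ^ Poly_Mapping.lookup m v) *
    (\<Prod>v\<in>Poly_Mapping.keys m'. a v ^ Poly_Mapping.lookup m' v)"
proof -
  let ?A = "Poly_Mapping.keys m \<union> Poly_Mapping.keys m'"
  have *: "(\<Prod>v\<in>Poly_Mapping.keys k. a v ^ Poly_Mapping.lookup k v) =
      (\<Prod>v\<in>?A. a v ^ Poly_Mapping.lookup k v)" if "Poly_Mapping.keys k \<subseteq> ?A" for k
    by (rule prod.mono_neutral_left) (use that in \<open>auto simp: in_keys_iff\<close>)
  show ?thesis
    using *[OF keys_add] *[of m] *[of m'] by (simp add: lookup_add power_add prod.distrib)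
qed

lemma monom_degree_add: "monom_degree (m + m') = monom_degree m + monom_degree m'"
proof -
  let ?A = "Poly_Mapping.keys m \<union> Poly_Mapping.keys m'"
  have *: "monom_degree k = (\<Sum>v\<in>?A. Poly_Mapping.lookup k v)"
    if "Poly_Mapping.keys k \<subseteq> ?A" for k
    unfolding monom_degree_def
    by (rule sum.mono_neutral_left) (use that in \<open>auto simp: in_keys_iff\<close>)
  show ?thesis
    using *[OF keys_add] *[of m] *[of m'] by (simp add: lookup_add sum.distrib)
qed

lemma eval_at_single:
  "eval_at a (Poly_Mapping.single m c) =
     c * (\<Prod>v\<in>Poly_Mapping.keys m. a v ^ Poly_Mapping.lookup m v)"
  by (simp add: eval_at_def)

lemma eval_at_mult: "eval_at a (F * G) = eval_at a F * eval_at a G"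
proof -
  let ?s = "\<lambda>F m. Poly_Mapping.single m (Poly_Mapping.lookup F m)"
  have "F * G = (\<Sum>m\<in>Poly_Mapping.keys F. ?s F m) * (\<Sum>m\<in>Poly_Mapping.keys G. ?s G m)"
    using poly_expand[of F] poly_expand[of G] by simp
  then have "eval_at a (F * G) =
      eval_at a ((\<Sum>m\<in>Poly_Mapping.keys F. ?s F m) * (\<Sum>m\<in>Poly_Mapping.keys G. ?s G m))"
    by simp
  also have "\<dots> = eval_at a F * eval_at a G"
    by (simp add: sum_product mult_single eval_at_sum eval_at_single monom_value_add)
      (simp add: eval_at_def sum_product mult_ac)
  finally show ?thesis .
qed

lemma homogeneous_mult: "homogeneous k F \<Longrightarrow> homogeneous l G \<Longrightarrow> homogeneous (k + l) (F * G)"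
  using keys_mult[of F G] by (fastforce simp: homogeneous_def monom_degree_add)

lemma homogeneous_1: "homogeneous 0 1"
  by (simp add: homogeneous_def monom_degree_def)

lemma eval_at_scale: "homogeneous k G \<Longrightarrow> eval_at (\<lambda>v. c * a v) G = c ^ k * eval_at a G"
  by (auto simp: homogeneous_def eval_at_def monom_degree_def power_mult_distrib prod.distrib
      sum_distrib_left mult_ac power_sum intro!: sum.cong)

lemma lookup_scale: "Poly_Mapping.lookup (scale c F) m = c * Poly_Mapping.lookup F m"
  by (simp add: scale_def map.rep_eq when_def flip: mult_map_scale_conv_mult)

lemma vanish_on_line:
  assumes "homogeneous k G" "p \<in> proj_space n d" "F \<in> p" "F \<noteq> 0"
    and "eval_at (Poly_Mapping.lookup F) G = 0" "F' \<in> p"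
  shows "eval_at (Poly_Mapping.lookup F') G = 0"
proof -
  obtain H where p: "p = range (\<lambda>c. scale c H)"
    using assms(2) by (auto simp: proj_space_def cpoly.span_singleton)
  obtain c c' where c: "F = scale c H" "F' = scale c' H"
    using assms(3,6) p by auto
  then have "c \<noteq> 0"
    using assms(4) by auto
  then have "F' = scale (c' / c) F"
    using c by simp
  then have "Poly_Mapping.lookup F' = (\<lambda>m. (c' / c) * Poly_Mapping.lookup F m)"
    by (auto simp: lookup_scale)
  then show ?thesis
    using eval_at_scale[OF assms(1), of "c' / c" "Poly_Mapping.lookup F"] assms(5) by simp
qed

lemma zero_locus_union:
  assumes "\<forall>G\<in>S. \<exists>k. homogeneous k G" "\<forall>G\<in>T. \<exists>k. homogeneous k G"
  shows "zero_locus n d S \<union> zero_locus n d T = zero_locus n d {G * H | G H. G \<in> S \<and> H \<in> T}"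
    (is "?L = ?R")
proof
  show "?L \<subseteq> ?R"
    by (auto simp: zero_locus_def eval_at_mult)
  show "?R \<subseteq> ?L"
  proof
    fix p assume p: "p \<in> ?R"
    then have P: "p \<in> proj_space n d"
      by (simp add: zero_locus_def)
    then obtain F where F: "F \<in> p" "F \<noteq> 0"
      by (auto simp: proj_space_def intro: cpoly.span_base)
    show "p \<in> ?L"
    proof (rule ccontr)
      assume "p \<notin> ?L"
      then obtain G H F1 F2 where GH: "G \<in> S" "H \<in> T" "F1 \<in> p" "F2 \<in> p"
        "eval_at (Poly_Mapping.lookup F1) G \<noteq> 0" "eval_at (Poly_Mapping.lookup F2) H \<noteq> 0"
        using P by (auto simp: zero_locus_def)
      then have "eval_at (Poly_Mapping.lookup F) G \<noteq> 0" "eval_at (Poly_Mapping.lookup F) H \<noteq> 0"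
        using vanish_on_line[OF _ P F] assms by metis+
      then have "eval_at (Poly_Mapping.lookup F) (G * H) \<noteq> 0"
        by (simp add: eval_at_mult)
      moreover have "eval_at (Poly_Mapping.lookup F) (G * H) = 0"
        using p F GH(1,2) by (auto simp: zero_locus_def)
      ultimately show False
        by contradiction
    qed
  qed
qed

lemma istopology_zariski:
  "istopology (\<lambda>U. \<exists>S. (\<forall>G\<in>S. \<exists>k. homogeneous k G) \<and> U = proj_space n d - zero_locus n d S)"
    (is "istopology ?open")
  unfolding istopology_def
proof (intro conjI allI impI)
  fix U V assume "?open U" "?open V"
  then obtain S T where S: "\<forall>G\<in>S. \<exists>k. homogeneous k G" "U = proj_space n d - zero_locus n d S"
    and T: "\<forall>G\<in>T. \<exists>k. homogeneous k G" "V = proj_space n d - zero_locus n d T"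
    by blast
  have "U \<inter> V = proj_space n d - zero_locus n d {G * H | G H. G \<in> S \<and> H \<in> T}"
    using zero_locus_union[OF S(1) T(1), of n d, symmetric] S(2) T(2) by auto
  moreover have "\<forall>G\<in>{G * H | G H. G \<in> S \<and> H \<in> T}. \<exists>k. homogeneous k G"
    using S(1) T(1) homogeneous_mult by blast
  ultimately show "?open (U \<inter> V)"
    by blast
next
  fix K assume "\<forall>U\<in>K. ?open U"
  then obtain S where S: "\<And>U. U \<in> K \<Longrightarrow> \<forall>G\<in>S U. \<exists>k. homogeneous k G"
    "\<And>U. U \<in> K \<Longrightarrow> U = proj_space n d - zero_locus n d (S U)"
    by metis
  have "\<Union>K = (\<Union>U\<in>K. proj_space n d - zero_locus n d (S U))"
    using S(2) by auto
  also have "\<dots> = proj_space n d - zero_locus n d (\<Union>U\<in>K. S U)"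
    by (auto simp: zero_locus_def)
  finally show "?open (\<Union>K)"
    using S(1) by (intro exI[of _ "\<Union>U\<in>K. S U"]) auto
qed

lemma openin_zariski:
  "openin (zariski n d) U \<longleftrightarrow>
     (\<exists>S. (\<forall>G\<in>S. \<exists>k. homogeneous k G) \<and> U = proj_space n d - zero_locus n d S)"
  unfolding zariski_def by (simp add: topology_inverse'[OF istopology_zariski])

lemma zero_locus_subset: "zero_locus n d S \<subseteq> proj_space n d"
  by (auto simp: zero_locus_def)

lemma topspace_zariski [simp]: "topspace (zariski n d) = proj_space n d"
proof
  show "topspace (zariski n d) \<subseteq> proj_space n d"
    using openin_topspace[of "zariski n d"] unfolding openin_zariski by blast
  have "zero_locus n d {1} = {}"
    using cpoly.span_zero by (fastforce simp: zero_locus_def proj_space_def)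
  then have "proj_space n d = proj_space n d - zero_locus n d {1}"
    by simp
  then have "openin (zariski n d) (proj_space n d)"
    unfolding openin_zariski using homogeneous_1 by blast
  then show "proj_space n d \<subseteq> topspace (zariski n d)"
    by (rule openin_subset)
qed

lemma closedin_zariski:
  "closedin (zariski n d) C \<longleftrightarrow>
     (\<exists>S. (\<forall>G\<in>S. \<exists>k. homogeneous k G) \<and> C = zero_locus n d S)"
proof -
  have "C \<subseteq> proj_space n d \<and> proj_space n d - C = proj_space n d - zero_locus n d S \<longleftrightarrow>
      C = zero_locus n d S" for S
    using zero_locus_subset[of n d S] by blast
  then show ?thesis
    unfolding closedin_def openin_zariski topspace_zariski by blast
qed

lemma eigenpoints_iff:
  assumes "L \<in> forms n 1 - {0}"
  shows "(\<forall>i\<le>n. \<forall>j\<le>n.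
           eval_at (lin_coeff L) (partial_deriv i F) * lin_coeff L j
         = eval_at (lin_coeff L) (partial_deriv j F) * lin_coeff L i) \<longleftrightarrow>
    (\<exists>c. \<forall>i\<le>n. eval_at (lin_coeff L) (partial_deriv i F) = c * lin_coeff L i)"
proof -
  have "\<exists>j\<le>n. lin_coeff L j \<noteq> 0"
  proof -
    obtain m where m: "m \<in> Poly_Mapping.keys L"
      using assms by (metis DiffD2 insertI1 ex_in_conv in_keys_iff lookup_zero poly_mapping_eqI)
    then have deg: "monom_degree m = 1" and sub: "Poly_Mapping.keys m \<subseteq> {..n}"
      using assms by (auto simp: forms_def homogeneous_def)
    obtain j where j: "j \<in> Poly_Mapping.keys m" "Poly_Mapping.lookup m j = 1"
      "\<forall>i\<in>Poly_Mapping.keys m. i \<noteq> j \<longrightarrow> Poly_Mapping.lookup m i = 0"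
      using deg unfolding monom_degree_def by (auto simp: sum_eq_Suc0_iff)
    then have "m = Poly_Mapping.single j 1"
      by (intro poly_mapping_eqI) (auto simp: lookup_single when_def in_keys_iff)
    then show ?thesis
      using m j(1) sub by (auto simp: lin_coeff_def in_keys_iff)
  qed
  then obtain j where j: "j \<le> n" "lin_coeff L j \<noteq> 0"
    by blast
  show ?thesis
  proof
    assume H: "\<forall>i\<le>n. \<forall>j\<le>n.
           eval_at (lin_coeff L) (partial_deriv i F) * lin_coeff L j
         = eval_at (lin_coeff L) (partial_deriv j F) * lin_coeff L i"
    show "\<exists>c. \<forall>i\<le>n. eval_at (lin_coeff L) (partial_deriv i F) = c * lin_coeff L i"
      using H j by (intro exI[of _ "eval_at (lin_coeff L) (partial_deriv j F) / lin_coeff L j"])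
        (auto simp: field_simps)
  qed (auto simp: mult_ac)
qed

end

theory Submission
  imports Defs "Jordan_Normal_Form.Determinant"
begin

text \<open>
  Write a linear form as a point \<open>a = (a', a'')\<close> of the plane.  The cone over the \<open>r\<close>-th secant
  variety is the closure of the image of \<open>(a\<^sub>1, \<dots>, a\<^sub>r) \<mapsto> F = a\<^sub>1\<^sup>d + \<dots> + a\<^sub>r\<^sup>d\<close>, which has \<open>2 r\<close>
  parameters.  The gradient of \<open>a\<^sup>d\<close> at \<open>x\<close> is a multiple of \<open>a\<close> by \<open>d \<langle>a, x\<rangle>\<close> to the power \<open>d - 1\<close>, so
  \<open>a\<^sub>1\<close> is an eigenvector of \<open>F\<close> if and only if one polynomial in the parameters vanishes: the sum over
  \<open>i \<ge> 2\<close> of the determinants of \<open>(a\<^sub>i, a\<^sub>1)\<close> weighted by the powers of \<open>\<langle>a\<^sub>i, a\<^sub>1\<rangle>\<close>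
  (\<open>eigenvector_power_sum_iff\<close>).  Hence the critical Waring variety comes from a hypersurface in the
  parameter space, and the two dimensions are expected to be \<open>2 r - 2\<close> and \<open>2 r - 1\<close>.

  Upper bounds.  A chain of \<open>k + 1\<close> irreducible closed sets gives \<open>k + 1\<close> homogeneous polynomials that
  are algebraically independent on the cone over the largest set: each one vanishes on a member of the
  chain but not on the next (\<open>irreducible_chain_independent\<close>).  Pulled back to the parameters they are
  polynomial functions of \<open>2 r\<close> coordinates.  On the hypersurface one coordinate is integral over the
  other \<open>2 r - 1\<close> (\<open>critical_parameters_integral\<close>), and counting monomials shows that no more functions
  than free coordinates are algebraically independent (\<open>polynomial_functions_dependent\<close>).

  Lower bounds.  Consider sums of \<open>s\<close> powers, and sums of \<open>s\<close> powers plus a multiple of the fixed power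
  \<open>x\<^sub>0\<^sup>d\<close>.  Any two members of such a family are joined by a polynomial curve inside it, so its closure
  is irreducible (\<open>irreducible_proj_closure\<close>).  Divide the coefficients of a form by the binomial
  coefficients and take the Hankel determinant of size \<open>s + 1\<close> of the resulting sequence.  It vanishes on
  sums of \<open>s\<close> powers; when the sequence is started at index \<open>1\<close>, the form \<open>x\<^sub>0\<^sup>d\<close> is invisible and the
  determinant vanishes also after adding a multiple of it.  Neither vanishes on a general sum of \<open>s + 1\<close>
  powers.  This separates consecutive families (\<open>hankel_det_power_sum_eq_0\<close>,
  \<open>hankel_det_power_sum_neq_0\<close>); the last determinant uses the coefficient of index \<open>2 r - 1\<close>, which is
  where \<open>2 r \<le> d + 1\<close> enters.

  The same alternation works inside the critical Waring variety, because the eigenvector equation is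
  linear in the coefficients of the powers and can be solved polynomially once there are three powers
  (\<open>critical_coeff\<close>).  With two powers its solutions are the sums of powers of two orthogonal linear
  forms, and the chain passes through these.  Finally, a nonzero Hankel determinant of size \<open>r\<close> forces
  the Waring rank to be \<open>r\<close>, so that \<open>a\<^sub>1\<close> belongs to the Waring locus for a general member of the top
  family (\<open>critical_power_sum_in_critical_forms\<close>).
\<close>


section \<open>Algebras of polynomial functions\<close>

text \<open>
  The algebra of functions generated by the coordinate functions in \<open>X\<close>.  With \<open>X\<close> the identity of the
  complex numbers these are the polynomials in one variable; with coordinates of a parameter space they
  are the polynomial functions on it.
\<close>

inductive_set polyfun :: "('p \<Rightarrow> complex) set \<Rightarrow> ('p \<Rightarrow> complex) set" for X where
  const: "(\<lambda>_. c) \<in> polyfun X"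
| var: "f \<in> X \<Longrightarrow> f \<in> polyfun X"
| add: "f \<in> polyfun X \<Longrightarrow> g \<in> polyfun X \<Longrightarrow> (\<lambda>p. f p + g p) \<in> polyfun X"
| mult: "f \<in> polyfun X \<Longrightarrow> g \<in> polyfun X \<Longrightarrow> (\<lambda>p. f p * g p) \<in> polyfun X"

lemma polyfun_minus: "f \<in> polyfun X \<Longrightarrow> (\<lambda>p. - f p) \<in> polyfun X"
  using polyfun.mult[OF polyfun.const[of "-1"]] by simp

lemma polyfun_diff:
  "f \<in> polyfun X \<Longrightarrow> g \<in> polyfun X \<Longrightarrow> (\<lambda>p. f p - g p) \<in> polyfun X"
  using polyfun.add[OF _ polyfun_minus] by fastforce

lemma polyfun_power: "f \<in> polyfun X \<Longrightarrow> (\<lambda>p. f p ^ k) \<in> polyfun X"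
  by (induction k) (auto intro: polyfun.intros)

lemma polyfun_sum:
  "(\<And>i. i \<in> A \<Longrightarrow> f i \<in> polyfun X) \<Longrightarrow> (\<lambda>p. \<Sum>i\<in>A. f i p) \<in> polyfun X"
  by (induction A rule: infinite_finite_induct) (auto intro: polyfun.intros)

lemma polyfun_prod:
  "(\<And>i. i \<in> A \<Longrightarrow> f i \<in> polyfun X) \<Longrightarrow> (\<lambda>p. \<Prod>i\<in>A. f i p) \<in> polyfun X"
  by (induction A rule: infinite_finite_induct) (auto intro: polyfun.intros)

lemmas polyfun_intros =
  polyfun.intros polyfun_minus polyfun_diff polyfun_power polyfun_sum polyfun_prod

lemma polyfun_univariate:
  assumes "f \<in> polyfun {\<lambda>t. t}"
  shows "\<exists>P. \<forall>t. f t = poly P t"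
  using assms
proof (induction rule: polyfun.induct)
  case (const c)
  show ?case by (rule exI[of _ "[:c:]"]) simp
next
  case (var f)
  then show ?case by (intro exI[of _ "[:0, 1:]"]) simp
next
  case (add f g)
  then obtain P Q where "\<forall>t. f t = poly P t" "\<forall>t. g t = poly Q t" by blast
  then show ?case by (intro exI[of _ "P + Q"]) simp
next
  case (mult f g)
  then obtain P Q where "\<forall>t. f t = poly P t" "\<forall>t. g t = poly Q t" by blast
  then show ?case by (intro exI[of _ "P * Q"]) simp
qed


section \<open>Counting monomials\<close>

text \<open>
  Gaussian elimination: a variable with nonzero coefficient in the last equation is eliminated from the
  other equations.
\<close>

lemma linear_system_nontrivial_solution:
  fixes A :: "'i \<Rightarrow> 'j \<Rightarrow> 'a::field"
  assumes "finite J" "finite I" "card J < card I"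
  shows "\<exists>c. (\<exists>i\<in>I. c i \<noteq> 0) \<and> (\<forall>j\<in>J. (\<Sum>i\<in>I. c i * A i j) = 0)"
  using assms
proof (induction J arbitrary: I A rule: finite_induct)
  case empty
  then have "I \<noteq> {}" by auto
  then show ?case by (intro exI[of _ "\<lambda>_. 1"]) auto
next
  case (insert j J)
  show ?case
  proof (cases "\<forall>i\<in>I. A i j = 0")
    case True
    have "card J < card I"
      using insert by simp
    then obtain c where c: "\<exists>i\<in>I. c i \<noteq> 0" "\<forall>j\<in>J. (\<Sum>i\<in>I. c i * A i j) = 0"
      using insert.IH[OF insert.prems(1), of A] by blast
    then show ?thesis
      using True by (intro exI[of _ c]) simp
  next
    case False
    then obtain k where k: "k \<in> I" "A k j \<noteq> 0" by blast
    let ?B = "\<lambda>i j'. A i j' - A i j / A k j * A k j'"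
    have "card J < card (I - {k})"
      using insert k by (simp add: card_Diff_singleton)
    then obtain c where c: "\<exists>i\<in>I - {k}. c i \<noteq> 0"
      "\<forall>j'\<in>J. (\<Sum>i\<in>I - {k}. c i * ?B i j') = 0"
      using insert.IH[of "I - {k}" ?B] insert.prems(1) by blast
    define s where "s = (\<Sum>i\<in>I - {k}. c i * A i j / A k j)"
    define c' where "c' = c(k := - s)"
    have sum: "(\<Sum>i\<in>I. c' i * A i j') = (\<Sum>i\<in>I - {k}. c i * ?B i j')" for j'
    proof -
      have "(\<Sum>i\<in>I. c' i * A i j') = c' k * A k j' + (\<Sum>i\<in>I - {k}. c' i * A i j')"
        using insert.prems k by (simp add: sum.remove)
      also have "(\<Sum>i\<in>I - {k}. c' i * A i j') = (\<Sum>i\<in>I - {k}. c i * A i j')"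
        by (intro sum.cong) (auto simp: c'_def)
      also have "c' k * A k j' = - (\<Sum>i\<in>I - {k}. c i * A i j / A k j * A k j')"
        by (simp add: c'_def s_def sum_distrib_right)
      finally show ?thesis
        by (simp add: right_diff_distrib sum_subtractf mult.assoc)
    qed
    have "(\<Sum>i\<in>I - {k}. c i * ?B i j) = 0"
      using k by simp
    moreover have "\<exists>i\<in>I. c' i \<noteq> 0"
      using c(1) by (auto simp: c'_def)
    ultimately show ?thesis
      using sum c(2) by (intro exI[of _ c']) simp
  qed
qed

text \<open>
  Exponent vectors are lists, aligned with the list of functions that is raised to them, so that the
  head of the list is the generator that is added last.
\<close>

definition exponents :: "nat \<Rightarrow> nat \<Rightarrow> nat list set" where
  "exponents B n = {as. length as = n \<and> set as \<subseteq> {..<B}}"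

lemma finite_exponents [simp]: "finite (exponents B n)"
  using finite_lists_length_eq[of "{..<B}" n] by (simp add: exponents_def conj_commute)

lemma card_exponents: "card (exponents B n) = B ^ n"
  using card_lists_length_eq[of "{..<B}" n] by (simp add: exponents_def conj_commute)

lemma exponents_0 [simp]: "exponents B 0 = {[]}"
  by (auto simp: exponents_def)

lemma exponents_Suc: "exponents B (Suc n) = (\<lambda>(a, as). a # as) ` ({..<B} \<times> exponents B n)"
  by (auto simp: exponents_def length_Suc_conv image_iff)

lemma sum_exponents_Suc:
  "(\<Sum>as\<in>exponents B (Suc n). f as) = (\<Sum>a<B. \<Sum>as\<in>exponents B n. f (a # as))"
  unfolding exponents_Suc
  by (subst sum.reindex) (auto simp: inj_on_def sum.cartesian_product case_prod_beta)

definition power_product :: "'a::comm_monoid_mult list \<Rightarrow> nat list \<Rightarrow> 'a" where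
  "power_product xs as = prod_list (map2 (^) xs as)"

lemma power_product_simps [simp]:
  "power_product [] as = 1"
  "power_product (x # xs) (a # as) = x ^ a * power_product xs as"
  by (simp_all add: power_product_def)

text \<open>
  The functions that agree on \<open>S\<close> with a linear combination of the monomials in \<open>t\<close> and the \<open>b i\<close> whose
  \<open>t\<close>-degree is less than \<open>e\<close> and whose exponents of the \<open>b i\<close> are at most \<open>m\<close>.  If \<open>t\<close> is integral of degree
  \<open>e\<close> over the \<open>b i\<close> on \<open>S\<close>, these sets exhaust all polynomial functions as \<open>m\<close> grows, and the number of
  monomials grows like \<open>m\<close> to the number of the \<open>b i\<close>.
\<close>

inductive_set reduced_span ::
    "'p set \<Rightarrow> 'i set \<Rightarrow> ('i \<Rightarrow> 'p \<Rightarrow> complex) \<Rightarrow> ('p \<Rightarrow> complex) \<Rightarrow> nat \<Rightarrow> nat \<Rightarrow> ('p \<Rightarrow> complex) set"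
  for S I b t e m where
  monomial: "j < e \<Longrightarrow> (\<And>i. i \<in> I \<Longrightarrow> \<beta> i \<le> m) \<Longrightarrow>
     (\<lambda>p. t p ^ j * (\<Prod>i\<in>I. b i p ^ \<beta> i)) \<in> reduced_span S I b t e m"
| zero: "(\<lambda>_. 0) \<in> reduced_span S I b t e m"
| add: "f \<in> reduced_span S I b t e m \<Longrightarrow> g \<in> reduced_span S I b t e m \<Longrightarrow>
     (\<lambda>p. f p + g p) \<in> reduced_span S I b t e m"
| scale: "f \<in> reduced_span S I b t e m \<Longrightarrow> (\<lambda>p. c * f p) \<in> reduced_span S I b t e m"
| cong: "f \<in> reduced_span S I b t e m \<Longrightarrow> (\<And>p. p \<in> S \<Longrightarrow> f p = g p) \<Longrightarrow>
     g \<in> reduced_span S I b t e m"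

lemma reduced_span_mono:
  assumes "f \<in> reduced_span S I b t e m" "m \<le> m'"
  shows "f \<in> reduced_span S I b t e m'"
  using assms
proof (induction rule: reduced_span.induct)
  case (monomial j \<beta>)
  then show ?case by (intro reduced_span.monomial) (auto intro: order_trans)
qed (auto intro: reduced_span.intros)

lemma reduced_span_sum:
  "(\<And>k. k \<in> A \<Longrightarrow> f k \<in> reduced_span S I b t e m) \<Longrightarrow>
    (\<lambda>p. \<Sum>k\<in>A. f k p) \<in> reduced_span S I b t e m"
  by (induction A rule: infinite_finite_induct) (auto intro: reduced_span.intros)

lemma reduced_span_expand:
  assumes I: "finite I" and "f \<in> reduced_span S I b t e m"
  shows "\<exists>u. \<forall>p\<in>S. f p = (\<Sum>k\<in>{..<e} \<times> (I \<rightarrow>\<^sub>E {..m}).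
    u k * (t p ^ fst k * (\<Prod>i\<in>I. b i p ^ snd k i)))" (is "\<exists>u. \<forall>p\<in>S. f p = ?R u p")
  using assms(2)
proof (induction rule: reduced_span.induct)
  case (monomial j \<beta>)
  let ?k = "(j, restrict \<beta> I)"
  have fin: "finite ({..<e} \<times> (I \<rightarrow>\<^sub>E {..m}))"
    using I by (auto intro: finite_PiE)
  have mem: "?k \<in> {..<e} \<times> (I \<rightarrow>\<^sub>E {..m})"
    using monomial by auto
  have "?R (\<lambda>k. if k = ?k then 1 else 0) p = t p ^ j * (\<Prod>i\<in>I. b i p ^ \<beta> i)" for p
  proof -
    have "?R (\<lambda>k. if k = ?k then 1 else 0) p =
        (\<Sum>k\<in>{..<e} \<times> (I \<rightarrow>\<^sub>E {..m}).
           if k = ?k then t p ^ j * (\<Prod>i\<in>I. b i p ^ restrict \<beta> I i) else 0)"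
      by (intro sum.cong) auto
    also have "\<dots> = t p ^ j * (\<Prod>i\<in>I. b i p ^ restrict \<beta> I i)"
      using fin mem by (subst sum.delta) auto
    also have "\<dots> = t p ^ j * (\<Prod>i\<in>I. b i p ^ \<beta> i)"
      by (intro arg_cong2[where f = "(*)"] prod.cong) auto
    finally show ?thesis .
  qed
  then show ?case
    by (intro exI[of _ "\<lambda>k. if k = ?k then 1 else 0"]) simp
next
  case zero
  show ?case by (intro exI[of _ "\<lambda>_. 0"]) simp
next
  case (add f g)
  then obtain u v where "\<forall>p\<in>S. f p = ?R u p" "\<forall>p\<in>S. g p = ?R v p" by blast
  then show ?case
    by (intro exI[of _ "\<lambda>k. u k + v k"]) (simp add: distrib_right sum.distrib)
next
  case (scale f c)
  then obtain u where "\<forall>p\<in>S. f p = ?R u p" by blast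
  then show ?case
    by (intro exI[of _ "\<lambda>k. c * u k"]) (simp add: sum_distrib_left mult.assoc)
next
  case (cong f g)
  then obtain u where "\<forall>p\<in>S. f p = ?R u p" by blast
  then show ?case
    using cong(2) by (intro exI[of _ u]) simp
qed

text \<open>
  Multiplication by \<open>f\<close> raises the bound on the exponents by at most \<open>c\<close>, whatever the bound is.  This is
  what makes the growth along powers of \<open>f\<close> linear.
\<close>

definition tame ::
    "'p set \<Rightarrow> 'i set \<Rightarrow> ('i \<Rightarrow> 'p \<Rightarrow> complex) \<Rightarrow> ('p \<Rightarrow> complex) \<Rightarrow> nat \<Rightarrow> ('p \<Rightarrow> complex) \<Rightarrow> nat \<Rightarrow> bool" where
  "tame S I b t e f c \<longleftrightarrow>
     (\<forall>m. \<forall>h\<in>reduced_span S I b t e m. (\<lambda>p. f p * h p) \<in> reduced_span S I b t e (m + c))"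

lemma tame_mono: "tame S I b t e f c \<Longrightarrow> c \<le> c' \<Longrightarrow> tame S I b t e f c'"
  unfolding tame_def by (meson add_left_mono reduced_span_mono)

lemma tame_polyfun:
  assumes "f \<in> polyfun X" and X: "\<And>x. x \<in> X \<Longrightarrow> \<exists>c. tame S I b t e x c"
  shows "\<exists>c. tame S I b t e f c"
  using assms(1)
proof (induction rule: polyfun.induct)
  case (const c)
  show ?case
    by (intro exI[of _ 0]) (auto simp: tame_def intro: reduced_span.scale)
next
  case (var f)
  then show ?case using X by blast
next
  case (add f g)
  then obtain c c' where "tame S I b t e f c" "tame S I b t e g c'" by blast
  then have "tame S I b t e f (max c c')" "tame S I b t e g (max c c')"
    by (auto intro: tame_mono)
  then have "tame S I b t e (\<lambda>p. f p + g p) (max c c')"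
    by (auto simp: tame_def distrib_right intro: reduced_span.add)
  then show ?case by blast
next
  case (mult f g)
  then obtain c c' where "tame S I b t e f c" "tame S I b t e g c'" by blast
  then have "tame S I b t e (\<lambda>p. f p * g p) (c' + c)"
    unfolding tame_def mult.assoc by (fastforce simp flip: add.assoc)
  then show ?case by blast
qed

lemma tame_coordinate:
  assumes "finite I" "i \<in> I"
  shows "tame S I b t e (b i) 1"
  unfolding tame_def
proof (intro allI ballI)
  fix m h assume "h \<in> reduced_span S I b t e m"
  then show "(\<lambda>p. b i p * h p) \<in> reduced_span S I b t e (m + 1)"
  proof (induction rule: reduced_span.induct)
    case (monomial j \<beta>)
    let ?\<beta> = "\<beta>(i := Suc (\<beta> i))"
    have "(\<Prod>k\<in>I. b k p ^ ?\<beta> k) = b i p * (\<Prod>k\<in>I. b k p ^ \<beta> k)" for p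
    proof -
      have "(\<Prod>k\<in>I - {i}. b k p ^ ?\<beta> k) = (\<Prod>k\<in>I - {i}. b k p ^ \<beta> k)"
        by (intro prod.cong) auto
      then show ?thesis
        using assms by (simp add: prod.remove[of I i] mult.assoc)
    qed
    moreover have "(\<lambda>p. t p ^ j * (\<Prod>k\<in>I. b k p ^ ?\<beta> k)) \<in> reduced_span S I b t e (m + 1)"
      using monomial by (intro reduced_span.monomial) (auto simp: le_SucI)
    ultimately show ?case by (simp add: mult_ac)
  next
    case (add f g)
    then show ?case by (simp add: distrib_left reduced_span.add)
  next
    case (scale f c)
    then show ?case
      using reduced_span.scale[OF scale.IH, of c] by (simp add: mult_ac)
  next
    case (cong f g)
    show ?case by (rule reduced_span.cong[OF cong.IH]) (simp add: cong)
  qed (auto intro: reduced_span.intros)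
qed

lemma tame_integral:
  assumes pc: "\<And>j. j < e \<Longrightarrow> \<exists>c. tame S I b t e (q j) c"
    and rel: "\<And>p. p \<in> S \<Longrightarrow> t p ^ e = (\<Sum>j<e. q j p * t p ^ j)"
  shows "\<exists>c. tame S I b t e t c"
proof -
  obtain c where c: "\<And>j. j < e \<Longrightarrow> tame S I b t e (q j) (c j)"
    using pc by metis
  define C where "C = (\<Sum>j<e. c j)"
  have C: "tame S I b t e (q j) C" if "j < e" for j
    using c[OF that] by (rule tame_mono) (use that in \<open>auto simp: C_def intro: member_le_sum\<close>)
  have "tame S I b t e t C"
    unfolding tame_def
  proof (intro allI ballI)
    fix m h assume "h \<in> reduced_span S I b t e m"
    then show "(\<lambda>p. t p * h p) \<in> reduced_span S I b t e (m + C)"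
    proof (induction rule: reduced_span.induct)
      case (monomial j \<beta>)
      let ?B = "\<lambda>p. \<Prod>i\<in>I. b i p ^ \<beta> i"
      show ?case
      proof (cases "Suc j < e")
        case True
        then have "(\<lambda>p. t p ^ Suc j * ?B p) \<in> reduced_span S I b t e (m + C)"
          using monomial by (intro reduced_span.monomial) (auto intro: trans_le_add1)
        then show ?thesis by (simp add: mult.assoc)
      next
        case False
        then have e: "e = Suc j" using monomial by simp
        \<comment> \<open>the monomial has the largest admissible power of \<open>t\<close>, and the relation lowers it\<close>
        have "(\<lambda>p. t p ^ j' * ?B p) \<in> reduced_span S I b t e m" if "j' < e" for j'
          using monomial that by (intro reduced_span.monomial) auto
        then have "(\<lambda>p. \<Sum>j'<e. q j' p * (t p ^ j' * ?B p)) \<in> reduced_span S I b t e (m + C)"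
          using C by (intro reduced_span_sum) (auto simp: tame_def)
        then show ?thesis
        proof (rule reduced_span.cong)
          fix p assume "p \<in> S"
          have "(\<Sum>j'<e. q j' p * (t p ^ j' * ?B p)) = t p ^ e * ?B p"
            by (simp add: rel[OF \<open>p \<in> S\<close>] sum_distrib_right mult.assoc)
          then show "(\<Sum>j'<e. q j' p * (t p ^ j' * ?B p)) = t p * (t p ^ j * ?B p)"
            by (simp add: e mult.assoc)
        qed
      qed
    next
      case (add f g)
      then show ?case by (simp add: distrib_left reduced_span.add)
    next
      case (scale f c)
      then show ?case
        using reduced_span.scale[OF scale.IH, of c] by (simp add: mult_ac)
    next
      case (cong f g)
      show ?case by (rule reduced_span.cong[OF cong.IH]) (simp add: cong)
    qed (auto intro: reduced_span.intros)
  qed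
  then show ?thesis by blast
qed

lemma tame_power_product:
  assumes "\<And>f. f \<in> set fs \<Longrightarrow> tame S I b t e f C"
    and "as \<in> exponents B (length fs)"
    and "h \<in> reduced_span S I b t e m"
  shows "(\<lambda>p. power_product (map (\<lambda>f. f p) fs) as * h p)
           \<in> reduced_span S I b t e (m + length fs * B * C)"
  using assms(1,2)
proof (induction fs arbitrary: as)
  case Nil
  then show ?case using assms(3) by simp
next
  case (Cons f fs)
  then obtain a as' where as: "as = a # as'" "a < B" "as' \<in> exponents B (length fs)"
    by (auto simp: exponents_Suc)
  let ?h = "\<lambda>p. power_product (map (\<lambda>f. f p) fs) as' * h p"
  let ?m = "m + length fs * B * C"
  have h: "?h \<in> reduced_span S I b t e ?m"
    using Cons as by simp
  have "(\<lambda>p. f p ^ k * ?h p) \<in> reduced_span S I b t e (?m + k * C)" for k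
  proof (induction k)
    case 0
    then show ?case using h by simp
  next
    case (Suc k)
    then have "(\<lambda>p. f p * (f p ^ k * ?h p)) \<in> reduced_span S I b t e (?m + k * C + C)"
      using Cons.prems(1)[of f] by (simp add: tame_def)
    then show ?case by (simp add: algebra_simps)
  qed
  then have "(\<lambda>p. f p ^ a * ?h p) \<in> reduced_span S I b t e (?m + a * C)" .
  moreover have "?m + a * C \<le> m + length (f # fs) * B * C"
    using as(2) by (simp add: algebra_simps)
  ultimately show ?case
    using reduced_span_mono as(1) by (fastforce simp: mult.assoc)
qed

text \<open>
  Power products of \<open>n\<close> functions with exponents below \<open>B\<close> number \<open>B ^ n\<close>, but they lie in the span of at
  most \<open>e * (n * C * B + 1) ^ card I\<close> reduced monomials, where \<open>C\<close> bounds the growth.  For \<open>n > card I\<close> and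
  large \<open>B\<close> the first number is larger.
\<close>

theorem polynomial_functions_dependent:
  fixes b :: "'i \<Rightarrow> 'p \<Rightarrow> complex"
  assumes I: "finite I" and e: "0 < e"
    and q: "\<And>j. j < e \<Longrightarrow> q j \<in> polyfun (b ` I)"
    and rel: "\<And>p. p \<in> S \<Longrightarrow> t p ^ e = (\<Sum>j<e. q j p * t p ^ j)"
    and fs: "set fs \<subseteq> polyfun (insert t (b ` I))"
    and len: "card I < length fs"
  shows "\<exists>B c. (\<exists>as\<in>exponents B (length fs). c as \<noteq> 0) \<and>
    (\<forall>p\<in>S. (\<Sum>as\<in>exponents B (length fs).
       c as * power_product (map (\<lambda>f. f p) fs) as) = 0)"
proof -
  let ?Q = "reduced_span S I b t e"
  let ?n = "length fs"
  have b: "\<exists>c. tame S I b t e x c" if "x \<in> b ` I" for x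
    using tame_coordinate[OF I] that by blast
  have t: "\<exists>c. tame S I b t e t c"
    by (rule tame_integral[OF _ rel]) (use tame_polyfun[OF q b] in auto)
  have "\<exists>c. tame S I b t e f c" if "f \<in> set fs" for f
    by (rule tame_polyfun[of f "insert t (b ` I)"]) (use that fs b t in auto)
  then obtain c where c: "\<And>f. f \<in> set fs \<Longrightarrow> tame S I b t e f (c f)"
    by metis
  define C where "C = (\<Sum>f\<in>set fs. c f)"
  have C: "tame S I b t e f C" if "f \<in> set fs" for f
    using c[OF that] by (rule tame_mono) (use that in \<open>auto simp: C_def intro: member_le_sum\<close>)
  \<comment> \<open>just large enough for the comparison of the two cardinalities below\<close>
  define B where "B = e * (?n * C + 1) ^ card I + 1"
  define M where "M = ?n * B * C"
  define J where "J = {..<e} \<times> (I \<rightarrow>\<^sub>E {..M})"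
  define \<mu> where "\<mu> = (\<lambda>p (k :: nat \<times> ('i \<Rightarrow> nat)). t p ^ fst k * (\<Prod>i\<in>I. b i p ^ snd k i))"
  have one: "(\<lambda>_. 1) \<in> ?Q 0"
    using reduced_span.monomial[of 0 e I "\<lambda>_. 0" 0 t b S] e by simp
  have "\<exists>u. \<forall>p\<in>S. power_product (map (\<lambda>f. f p) fs) as = (\<Sum>k\<in>J. u k * \<mu> p k)"
    if "as \<in> exponents B ?n" for as
    using reduced_span_expand[OF I tame_power_product[OF C that one]]
    by (simp add: J_def M_def \<mu>_def)
  then obtain A where A: "\<And>as p. as \<in> exponents B ?n \<Longrightarrow> p \<in> S \<Longrightarrow>
      power_product (map (\<lambda>f. f p) fs) as = (\<Sum>k\<in>J. A as k * \<mu> p k)"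
    by metis
  have "card J < card (exponents B ?n)"
  proof -
    have "card J = e * (M + 1) ^ card I"
      using I by (simp add: J_def card_cartesian_product card_PiE)
    also have "\<dots> \<le> e * ((?n * C + 1) * B) ^ card I"
      by (intro mult_left_mono power_mono) (auto simp: M_def B_def algebra_simps)
    also have "\<dots> = e * (?n * C + 1) ^ card I * B ^ card I"
      by (simp only: power_mult_distrib mult.assoc)
    also have "\<dots> < B * B ^ card I"
      by (intro mult_strict_right_mono) (auto simp: B_def)
    also have "\<dots> \<le> B ^ ?n"
      using len power_increasing[of "Suc (card I)" ?n B] by (simp add: B_def)
    finally show ?thesis by (simp add: card_exponents)
  qed
  then obtain c where c: "\<exists>as\<in>exponents B ?n. c as \<noteq> 0"
    "\<And>k. k \<in> J \<Longrightarrow> (\<Sum>as\<in>exponents B ?n. c as * A as k) = 0"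
    using linear_system_nontrivial_solution[of J "exponents B ?n" A] I
    by (auto simp: J_def finite_PiE)
  have "(\<Sum>as\<in>exponents B ?n. c as * power_product (map (\<lambda>f. f p) fs) as) = 0" if "p \<in> S" for p
  proof -
    have "(\<Sum>as\<in>exponents B ?n. c as * power_product (map (\<lambda>f. f p) fs) as) =
        (\<Sum>as\<in>exponents B ?n. \<Sum>k\<in>J. c as * A as k * \<mu> p k)"
      using A that by (intro sum.cong) (auto simp: sum_distrib_left mult.assoc)
    also have "\<dots> = (\<Sum>k\<in>J. (\<Sum>as\<in>exponents B ?n. c as * A as k) * \<mu> p k)"
      by (subst sum.swap) (simp add: sum_distrib_right)
    also have "\<dots> = 0"
      using c(2) by simp
    finally show ?thesis .
  qed
  then show ?thesis
    using c(1) by blast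
qed


section \<open>Polynomials in the coefficients of a form\<close>

text \<open>
  The variables of \<open>G\<close> are the exponent vectors of forms, so that \<open>G\<close> is a polynomial in the coefficients.
\<close>

abbreviation ev :: "(nat \<Rightarrow>\<^sub>0 nat) cpoly \<Rightarrow> form \<Rightarrow> complex" where
  "ev G F \<equiv> eval_at (Poly_Mapping.lookup F) G"

lemma eval_at_scale_poly [simp]: "eval_at a (scale c F) = c * eval_at a F"
  by (simp add: scale_def eval_at_mult eval_at_single)

lemma eval_at_power: "eval_at a (F ^ k) = eval_at a F ^ k"
  by (induction k) (simp_all add: eval_at_mult)

lemma eval_at_variable: "eval_at a (Poly_Mapping.single (Poly_Mapping.single v 1) c) = c * a v"
  by (simp add: eval_at_single)

lemma eval_at_power_product:
  "eval_at a (power_product gs as) = power_product (map (eval_at a) gs) as"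
  unfolding power_product_def
  by (induction gs as rule: list_induct2') (simp_all add: eval_at_mult eval_at_power)

lemma polyfun_eval_at:
  assumes "\<And>v. (\<lambda>p. a p v) \<in> polyfun X"
  shows "(\<lambda>p. eval_at (a p) G) \<in> polyfun X"
  unfolding eval_at_def by (intro polyfun_intros assms)

lemma eval_on_line:
  obtains P where "\<And>c. ev H (scale c F) = poly P c"
proof -
  have "(\<lambda>c. ev H (scale c F)) \<in> polyfun {\<lambda>t. t}"
    by (rule polyfun_eval_at) (simp add: lookup_scale polyfun.mult polyfun.var polyfun.const)
  then show ?thesis
    using polyfun_univariate that by blast
qed

lemma poly_zero_if_zero_off_0:
  fixes P :: "complex poly"
  assumes "\<And>c. c \<noteq> 0 \<Longrightarrow> poly P c = 0"
  shows "P = 0"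
proof (rule ccontr)
  assume "P \<noteq> 0"
  then have "finite {c. poly P c = 0}"
    by (rule poly_roots_finite)
  moreover have "- {0} \<subseteq> {c. poly P c = 0}"
    using assms by auto
  ultimately have "finite (- {0 :: complex})"
    by (rule finite_subset[rotated])
  then have "finite (UNIV :: complex set)"
    by (metis finite_insert Compl_eq_Diff_UNIV finite_Diff2 finite.emptyI)
  then show False
    using infinite_UNIV_char_0 by blast
qed

lemma proj_space_scale: "p \<in> proj_space n d \<Longrightarrow> F \<in> p \<Longrightarrow> scale c F \<in> p"
  by (auto simp: proj_space_def intro: cpoly.span_scale)

lemma proj_space_nonzero: "p \<in> proj_space n d \<Longrightarrow> \<exists>F\<in>p. F \<noteq> 0"
  by (auto simp: proj_space_def intro: cpoly.span_base)

definition homogeneous_component :: "nat \<Rightarrow> 'v cpoly \<Rightarrow> 'v cpoly" where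
  "homogeneous_component e H =
     (\<Sum>m | m \<in> Poly_Mapping.keys H \<and> monom_degree m = e.
        Poly_Mapping.single m (Poly_Mapping.lookup H m))"

lemma homogeneous_homogeneous_component: "homogeneous e (homogeneous_component e H)"
  unfolding homogeneous_def
proof
  fix m assume "m \<in> Poly_Mapping.keys (homogeneous_component e H)"
  also have "Poly_Mapping.keys (homogeneous_component e H) \<subseteq>
      {m \<in> Poly_Mapping.keys H. monom_degree m = e}"
    by (auto simp: in_keys_iff homogeneous_component_def lookup_sum lookup_single when_def
        intro: sum.neutral split: if_splits)
  finally show "monom_degree m = e" by simp
qed

lemma sum_homogeneous_components:
  obtains D where "H = (\<Sum>e\<le>D. homogeneous_component e H)"
proof
  define D where "D = (\<Sum>m\<in>Poly_Mapping.keys H. monom_degree m)"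
  let ?s = "\<lambda>m. Poly_Mapping.single m (Poly_Mapping.lookup H m)"
  have D: "monom_degree m \<le> D" if "m \<in> Poly_Mapping.keys H" for m
    unfolding D_def using that by (intro member_le_sum) auto
  have "H = (\<Sum>m\<in>Poly_Mapping.keys H. ?s m)"
    by (rule poly_expand)
  also have "\<dots> = (\<Sum>e\<le>D. \<Sum>m | m \<in> Poly_Mapping.keys H \<and> monom_degree m = e. ?s m)"
    by (rule sum.group[symmetric]) (use D in auto)
  finally show "H = (\<Sum>e\<le>D. homogeneous_component e H)"
    by (simp add: homogeneous_component_def)
qed

text \<open>
  The polynomial \<open>H\<close> may be inhomogeneous: along a line its value is a polynomial in the scaling factor,
  whose coefficients are the values of the homogeneous components, so \<open>H\<close> vanishes on the line if and
  only if all components do.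
\<close>

lemma closedin_vanishing:
  "closedin (zariski n d) {p \<in> proj_space n d. \<forall>F\<in>p. ev H F = 0}"
proof -
  obtain D where D: "H = (\<Sum>e\<le>D. homogeneous_component e H)"
    by (rule sum_homogeneous_components)
  let ?S = "{homogeneous_component e H | e. e \<le> D}"
  have expand: "ev H F = (\<Sum>e\<le>D. ev (homogeneous_component e H) F)" for F
    using arg_cong[OF D, of "eval_at (Poly_Mapping.lookup F)"] by (simp add: eval_at_sum)
  have "{p \<in> proj_space n d. \<forall>F\<in>p. ev H F = 0} = zero_locus n d ?S"
  proof (intro equalityI subsetI)
    fix p assume "p \<in> {p \<in> proj_space n d. \<forall>F\<in>p. ev H F = 0}"
    then have p: "p \<in> proj_space n d" and H: "\<And>F. F \<in> p \<Longrightarrow> ev H F = 0"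
      by auto
    have "ev (homogeneous_component e H) F = 0" if "F \<in> p" "e \<le> D" for F e
    proof -
      let ?P = "\<Sum>e\<le>D. monom (ev (homogeneous_component e H) F) e"
      have "poly ?P c = 0" for c
      proof -
        have "poly ?P c = (\<Sum>e\<le>D. ev (homogeneous_component e H) (scale c F))"
          using eval_at_scale[OF homogeneous_homogeneous_component, of c "Poly_Mapping.lookup F"]
          by (simp add: poly_sum poly_monom lookup_scale[abs_def] mult.commute)
        also have "\<dots> = 0"
          using H[OF proj_space_scale[OF p \<open>F \<in> p\<close>]] by (simp add: expand)
        finally show ?thesis .
      qed
      then have "?P = 0"
        by (intro poly_zero_if_zero_off_0)
      then have "coeff ?P e = 0"
        by simp
      then show ?thesis
        using that(2) by (simp add: coeff_sum)
    qed
    then show "p \<in> zero_locus n d ?S"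
      using p by (auto simp: zero_locus_def)
  next
    fix p assume "p \<in> zero_locus n d ?S"
    then show "p \<in> {p \<in> proj_space n d. \<forall>F\<in>p. ev H F = 0}"
      by (auto simp: zero_locus_def expand intro!: sum.neutral)
  qed
  then show ?thesis
    unfolding closedin_zariski
    by (intro exI[of _ ?S]) (auto intro: homogeneous_homogeneous_component)
qed

lemma vanishing_on_closure:
  assumes "A \<subseteq> proj_space n d" and "\<And>p F. p \<in> A \<Longrightarrow> F \<in> p \<Longrightarrow> ev H F = 0"
    and "p \<in> (zariski n d) closure_of A" "F \<in> p"
  shows "ev H F = 0"
proof -
  have "A \<subseteq> {p \<in> proj_space n d. \<forall>F\<in>p. ev H F = 0}"
    using assms(1,2) by blast
  then have "(zariski n d) closure_of A \<subseteq> {p \<in> proj_space n d. \<forall>F\<in>p. ev H F = 0}"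
    using closedin_vanishing by (rule closure_of_minimal)
  then show ?thesis
    using assms(3,4) by auto
qed


section \<open>Chains of irreducible closed sets\<close>

lemma irreducible_subspace_iff:
  assumes "closedin T C"
  shows "irreducible_space (subtopology T C) \<longleftrightarrow>
    C \<noteq> {} \<and> (\<forall>A B. closedin T A \<and> closedin T B \<and> C \<subseteq> A \<union> B \<longrightarrow> C \<subseteq> A \<or> C \<subseteq> B)"
proof -
  have top: "topspace (subtopology T C) = C"
    using closedin_subset[OF assms] by (auto simp: topspace_subtopology)
  show ?thesis
  proof (intro iffI conjI allI impI)
    assume irr: "irreducible_space (subtopology T C)"
    then show "C \<noteq> {}"
      unfolding irreducible_space_def top by blast
    fix A B assume AB: "closedin T A \<and> closedin T B \<and> C \<subseteq> A \<union> B"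
    then have "closedin (subtopology T C) (C \<inter> A)" "closedin (subtopology T C) (C \<inter> B)"
      by (auto simp: closedin_subtopology)
    moreover have "(C \<inter> A) \<union> (C \<inter> B) = C"
      using AB by blast
    ultimately have "C \<inter> A = C \<or> C \<inter> B = C"
      using irr unfolding irreducible_space_def top by blast
    then show "C \<subseteq> A \<or> C \<subseteq> B"
      by blast
  next
    assume H: "C \<noteq> {} \<and>
      (\<forall>A B. closedin T A \<and> closedin T B \<and> C \<subseteq> A \<union> B \<longrightarrow> C \<subseteq> A \<or> C \<subseteq> B)"
    show "irreducible_space (subtopology T C)"
      unfolding irreducible_space_def top closedin_closed_subtopology[OF assms]
      using H by (metis Un_upper1 Un_upper2 subset_antisym subset_refl)
  qed
qed

text \<open>
  Chains are built upwards and only their length and their largest member are recorded, since both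
  bounds are proved by adding one larger set at a time.
\<close>

inductive irreducible_chain :: "nat \<Rightarrow> nat \<Rightarrow> nat \<Rightarrow> form set set \<Rightarrow> bool" for n d where
  base: "closedin (zariski n d) Z \<Longrightarrow> irreducible_space (subtopology (zariski n d) Z) \<Longrightarrow>
     irreducible_chain n d 0 Z"
| step: "irreducible_chain n d k Z \<Longrightarrow> Z \<subset> Z' \<Longrightarrow> closedin (zariski n d) Z' \<Longrightarrow>
     irreducible_space (subtopology (zariski n d) Z') \<Longrightarrow> irreducible_chain n d (Suc k) Z'"

lemma irreducible_chain_top:
  assumes "irreducible_chain n d k Z"
  shows "closedin (zariski n d) Z" "irreducible_space (subtopology (zariski n d) Z)"
  using assms by (auto elim: irreducible_chain.cases)

lemma irreducible_chain_sequence: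
  assumes "irreducible_chain n d k Z"
  shows "\<exists>W. (\<forall>i\<le>k. closedin (zariski n d) (W i) \<and>
      irreducible_space (subtopology (zariski n d) (W i))) \<and>
    (\<forall>i<k. W i \<subset> W (Suc i)) \<and> W k = Z"
  using assms
proof (induction rule: irreducible_chain.induct)
  case (base Z)
  then show ?case by (intro exI[of _ "\<lambda>_. Z"]) simp
next
  case (step k Z Z')
  then obtain W where W: "\<forall>i\<le>k. closedin (zariski n d) (W i) \<and>
      irreducible_space (subtopology (zariski n d) (W i))"
    "\<forall>i<k. W i \<subset> W (Suc i)" "W k = Z"
    by blast
  show ?case
    using W step.hyps by (intro exI[of _ "W(Suc k := Z')"]) (auto simp: le_Suc_eq less_Suc_eq)
qed

lemma sequence_irreducible_chain:
  assumes "\<And>i. i \<le> k \<Longrightarrow> closedin (zariski n d) (W i) \<and>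
      irreducible_space (subtopology (zariski n d) (W i))"
    and "\<And>i. i < k \<Longrightarrow> W i \<subset> W (Suc i)"
  shows "irreducible_chain n d k (W k)"
  using assms
proof (induction k)
  case 0
  then show ?case by (auto intro: irreducible_chain.base)
next
  case (Suc k)
  then have "irreducible_chain n d k (W k)" by auto
  then show ?case
    by (rule irreducible_chain.step) (use Suc.prems in auto)
qed

lemma closed_subspace_chain_iff:
  assumes "closedin T Y"
  shows "closedin (subtopology T Y) Z \<and> irreducible_space (subtopology (subtopology T Y) Z)
    \<longleftrightarrow> closedin T Z \<and> irreducible_space (subtopology T Z) \<and> Z \<subseteq> Y"
  by (auto simp: closedin_closed_subtopology[OF assms] subtopology_subtopology Int_absorb1)

lemma zariski_dim_le:
  assumes Y: "closedin (zariski n d) Y"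
    and bound: "\<And>k Z. irreducible_chain n d k Z \<Longrightarrow> Z \<subseteq> Y \<Longrightarrow> k \<le> N"
  shows "zariski_dim n d Y \<le> enat N"
  unfolding zariski_dim_def krull_dim_def closed_subspace_chain_iff[OF Y]
proof (rule Sup_least)
  fix x
  assume "x \<in> {enat k | k. \<exists>Z. (\<forall>i\<le>k. closedin (zariski n d) (Z i) \<and>
    irreducible_space (subtopology (zariski n d) (Z i)) \<and> Z i \<subseteq> Y) \<and> (\<forall>i<k. Z i \<subset> Z (Suc i))}"
  then obtain k Z where "x = enat k" and Z: "\<forall>i\<le>k. closedin (zariski n d) (Z i) \<and>
    irreducible_space (subtopology (zariski n d) (Z i)) \<and> Z i \<subseteq> Y" "\<forall>i<k. Z i \<subset> Z (Suc i)"
    by blast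
  moreover have "irreducible_chain n d k (Z k)"
    by (rule sequence_irreducible_chain) (use Z in auto)
  ultimately show "x \<le> enat N"
    using bound by auto
qed

lemma zariski_dim_ge:
  assumes Y: "closedin (zariski n d) Y" and "irreducible_chain n d k Z" "Z \<subseteq> Y"
  shows "enat k \<le> zariski_dim n d Y"
proof -
  obtain W where W: "\<forall>i\<le>k. closedin (zariski n d) (W i) \<and>
      irreducible_space (subtopology (zariski n d) (W i))"
    "\<forall>i<k. W i \<subset> W (Suc i)" "W k = Z"
    using irreducible_chain_sequence[OF assms(2)] by blast
  have "W i \<subseteq> W k" if "i \<le> k" for i
    using that by (induction rule: inc_induct) (use W(2) in auto)
  then have "W i \<subseteq> Y" if "i \<le> k" for i
    using that W(3) assms(3) by blast
  then show ?thesis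
    unfolding zariski_dim_def krull_dim_def closed_subspace_chain_iff[OF Y]
    using W by (intro Sup_upper) blast
qed


section \<open>A chain yields algebraically independent polynomials\<close>

text \<open>
  Algebraic independence of the restrictions to a set of forms.
\<close>

definition independent_on :: "form set \<Rightarrow> (nat \<Rightarrow>\<^sub>0 nat) cpoly list \<Rightarrow> bool" where
  "independent_on X gs \<longleftrightarrow> (\<forall>B c.
     (\<forall>F\<in>X. ev (\<Sum>as\<in>exponents B (length gs). scale (c as) (power_product gs as)) F = 0) \<longrightarrow>
     (\<forall>as\<in>exponents B (length gs). c as = 0))"

lemma independent_onD:
  assumes "independent_on X gs"
    and "\<And>F. F \<in> X \<Longrightarrow>
      ev (\<Sum>as\<in>exponents B (length gs). scale (c as) (power_product gs as)) F = 0"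
    and "as \<in> exponents B (length gs)"
  shows "c as = 0"
  using spec[OF spec[OF assms(1)[unfolded independent_on_def], of B], of c] assms(2,3) by simp

text \<open>
  In a vanishing polynomial expression in \<open>g\<close> with coefficients in the \<open>gs\<close>, the constant term vanishes on
  \<open>X\<close>, because \<open>g\<close> does, and is therefore the zero combination.  The rest is divisible by \<open>g\<close>, which can be
  cancelled on \<open>X'\<close>, and the argument is repeated.
\<close>

lemma independent_on_Cons:
  assumes indep: "independent_on X gs" and "X \<subseteq> X'"
    and g: "\<And>F. F \<in> X \<Longrightarrow> ev g F = 0"
    and cancel: "\<And>H. (\<And>F. F \<in> X' \<Longrightarrow> ev g F * ev H F = 0) \<Longrightarrow> (\<And>F. F \<in> X' \<Longrightarrow> ev H F = 0)"
  shows "independent_on X' (g # gs)"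
proof -
  have digits: "\<forall>a<B. \<forall>F\<in>X'. ev (Q a) F = 0"
    if "\<And>a. (\<forall>F\<in>X. ev (Q a) F = 0) \<Longrightarrow> (\<forall>F\<in>X'. ev (Q a) F = 0)"
      and "\<And>F. F \<in> X' \<Longrightarrow> (\<Sum>a<B. ev g F ^ a * ev (Q a) F) = 0" for Q B
    using that
  proof (induction B arbitrary: Q)
    case 0
    then show ?case by simp
  next
    case (Suc B)
    have split: "ev (Q 0) F + ev g F * (\<Sum>a<B. ev g F ^ a * ev (Q (Suc a)) F) = 0"
      if "F \<in> X'" for F
      using Suc.prems(2)[OF that]
      by (simp add: sum.lessThan_Suc_shift sum_distrib_left mult.assoc del: sum.lessThan_Suc)
    have "\<forall>F\<in>X. ev (Q 0) F = 0"
      using split g \<open>X \<subseteq> X'\<close> by fastforce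
    then have Q0: "\<forall>F\<in>X'. ev (Q 0) F = 0"
      by (rule Suc.prems(1))
    let ?H = "\<Sum>a<B. g ^ a * Q (Suc a)"
    have H: "ev ?H F = (\<Sum>a<B. ev g F ^ a * ev (Q (Suc a)) F)" for F
      by (simp add: eval_at_sum eval_at_mult eval_at_power)
    have "ev ?H F = 0" if "F \<in> X'" for F
      by (rule cancel[OF _ that]) (use split Q0 H in auto)
    then have "\<forall>a<B. \<forall>F\<in>X'. ev (Q (Suc a)) F = 0"
      using H by (intro Suc.IH Suc.prems(1)) simp_all
    then show ?case
      using Q0 by (auto simp: less_Suc_eq_0_disj)
  qed
  show ?thesis
    unfolding independent_on_def
  proof (intro allI impI)
    fix B c
    let ?n = "length gs"
    assume zero: "\<forall>F\<in>X'. ev (\<Sum>as\<in>exponents B (length (g # gs)).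
      scale (c as) (power_product (g # gs) as)) F = 0"
    define Q where "Q = (\<lambda>a. \<Sum>as\<in>exponents B ?n. scale (c (a # as)) (power_product gs as))"
    have cQ: "\<forall>as\<in>exponents B ?n. c (a # as) = 0" if "\<forall>F\<in>X. ev (Q a) F = 0" for a
      using independent_onD[OF indep, where B = B and c = "\<lambda>as. c (a # as)"] that by (simp add: Q_def)
    have "\<forall>a<B. \<forall>F\<in>X'. ev (Q a) F = 0"
    proof (rule digits)
      fix a assume "\<forall>F\<in>X. ev (Q a) F = 0"
      then have "Q a = 0"
        using cQ by (simp add: Q_def)
      then show "\<forall>F\<in>X'. ev (Q a) F = 0" by simp
    next
      fix F assume "F \<in> X'"
      then have "0 = ev (\<Sum>as\<in>exponents B (Suc ?n).
          scale (c as) (power_product (g # gs) as)) F"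
        using zero by simp
      also have "\<dots> = (\<Sum>a<B. ev g F ^ a * ev (Q a) F)"
        by (simp add: sum_exponents_Suc Q_def eval_at_sum eval_at_mult eval_at_power
            sum_distrib_left mult.left_commute)
      finally show "(\<Sum>a<B. ev g F ^ a * ev (Q a) F) = 0" by simp
    qed
    then have "\<forall>a<B. \<forall>as\<in>exponents B ?n. c (a # as) = 0"
      using cQ \<open>X \<subseteq> X'\<close> by blast
    then show "\<forall>as\<in>exponents B (length (g # gs)). c as = 0"
      by (auto simp: exponents_Suc)
  qed
qed

text \<open>
  Irreducibility for a factor \<open>H\<close> that need not be homogeneous, as it occurs when powers of polynomials of
  different degrees are combined.
\<close>

lemma irreducible_cancel:
  assumes Z: "closedin (zariski n d) Z" "irreducible_space (subtopology (zariski n d) Z)"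
    and G: "homogeneous k G" and F0: "F0 \<in> \<Union>Z" "ev G F0 \<noteq> 0"
    and prod: "\<And>F. F \<in> \<Union>Z \<Longrightarrow> ev G F * ev H F = 0"
    and F: "F \<in> \<Union>Z"
  shows "ev H F = 0"
proof -
  let ?V = "\<lambda>G. {p \<in> proj_space n d. \<forall>F\<in>p. ev G F = 0}"
  have Zsub: "Z \<subseteq> proj_space n d"
    using closedin_subset[OF Z(1)] by simp
  have "Z \<subseteq> ?V G \<union> ?V H"
  proof
    fix p assume p: "p \<in> Z"
    then have pp: "p \<in> proj_space n d" using Zsub by blast
    show "p \<in> ?V G \<union> ?V H"
    proof (rule ccontr)
      assume "p \<notin> ?V G \<union> ?V H"
      then obtain F1 F2 where F12: "F1 \<in> p" "ev G F1 \<noteq> 0" "F2 \<in> p" "ev H F2 \<noteq> 0"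
        using pp by blast
      \<comment> \<open>a homogeneous polynomial that is nonzero somewhere on a line is nonzero at all its nonzero points\<close>
      have H0: "ev H F = 0" if "F \<in> p" "F \<noteq> 0" for F
      proof -
        have "ev G F \<noteq> 0"
          using vanish_on_line[OF G pp that _ F12(1)] F12(2) by blast
        then show ?thesis
          using prod[of F] p that(1) by auto
      qed
      obtain F where F: "F \<in> p" "F \<noteq> 0"
        using proj_space_nonzero[OF pp] by blast
      obtain P where P: "\<And>c. ev H (scale c F) = poly P c"
        using eval_on_line[where H = H and F = F] by blast
      have "P = 0"
      proof (rule poly_zero_if_zero_off_0)
        fix c :: complex assume "c \<noteq> 0"
        then show "poly P c = 0"
          using H0[OF proj_space_scale[OF pp F(1)], of c] F(2) P by auto
      qed
      then have "ev H 0 = 0"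
        using P[of 0] by simp
      then show False
        using H0[OF F12(3)] F12(4) by (cases "F2 = 0") auto
    qed
  qed
  then have "Z \<subseteq> ?V G \<or> Z \<subseteq> ?V H"
    using iffD1[OF irreducible_subspace_iff[OF Z(1)] Z(2), THEN conjunct2, rule_format,
        of "?V G" "?V H"] closedin_vanishing[of n d G] closedin_vanishing[of n d H] by simp
  then show ?thesis
    using F0 F by blast
qed

text \<open>
  Each step of the chain contributes a homogeneous polynomial that vanishes on the smaller set but not on
  the larger one.  The first polynomial is a coefficient that does not vanish at some point of the
  smallest set; the step below that one starts from the vertex of the cone.
\<close>

lemma irreducible_chain_independent:
  assumes "irreducible_chain n d k Z"
  shows "\<exists>gs. length gs = Suc k \<and> independent_on (\<Union>Z) gs"
  using assms
proof (induction rule: irreducible_chain.induct)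
  case (base Z)
  have Zsub: "Z \<subseteq> proj_space n d"
    using closedin_subset[OF base(1)] by simp
  obtain p where p: "p \<in> Z"
    using base unfolding irreducible_subspace_iff[OF base(1)] by blast
  then obtain F where F: "F \<in> p" "F \<noteq> 0"
    using Zsub proj_space_nonzero by blast
  then obtain m where m: "Poly_Mapping.lookup F m \<noteq> 0"
    by (metis lookup_zero poly_mapping_eqI)
  define g :: "(nat \<Rightarrow>\<^sub>0 nat) cpoly"
    where "g = Poly_Mapping.single (Poly_Mapping.single m 1) 1"
  have g: "ev g F = Poly_Mapping.lookup F m" for F
    using eval_at_variable[of _ m 1] by (simp add: g_def)
  have hom: "homogeneous 1 g"
    by (simp add: g_def homogeneous_def monom_degree_def)
  have "0 \<in> p"
    using proj_space_scale[of p n d F 0] p F Zsub by auto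
  then have "0 \<in> \<Union>Z"
    using p by blast
  moreover have "independent_on {0} []"
    by (simp add: independent_on_def)
  moreover have "ev H F' = 0" if "\<And>F. F \<in> \<Union>Z \<Longrightarrow> ev g F * ev H F = 0" "F' \<in> \<Union>Z" for H F'
    by (rule irreducible_cancel[OF base hom _ _ that]) (use p F(1) m g in auto)
  moreover have "ev g F = 0" if "F \<in> {0}" for F
    using that g by simp
  ultimately have "independent_on (\<Union>Z) [g]"
    using independent_on_Cons[of "{0}" "[]" "\<Union>Z" g] by blast
  then show ?case
    by (intro exI[of _ "[g]"]) simp
next
  case (step k Z Z')
  then obtain gs where gs: "length gs = Suc k" "independent_on (\<Union>Z) gs"
    by blast
  obtain S where S: "\<forall>G\<in>S. \<exists>k. homogeneous k G" "Z = zero_locus n d S"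
    using irreducible_chain_top(1)[OF step.hyps(1)] unfolding closedin_zariski by blast
  obtain p where p: "p \<in> Z'" "p \<notin> Z"
    using step.hyps(2) by blast
  moreover have "p \<in> proj_space n d"
    using closedin_subset[OF step.hyps(3)] p by auto
  ultimately obtain F G where FG: "F \<in> p" "G \<in> S" "ev G F \<noteq> 0"
    using S(2) by (auto simp: zero_locus_def)
  then obtain e where "homogeneous e G"
    using S(1) by blast
  then have "ev H F' = 0" if "\<And>F. F \<in> \<Union>Z' \<Longrightarrow> ev G F * ev H F = 0" "F' \<in> \<Union>Z'" for H F'
    by (rule irreducible_cancel[OF step.hyps(3,4) _ _ _ that]) (use p FG in auto)
  moreover have "ev G F = 0" if "F \<in> \<Union>Z" for F
    using that FG(2) S(2) by (auto simp: zero_locus_def)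
  moreover have "\<Union>Z \<subseteq> \<Union>Z'"
    using step.hyps(2) by blast
  ultimately have "independent_on (\<Union>Z') (G # gs)"
    using independent_on_Cons[OF gs(2)] by metis
  then show ?case
    using gs(1) by (intro exI[of _ "G # gs"]) simp
qed

text \<open>
  The dimension of a parametrized set, in terms of the affine cone: the parameters are \<open>card I\<close> free
  coordinates and one more that is integral over them.  The \<open>k + 1\<close> independent polynomials of a chain of
  length \<open>k\<close> become polynomial functions of the parameters, and a relation between these extends from \<open>A\<close>
  to its closure.
\<close>

theorem zariski_dim_parametrized_le:
  fixes b :: "'i \<Rightarrow> 'p \<Rightarrow> complex"
  assumes A: "A \<subseteq> proj_space n d"
    and cover: "\<And>p F. p \<in> A \<Longrightarrow> F \<in> p \<Longrightarrow> \<exists>s\<in>S. F = \<Phi> s"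
    and \<Phi>: "\<And>m. (\<lambda>s. Poly_Mapping.lookup (\<Phi> s) m) \<in> polyfun (insert t (b ` I))"
    and I: "finite I" and e: "0 < e"
    and q: "\<And>j. j < e \<Longrightarrow> q j \<in> polyfun (b ` I)"
    and rel: "\<And>s. s \<in> S \<Longrightarrow> t s ^ e = (\<Sum>j<e. q j s * t s ^ j)"
  shows "zariski_dim n d ((zariski n d) closure_of A) \<le> enat (card I - 1)"
proof (rule zariski_dim_le)
  fix k Z
  assume chain: "irreducible_chain n d k Z" and Z: "Z \<subseteq> (zariski n d) closure_of A"
  obtain gs where gs: "length gs = Suc k" "independent_on (\<Union>Z) gs"
    using irreducible_chain_independent[OF chain] by blast
  let ?fs = "map (\<lambda>g s. ev g (\<Phi> s)) gs"
  have "\<not> card I < Suc k"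
  proof
    assume "card I < Suc k"
    then have len: "card I < length ?fs" using gs by simp
    have fs: "set ?fs \<subseteq> polyfun (insert t (b ` I))"
      using polyfun_eval_at[OF \<Phi>] by auto
    obtain B c where c: "\<exists>as\<in>exponents B (length ?fs). c as \<noteq> 0"
      and dep: "\<forall>s\<in>S. (\<Sum>as\<in>exponents B (length ?fs).
        c as * power_product (map (\<lambda>f. f s) ?fs) as) = 0"
      using polynomial_functions_dependent[OF I e q rel fs len] by blast
    let ?H = "\<Sum>as\<in>exponents B (length gs). scale (c as) (power_product gs as)"
    have "ev ?H (\<Phi> s) = 0" if "s \<in> S" for s
      using dep that by (simp add: eval_at_sum eval_at_power_product o_def)
    then have "ev ?H F = 0" if "p \<in> A" "F \<in> p" for p F
      using cover[OF that] by blast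
    then have van: "ev ?H F = 0" if "F \<in> \<Union>Z" for F
      using vanishing_on_closure[OF A, where H = ?H] Z that by blast
    have "c as = 0" if "as \<in> exponents B (length gs)" for as
      by (rule independent_onD[OF gs(2), where c = c, OF van that])
    then show False
      using c by simp
  qed
  then show "k \<le> card I - 1" by simp
qed simp


section \<open>Irreducibility of parametrized families\<close>

text \<open>
  Any two members are joined by a polynomial curve that stays in the set.  The image of an affine space
  under a polynomial map has this property, and it suffices for irreducibility, because a product of
  polynomials in one variable vanishes only if a factor does.
\<close>

definition poly_connected :: "form set \<Rightarrow> bool" where
  "poly_connected K \<longleftrightarrow> (\<forall>F1\<in>K. \<forall>F2\<in>K. \<exists>H. (\<forall>t. H t \<in> K) \<and> H 0 = F1 \<and> H 1 = F2 \<and>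
     (\<forall>m. (\<lambda>t. Poly_Mapping.lookup (H t) m) \<in> polyfun {\<lambda>t. t}))"

lemma poly_connected_prime:
  assumes K: "poly_connected K"
    and prod: "\<And>F. F \<in> K - {0} \<Longrightarrow> ev G F * ev H F = 0"
    and F1: "F1 \<in> K - {0}" "ev G F1 \<noteq> 0" and F2: "F2 \<in> K - {0}"
  shows "ev H F2 = 0"
proof (rule ccontr)
  assume "ev H F2 \<noteq> 0"
  obtain C where C: "\<And>t. C t \<in> K" "C 0 = F1" "C 1 = F2"
    "\<And>m. (\<lambda>t. Poly_Mapping.lookup (C t) m) \<in> polyfun {\<lambda>t. t}"
    using K F1(1) F2 unfolding poly_connected_def by (metis DiffD1)
  obtain m where m: "Poly_Mapping.lookup F1 m \<noteq> 0"
    using F1(1) by (metis DiffD2 insertI1 lookup_zero poly_mapping_eqI)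
  obtain P where P: "\<And>t. Poly_Mapping.lookup (C t) m = poly P t"
    using polyfun_univariate[OF C(4)] by blast
  obtain Q where Q: "\<And>t. ev G (C t) = poly Q t"
    using polyfun_univariate[OF polyfun_eval_at[where a = "\<lambda>t. Poly_Mapping.lookup (C t)" and G = G, OF C(4)]] by blast
  obtain R where R: "\<And>t. ev H (C t) = poly R t"
    using polyfun_univariate[OF polyfun_eval_at[where a = "\<lambda>t. Poly_Mapping.lookup (C t)" and G = H, OF C(4)]] by blast
  \<comment> \<open>the factor \<open>P\<close>, a coefficient of the form, takes care of the points where the curve meets \<open>0\<close>\<close>
  have "poly (P * Q * R) t = 0" for t
  proof (cases "C t = 0")
    case True
    then show ?thesis using P[of t] by simp
  next
    case False
    then show ?thesis using prod[of "C t"] C(1) Q[of t] R[of t] by simp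
  qed
  then have "P * Q * R = 0"
    by (intro poly_zero_if_zero_off_0)
  moreover have "P \<noteq> 0" "Q \<noteq> 0" "R \<noteq> 0"
    using P[of 0] Q[of 0] R[of 1] C m F1 \<open>ev H F2 \<noteq> 0\<close> by auto
  ultimately show False by simp
qed

definition proj_closure :: "nat \<Rightarrow> nat \<Rightarrow> form set \<Rightarrow> form set set" where
  "proj_closure n d K = (zariski n d) closure_of (proj_pt ` (K - {0}))"

lemma closedin_proj_closure [simp]: "closedin (zariski n d) (proj_closure n d K)"
  by (simp add: proj_closure_def)

lemma proj_pt_in_closure:
  assumes "K \<subseteq> forms n d" "F \<in> K" "F \<noteq> 0"
  shows "proj_pt F \<in> proj_closure n d K"
proof -
  have "proj_pt ` (K - {0}) \<subseteq> topspace (zariski n d)"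
    using assms(1) by (auto simp: proj_space_def)
  then show ?thesis
    unfolding proj_closure_def using closure_of_subset[of "proj_pt ` (K - {0})"] assms(2,3) by blast
qed

lemma proj_closure_mono: "K \<subseteq> K' \<Longrightarrow> proj_closure n d K \<subseteq> proj_closure n d K'"
  unfolding proj_closure_def by (intro closure_of_mono) blast

lemma irreducible_proj_closure:
  assumes K: "poly_connected K" "K \<subseteq> forms n d" and ne: "K - {0} \<noteq> {}"
  shows "irreducible_space (subtopology (zariski n d) (proj_closure n d K))"
  unfolding irreducible_subspace_iff[OF closedin_proj_closure]
proof (intro conjI allI impI)
  show "proj_closure n d K \<noteq> {}"
    using proj_pt_in_closure[OF K(2)] ne by blast
  fix A B
  assume AB: "closedin (zariski n d) A \<and> closedin (zariski n d) B \<and>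
    proj_closure n d K \<subseteq> A \<union> B"
  have cl: "proj_closure n d K \<subseteq> A" if "proj_pt ` (K - {0}) \<subseteq> A" "closedin (zariski n d) A" for A
    unfolding proj_closure_def using that by (rule closure_of_minimal)
  obtain S T where S: "\<forall>G\<in>S. \<exists>k. homogeneous k G" "A = zero_locus n d S"
    and T: "\<forall>G\<in>T. \<exists>k. homogeneous k G" "B = zero_locus n d T"
    using AB unfolding closedin_zariski by blast
  have point: "proj_pt F \<in> zero_locus n d S" if "F \<in> K - {0}" "\<And>G. G \<in> S \<Longrightarrow> ev G F = 0"
    "\<forall>G\<in>S. \<exists>k. homogeneous k G" for F S
  proof -
    have pp: "proj_pt F \<in> proj_space n d"
      using that(1) K(2) by (auto simp: proj_space_def)
    have "ev G F' = 0" if "G \<in> S" "F' \<in> proj_pt F" for G F'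
    proof -
      obtain k where "homogeneous k G" using \<open>\<forall>G\<in>S. \<exists>k. homogeneous k G\<close> \<open>G \<in> S\<close> by blast
      then show ?thesis
        by (rule vanish_on_line[OF _ pp, where F = F]) (use \<open>F \<in> K - {0}\<close> that
            \<open>\<And>G. G \<in> S \<Longrightarrow> ev G F = 0\<close> in \<open>auto intro: cpoly.span_base\<close>)
    qed
    then show ?thesis using pp by (auto simp: zero_locus_def)
  qed
  show "proj_closure n d K \<subseteq> A \<or> proj_closure n d K \<subseteq> B"
  proof (rule ccontr)
    assume "\<not> ?thesis"
    then have "\<not> proj_pt ` (K - {0}) \<subseteq> A" "\<not> proj_pt ` (K - {0}) \<subseteq> B"
      using cl[of A] cl[of B] AB by blast+
    then obtain F1 F2 where F1: "F1 \<in> K - {0}" "proj_pt F1 \<notin> A"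
      and F2: "F2 \<in> K - {0}" "proj_pt F2 \<notin> B"
      by (meson image_subsetI)
    obtain G1 where G1: "G1 \<in> S" "ev G1 F1 \<noteq> 0"
      using point[OF F1(1) _ S(1)] F1(2) S(2) by blast
    obtain G2 where G2: "G2 \<in> T" "ev G2 F2 \<noteq> 0"
      using point[OF F2(1) _ T(1)] F2(2) T(2) by blast
    note G = G1 G2
    have "ev G1 F * ev G2 F = 0" if "F \<in> K - {0}" for F
    proof -
      have "proj_pt F \<in> A \<union> B"
        using proj_pt_in_closure[OF K(2)] that AB by blast
      then show ?thesis
        using S(2) T(2) G by (auto simp: zero_locus_def intro: cpoly.span_base)
    qed
    then show False
      using poly_connected_prime[OF K(1) _ F1(1) G(2) F2(1), of G2] G(4) by blast
  qed
qed

text \<open>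
  The polynomial \<open>H\<close> separates the two closures.  It vanishes on the lines spanned by the members of \<open>K\<close>,
  because these are contained in the cone \<open>R\<close>.
\<close>

lemma proj_closure_strict:
  assumes "K \<subseteq> K'" "K' \<subseteq> forms n d" "K \<subseteq> R"
    and R: "\<And>c F. F \<in> R \<Longrightarrow> scale c F \<in> R" "\<And>F. F \<in> R \<Longrightarrow> ev H F = 0"
    and F: "F \<in> K'" "ev H F \<noteq> 0" "F \<noteq> 0"
  shows "proj_closure n d K \<subset> proj_closure n d K'"
proof
  show "proj_closure n d K \<subseteq> proj_closure n d K'"
    using assms(1) by (rule proj_closure_mono)
  have "proj_pt ` (K - {0}) \<subseteq> proj_space n d"
    using assms(1,2) by (auto simp: proj_space_def)
  moreover have "ev H F = 0" if "p \<in> proj_pt ` (K - {0})" "F \<in> p" for p F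
    using that assms(3) R by (auto simp: cpoly.span_singleton)
  ultimately have "proj_pt F \<notin> proj_closure n d K"
    using vanishing_on_closure[where A = "proj_pt ` (K - {0})" and n = n and d = d and H = H
        and p = "proj_pt F" and F = F] F(2) cpoly.span_base[of F "{F}"]
    unfolding proj_closure_def by blast
  then show "proj_closure n d K \<noteq> proj_closure n d K'"
    using proj_pt_in_closure[OF assms(2)] F by blast
qed

lemma irreducible_chain_proj_closure:
  assumes "poly_connected K" "K \<subseteq> forms n d" "F \<in> K" "F \<noteq> 0"
  shows "irreducible_chain n d 0 (proj_closure n d K)"
  using assms by (intro irreducible_chain.base irreducible_proj_closure) auto

lemma irreducible_chain_extend:
  assumes "irreducible_chain n d k (proj_closure n d K)"
    and "poly_connected K'" "K \<subseteq> K'" "K' \<subseteq> forms n d" "K \<subseteq> R"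
    and "\<And>c F. F \<in> R \<Longrightarrow> scale c F \<in> R" "\<And>F. F \<in> R \<Longrightarrow> ev H F = 0"
    and "F \<in> K'" "ev H F \<noteq> 0" "F \<noteq> 0"
  shows "irreducible_chain n d (Suc k) (proj_closure n d K')"
proof (rule irreducible_chain.step[OF assms(1)])
  show "proj_closure n d K \<subset> proj_closure n d K'"
    by (rule proj_closure_strict[OF assms(3-10)])
  show "irreducible_space (subtopology (zariski n d) (proj_closure n d K'))"
    using assms(2,4,8,10) by (intro irreducible_proj_closure) auto
qed simp


section \<open>Binary forms and powers of linear forms\<close>

definition linear_form :: "complex \<Rightarrow> complex \<Rightarrow> form" where
  "linear_form a b = Poly_Mapping.single (Poly_Mapping.single 0 1) a +
     Poly_Mapping.single (Poly_Mapping.single 1 1) b"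

definition binary_monom :: "nat \<Rightarrow> nat \<Rightarrow> nat \<Rightarrow>\<^sub>0 nat" where
  "binary_monom d k = Poly_Mapping.single 0 (d - k) + Poly_Mapping.single 1 k"

lemma lookup_binary_monom:
  "Poly_Mapping.lookup (binary_monom d k) i = (if i = 0 then d - k else if i = 1 then k else 0)"
  by (auto simp: binary_monom_def lookup_add lookup_single when_def)

lemma binary_monom_inject: "binary_monom d j = binary_monom d k \<longleftrightarrow> j = k"
proof
  assume "binary_monom d j = binary_monom d k"
  then have "Poly_Mapping.lookup (binary_monom d j) 1 = Poly_Mapping.lookup (binary_monom d k) 1"
    by (rule arg_cong)
  then show "j = k"
    by (simp add: lookup_binary_monom)
qed simp

lemma keys_binary_monom: "Poly_Mapping.keys (binary_monom d k) \<subseteq> {..1}"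
proof
  fix v assume "v \<in> Poly_Mapping.keys (binary_monom d k)"
  then have "Poly_Mapping.lookup (binary_monom d k) v \<noteq> 0"
    by (simp add: in_keys_iff)
  then have "v = 0 \<or> v = 1"
    unfolding lookup_binary_monom by presburger
  then show "v \<in> {..1}"
    by auto
qed

lemma monom_degree_binary_monom:
  assumes "k \<le> d" shows "monom_degree (binary_monom d k) = d"
proof -
  have "monom_degree (binary_monom d k) = (\<Sum>v\<in>{0, 1}. Poly_Mapping.lookup (binary_monom d k) v)"
    unfolding monom_degree_def
    by (rule sum.mono_neutral_left) (use keys_binary_monom[of d k] in \<open>auto simp: in_keys_iff\<close>)
  then show ?thesis
    using assms by (simp add: lookup_binary_monom)
qed

lemma single_index_inject [simp]:
  "Poly_Mapping.single i (Suc 0) = Poly_Mapping.single j (Suc 0) \<longleftrightarrow> i = j"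
  by (metis lookup_single_eq lookup_single_not_eq nat.distinct(1))

lemma single_power:
  fixes c :: complex and i :: nat
  shows "Poly_Mapping.single (Poly_Mapping.single i (1::nat)) c ^ k =
    Poly_Mapping.single (Poly_Mapping.single i k) (c ^ k)"
  by (induction k) (simp_all add: mult_single flip: single_add)

lemma linear_form_power:
  "linear_form a b ^ d =
    (\<Sum>k\<le>d. Poly_Mapping.single (binary_monom d k) (of_nat (d choose k) * a ^ (d - k) * b ^ k))"
proof -
  have "linear_form a b ^ d = (\<Sum>k\<le>d. of_nat (d choose k) *
      Poly_Mapping.single (Poly_Mapping.single 1 1) b ^ k *
      Poly_Mapping.single (Poly_Mapping.single 0 1) a ^ (d - k))"
    unfolding linear_form_def by (subst add.commute) (rule binomial_ring)
  also have "\<dots> = (\<Sum>k\<le>d. Poly_Mapping.single (binary_monom d k)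
      (of_nat (d choose k) * a ^ (d - k) * b ^ k))"
  proof (rule sum.cong)
    fix k
    have "of_nat (d choose k) * Poly_Mapping.single (Poly_Mapping.single 1 1) b ^ k *
        Poly_Mapping.single (Poly_Mapping.single 0 1) a ^ (d - k) =
      Poly_Mapping.single 0 (of_nat (d choose k)) *
        Poly_Mapping.single (Poly_Mapping.single 1 k) (b ^ k) *
        Poly_Mapping.single (Poly_Mapping.single (0::nat) (d - k)) (a ^ (d - k))"
      by (simp only: single_power single_of_nat)
    then show "of_nat (d choose k) * Poly_Mapping.single (Poly_Mapping.single 1 1) b ^ k *
        Poly_Mapping.single (Poly_Mapping.single 0 1) a ^ (d - k) =
      Poly_Mapping.single (binary_monom d k) (of_nat (d choose k) * a ^ (d - k) * b ^ k)"
      by (simp only: mult_single binary_monom_def add_0_left) (simp add: ac_simps)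
  qed simp
  finally show ?thesis .
qed

lemma lookup_linear_form_power:
  assumes "k \<le> d"
  shows "Poly_Mapping.lookup (linear_form a b ^ d) (binary_monom d k) =
    of_nat (d choose k) * a ^ (d - k) * b ^ k"
  using assms
  by (simp add: linear_form_power lookup_sum lookup_single when_def binary_monom_inject)

lemma polyfun_linear_form_power:
  assumes "a \<in> polyfun X" "b \<in> polyfun X"
  shows "(\<lambda>p. Poly_Mapping.lookup (linear_form (a p) (b p) ^ d) m) \<in> polyfun X"
proof -
  have "(\<lambda>p. Poly_Mapping.lookup (linear_form (a p) (b p) ^ d) m) =
    (\<lambda>p. \<Sum>k\<le>d. (if binary_monom d k = m then 1 else 0) *
       (of_nat (d choose k) * a p ^ (d - k) * b p ^ k))"
    by (auto simp: linear_form_power lookup_sum lookup_single when_def intro!: ext sum.cong)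
  also have "\<dots> \<in> polyfun X"
    by (intro polyfun_intros assms)
  finally show ?thesis .
qed

lemma forms_0 [simp]: "0 \<in> forms n d"
  by (simp add: forms_def homogeneous_def)

lemma forms_add: "F \<in> forms n d \<Longrightarrow> G \<in> forms n d \<Longrightarrow> F + G \<in> forms n d"
  using keys_add[of F G] by (fastforce simp: forms_def homogeneous_def)

lemma keys_scale: "Poly_Mapping.keys (scale c F) \<subseteq> Poly_Mapping.keys F"
  by (auto simp: in_keys_iff lookup_scale)

lemma forms_scale: "F \<in> forms n d \<Longrightarrow> scale c F \<in> forms n d"
  using keys_scale[of c F] by (fastforce simp: forms_def homogeneous_def)

lemma forms_sum: "(\<And>i. i \<in> A \<Longrightarrow> f i \<in> forms n d) \<Longrightarrow> (\<Sum>i\<in>A. f i) \<in> forms n d"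
  by (induction A rule: infinite_finite_induct) (auto intro: forms_add)

lemma linear_form_power_in_forms: "linear_form a b ^ d \<in> forms 1 d"
  unfolding linear_form_power
proof (rule forms_sum)
  fix k assume "k \<in> {..d}"
  then show "Poly_Mapping.single (binary_monom d k) (of_nat (d choose k) * a ^ (d - k) * b ^ k)
      \<in> forms 1 d"
    using monom_degree_binary_monom[of k d] keys_binary_monom[of d k]
    by (auto simp: forms_def homogeneous_def)
qed

lemma linear_form_in_forms: "linear_form a b \<in> forms 1 1"
  using linear_form_power_in_forms[of a b 1] by simp

lemma lin_coeff_linear_form [simp]:
  "lin_coeff (linear_form a b) = (\<lambda>i. if i = 0 then a else if i = 1 then b else 0)"
  by (auto simp: lin_coeff_def linear_form_def lookup_add lookup_single when_def fun_eq_iff)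

lemma linear_form_eq_iff [simp]: "linear_form a b = linear_form a' b' \<longleftrightarrow> a = a' \<and> b = b'"
proof
  assume "linear_form a b = linear_form a' b'"
  then have "lin_coeff (linear_form a b) = lin_coeff (linear_form a' b')"
    by (rule arg_cong)
  then show "a = a' \<and> b = b'"
    by (simp add: fun_eq_iff) (metis zero_neq_one)
qed simp

lemma linear_form_0 [simp]: "linear_form 0 0 = 0"
  by (simp add: linear_form_def)

lemma linear_form_eq_0_iff [simp]: "linear_form a b = 0 \<longleftrightarrow> a = 0 \<and> b = 0"
  using linear_form_eq_iff[of a b 0 0] by simp

lemma scale_linear_form: "scale c (linear_form a b) = linear_form (c * a) (c * b)"
  by (simp add: scale_def linear_form_def distrib_left mult_single)

lemma scale_power: "scale c F ^ k = scale (c ^ k) (F ^ k)"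
  by (induction k) (simp_all add: scale_def mult_single single_power power_mult_distrib mult_ac)

lemma linear_form_scaled_power:
  "linear_form (c * a) (c * b) ^ d = scale (c ^ d) (linear_form a b ^ d)"
  by (simp flip: scale_linear_form add: scale_power)

lemma linear_form_cases:
  assumes "L \<in> forms 1 1"
  obtains a b where "L = linear_form a b"
proof
  show "L = linear_form (lin_coeff L 0) (lin_coeff L 1)"
  proof (rule poly_mapping_eqI)
    fix m
    have rhs: "Poly_Mapping.lookup (linear_form (lin_coeff L 0) (lin_coeff L 1)) m =
        (if m = Poly_Mapping.single 0 1 then lin_coeff L 0
         else if m = Poly_Mapping.single 1 1 then lin_coeff L 1 else 0)"
      by (auto simp: linear_form_def lookup_add lookup_single when_def)
    show "Poly_Mapping.lookup L m =
        Poly_Mapping.lookup (linear_form (lin_coeff L 0) (lin_coeff L 1)) m"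
    proof (cases "m \<in> Poly_Mapping.keys L")
      case False
      then show ?thesis
        unfolding rhs by (auto simp: in_keys_iff lin_coeff_def)
    next
      case True
      then have deg: "monom_degree m = 1" and sub: "Poly_Mapping.keys m \<subseteq> {..1}"
        using assms by (auto simp: forms_def homogeneous_def)
      obtain j where j: "j \<in> Poly_Mapping.keys m" "Poly_Mapping.lookup m j = 1"
        "\<forall>i\<in>Poly_Mapping.keys m. i \<noteq> j \<longrightarrow> Poly_Mapping.lookup m i = 0"
        using deg unfolding monom_degree_def by (auto simp: sum_eq_Suc0_iff)
      then have "m = Poly_Mapping.single j 1"
        by (intro poly_mapping_eqI) (auto simp: lookup_single when_def in_keys_iff)
      moreover have "j = 0 \<or> j = 1"
        using j(1) sub by auto
      ultimately show ?thesis
        unfolding rhs by (auto simp: lin_coeff_def)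
    qed
  qed
qed

lemma eval_at_linear_form: "eval_at w (linear_form a b) = a * w 0 + b * w 1"
  by (simp add: linear_form_def eval_at_add eval_at_single)


section \<open>Eigenvectors of sums of powers\<close>

text \<open>
  The formal derivative is the complex derivative of the evaluation.  Thus the gradient of a sum of powers
  follows from the chain rule, without expanding the powers.
\<close>

lemma eval_at_partial_deriv:
  "((\<lambda>t. eval_at (w(v := t)) F) has_field_derivative eval_at w (partial_deriv v F)) (at (w v))"
proof -
  have mon: "((\<lambda>t. \<Prod>u\<in>Poly_Mapping.keys m. (w(v := t)) u ^ Poly_Mapping.lookup m u)
      has_field_derivative of_nat (Poly_Mapping.lookup m v) *
        (\<Prod>u\<in>Poly_Mapping.keys (m - Poly_Mapping.single v 1).
           w u ^ Poly_Mapping.lookup (m - Poly_Mapping.single v 1) u)) (at (w v))" for m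
  proof (cases "v \<in> Poly_Mapping.keys m")
    case False
    then have "(\<Prod>u\<in>Poly_Mapping.keys m. (w(v := t)) u ^ Poly_Mapping.lookup m u) =
        (\<Prod>u\<in>Poly_Mapping.keys m. w u ^ Poly_Mapping.lookup m u)" for t
      by (intro prod.cong) auto
    then show ?thesis
      using False by (simp add: in_keys_iff)
  next
    case True
    let ?k = "Poly_Mapping.lookup m v"
    let ?R = "\<Prod>u\<in>Poly_Mapping.keys m - {v}. w u ^ Poly_Mapping.lookup m u"
    have split: "(\<Prod>u\<in>Poly_Mapping.keys m. (w(v := t)) u ^ Poly_Mapping.lookup m u) = t ^ ?k * ?R"
      for t
    proof -
      have "(\<Prod>u\<in>Poly_Mapping.keys m - {v}. (w(v := t)) u ^ Poly_Mapping.lookup m u) = ?R"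
        by (intro prod.cong) auto
      then show ?thesis
        using True by (simp add: prod.remove)
    qed
    have "(\<Prod>u\<in>Poly_Mapping.keys (m - Poly_Mapping.single v 1).
           w u ^ Poly_Mapping.lookup (m - Poly_Mapping.single v 1) u) =
        (\<Prod>u\<in>Poly_Mapping.keys m. w u ^ Poly_Mapping.lookup (m - Poly_Mapping.single v 1) u)"
      by (rule prod.mono_neutral_left) (auto simp: in_keys_iff lookup_minus)
    also have "\<dots> = w v ^ (?k - 1) * ?R"
    proof -
      have "(\<Prod>u\<in>Poly_Mapping.keys m - {v}.
          w u ^ Poly_Mapping.lookup (m - Poly_Mapping.single v 1) u) = ?R"
        by (intro prod.cong) (auto simp: lookup_minus lookup_single when_def)
      then show ?thesis
        using True by (simp add: prod.remove lookup_minus)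
    qed
    finally have "of_nat ?k * (\<Prod>u\<in>Poly_Mapping.keys (m - Poly_Mapping.single v 1).
           w u ^ Poly_Mapping.lookup (m - Poly_Mapping.single v 1) u) =
        of_nat ?k * w v ^ (?k - 1) * ?R"
      by simp
    moreover have "((\<lambda>t. t ^ ?k * ?R) has_field_derivative of_nat ?k * w v ^ (?k - 1) * ?R) (at (w v))"
      by (auto intro!: derivative_eq_intros)
    ultimately show ?thesis
      unfolding split by (simp only:)
  qed
  have "eval_at w (partial_deriv v F) =
      (\<Sum>m\<in>Poly_Mapping.keys F. Poly_Mapping.lookup F m * (of_nat (Poly_Mapping.lookup m v) *
        (\<Prod>u\<in>Poly_Mapping.keys (m - Poly_Mapping.single v 1).
           w u ^ Poly_Mapping.lookup (m - Poly_Mapping.single v 1) u)))"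
    by (simp add: partial_deriv_def eval_at_sum eval_at_single mult_ac)
  moreover have "((\<lambda>t. eval_at (w(v := t)) F) has_field_derivative
      (\<Sum>m\<in>Poly_Mapping.keys F. Poly_Mapping.lookup F m * (of_nat (Poly_Mapping.lookup m v) *
        (\<Prod>u\<in>Poly_Mapping.keys (m - Poly_Mapping.single v 1).
           w u ^ Poly_Mapping.lookup (m - Poly_Mapping.single v 1) u)))) (at (w v))"
    unfolding eval_at_def by (intro DERIV_sum DERIV_cmult mon)
  ultimately show ?thesis
    by (simp only:)
qed

definition power_sum :: "nat \<Rightarrow> 'i set \<Rightarrow> ('i \<Rightarrow> complex) \<Rightarrow> ('i \<Rightarrow> complex) \<Rightarrow> ('i \<Rightarrow> complex) \<Rightarrow> form" where
  "power_sum d A c a b = (\<Sum>i\<in>A. scale (c i) (linear_form (a i) (b i) ^ d))"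

lemma power_sum_in_forms: "power_sum d A c a b \<in> forms 1 d"
  unfolding power_sum_def by (intro forms_sum forms_scale linear_form_power_in_forms)

text \<open>
  Up to the factor \<open>d\<close>, the determinant of the matrix whose rows are the gradient at \<open>(u, v)\<close> of the \<open>d\<close>-th
  power of the linear form \<open>(a, b)\<close>, and \<open>(u, v)\<close> itself.
\<close>

definition twist :: "nat \<Rightarrow> complex \<Rightarrow> complex \<Rightarrow> complex \<Rightarrow> complex \<Rightarrow> complex" where
  "twist d u v a b = (a * u + b * v) ^ (d - 1) * (a * v - b * u)"

lemma eval_at_power_sum:
  "eval_at w (power_sum d A c a b) = (\<Sum>i\<in>A. c i * (a i * w 0 + b i * w 1) ^ d)"
  by (simp add: power_sum_def eval_at_sum eval_at_power eval_at_linear_form)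

lemma partial_deriv_power_sum:
  "eval_at w (partial_deriv 0 (power_sum d A c a b)) =
     (\<Sum>i\<in>A. c i * (of_nat d * (a i * w 0 + b i * w 1) ^ (d - 1) * a i))"
  "eval_at w (partial_deriv 1 (power_sum d A c a b)) =
     (\<Sum>i\<in>A. c i * (of_nat d * (a i * w 0 + b i * w 1) ^ (d - 1) * b i))"
proof -
  have "((\<lambda>t. \<Sum>i\<in>A. c i * (a i * t + b i * w 1) ^ d) has_field_derivative
      (\<Sum>i\<in>A. c i * (of_nat d * (a i * w 0 + b i * w 1) ^ (d - 1) * a i))) (at (w 0))"
    by (intro DERIV_sum DERIV_cmult) (auto intro!: derivative_eq_intros)
  moreover have "((\<lambda>t. \<Sum>i\<in>A. c i * (a i * t + b i * w 1) ^ d) has_field_derivative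
      eval_at w (partial_deriv 0 (power_sum d A c a b))) (at (w 0))"
    using eval_at_partial_deriv[of w 0 "power_sum d A c a b"] by (simp add: eval_at_power_sum)
  ultimately show "eval_at w (partial_deriv 0 (power_sum d A c a b)) =
     (\<Sum>i\<in>A. c i * (of_nat d * (a i * w 0 + b i * w 1) ^ (d - 1) * a i))"
    by (rule DERIV_unique[rotated])
  have "((\<lambda>t. \<Sum>i\<in>A. c i * (a i * w 0 + b i * t) ^ d) has_field_derivative
      (\<Sum>i\<in>A. c i * (of_nat d * (a i * w 0 + b i * w 1) ^ (d - 1) * b i))) (at (w 1))"
    by (intro DERIV_sum DERIV_cmult) (auto intro!: derivative_eq_intros)
  moreover have "((\<lambda>t. \<Sum>i\<in>A. c i * (a i * w 0 + b i * t) ^ d) has_field_derivative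
      eval_at w (partial_deriv 1 (power_sum d A c a b))) (at (w 1))"
    using eval_at_partial_deriv[of w 1 "power_sum d A c a b"] by (simp add: eval_at_power_sum)
  ultimately show "eval_at w (partial_deriv 1 (power_sum d A c a b)) =
     (\<Sum>i\<in>A. c i * (of_nat d * (a i * w 0 + b i * w 1) ^ (d - 1) * b i))"
    by (rule DERIV_unique[rotated])
qed

text \<open>
  The minor of the gradient matrix is additive in the form, so it is the weighted sum of the minors of the
  single powers.
\<close>

lemma eigenvector_power_sum_iff:
  fixes u v :: complex and a b c :: "'i \<Rightarrow> complex" and A :: "'i set"
  assumes "0 < d"
  defines "L \<equiv> linear_form u v" and "F \<equiv> power_sum d A c a b"
  shows "(\<forall>i\<le>1. \<forall>j\<le>1. eval_at (lin_coeff L) (partial_deriv i F) * lin_coeff L j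
         = eval_at (lin_coeff L) (partial_deriv j F) * lin_coeff L i) \<longleftrightarrow>
    (\<Sum>i\<in>A. c i * twist d u v (a i) (b i)) = 0" (is "?E \<longleftrightarrow> ?S = 0")
proof -
  let ?D = "\<lambda>i. eval_at (lin_coeff L) (partial_deriv i F)"
  have "?D 0 * v - ?D 1 * u = of_nat d * ?S"
    unfolding F_def partial_deriv_power_sum
    by (simp add: L_def twist_def sum_distrib_left sum_distrib_right algebra_simps
        flip: sum_subtractf)
  then have "?S = 0 \<longleftrightarrow> ?D 0 * v = ?D 1 * u"
    using assms(1) by auto
  also have "\<dots> \<longleftrightarrow> ?E"
  proof
    assume eq: "?D 0 * v = ?D 1 * u"
    show ?E
    proof (intro allI impI)
      fix i j :: nat assume "i \<le> 1" "j \<le> 1"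
      then have "i = 0 \<or> i = 1" "j = 0 \<or> j = 1" by auto
      then show "?D i * lin_coeff L j = ?D j * lin_coeff L i"
        using eq by (auto simp: L_def)
    qed
  next
    assume E: ?E
    show "?D 0 * v = ?D 1 * u"
      using E[rule_format, of 0 1] by (simp add: L_def)
  qed
  finally show ?thesis by blast
qed

lemma twist_scale_point:
  assumes "0 < d" shows "twist d (k * u) (k * v) a b = k ^ d * twist d u v a b"
proof -
  obtain e where e: "d = Suc e"
    using assms by (cases d) auto
  have "a * (k * u) + b * (k * v) = k * (a * u + b * v)"
    "a * (k * v) - b * (k * u) = k * (a * v - b * u)"
    by (simp_all add: algebra_simps)
  then show ?thesis
    by (simp add: twist_def e power_mult_distrib)
qed

lemma twist_scale_form: "0 < d \<Longrightarrow> twist d u v (k * a) (k * b) = k ^ d * twist d u v a b"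
  using twist_scale_point[of d k u v a b] by (simp add: twist_def ac_simps)

lemma twist_self [simp]: "twist d u v u v = 0"
  by (simp add: twist_def mult.commute)


section \<open>Forms as sums of at most \<open>r\<close> powers\<close>

abbreviation pure_power_sum :: "nat \<Rightarrow> 'i set \<Rightarrow> ('i \<Rightarrow> complex) \<Rightarrow> ('i \<Rightarrow> complex) \<Rightarrow> form" where
  "pure_power_sum d A a b \<equiv> power_sum d A (\<lambda>_. 1) a b"

lemma scale_power_sum: "scale k (power_sum d A c a b) = power_sum d A (\<lambda>i. k * c i) a b"
  by (simp add: power_sum_def cpoly.scale_sum_right)

lemma power_sum_absorb:
  assumes "\<And>i. i \<in> A \<Longrightarrow> z i ^ d = c i"
  shows "power_sum d A c a b = pure_power_sum d A (\<lambda>i. z i * a i) (\<lambda>i. z i * b i)"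
  unfolding power_sum_def
  by (intro sum.cong) (auto simp: linear_form_scaled_power assms)

lemma power_sum_pure:
  assumes "0 < d"
  obtains z where "power_sum d A c a b = pure_power_sum d A (\<lambda>i. z i * a i) (\<lambda>i. z i * b i)"
proof -
  have "\<exists>w. w ^ d = c i" for i
    using exists_complex_root[of d "c i"] assms by (metis not_gr_zero)
  then obtain z where "\<And>i. z i ^ d = c i"
    by metis
  then show ?thesis
    by (intro that[of z] power_sum_absorb)
qed

lemma power_sum_mono_neutral:
  assumes "finite B" "A \<subseteq> B" "\<And>i. i \<in> B - A \<Longrightarrow> c i = 0"
  shows "power_sum d A c a b = power_sum d B c a b"
  unfolding power_sum_def using assms by (intro sum.mono_neutral_left) auto

lemma span_image_sum:
  assumes "finite A" "F \<in> cpoly.span (f ` A)"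
  shows "\<exists>u. F = (\<Sum>i\<in>A. scale (u i) (f i))"
  using assms
proof (induction A arbitrary: F rule: finite_induct)
  case empty
  then show ?case by simp
next
  case (insert x A)
  then obtain k where k: "F - scale k (f x) \<in> cpoly.span (f ` A)"
    by (auto simp: cpoly.span_insert)
  then obtain u where u: "F - scale k (f x) = (\<Sum>i\<in>A. scale (u i) (f i))"
    using insert.IH by blast
  have "(\<Sum>i\<in>A. scale ((u(x := k)) i) (f i)) = (\<Sum>i\<in>A. scale (u i) (f i))"
    using insert.hyps by (intro sum.cong) auto
  then have "F = (\<Sum>i\<in>insert x A. scale ((u(x := k)) i) (f i))"
    using u insert.hyps by (simp add: algebra_simps)
  then show ?case by blast
qed

lemma open_secant_power_sum:
  assumes "0 < d" "q \<in> open_secant 1 d r" "F \<in> q"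
  obtains a b where "F = pure_power_sum d {1..r} a b"
proof -
  obtain p where p: "\<forall>i\<in>{1..r}. p i \<in> veronese 1 d" "q \<subseteq> cpoly.span (\<Union>i\<in>{1..r}. p i)"
    using assms(2) by (auto simp: open_secant_def)
  have "\<exists>a b. p i = proj_pt (linear_form a b ^ d)" if "i \<in> {1..r}" for i
  proof -
    have "p i \<in> veronese 1 d"
      using p(1) that by blast
    then show ?thesis
      unfolding veronese_def mem_Collect_eq by (metis DiffD1 linear_form_cases)
  qed
  then obtain a b where ab: "\<And>i. i \<in> {1..r} \<Longrightarrow> p i = proj_pt (linear_form (a i) (b i) ^ d)"
    by metis
  let ?f = "\<lambda>i. linear_form (a i) (b i) ^ d"
  have "(\<Union>i\<in>{1..r}. p i) \<subseteq> cpoly.span (?f ` {1..r})"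
    using ab by (auto intro: subsetD[OF cpoly.span_mono, rotated])
  then have "F \<in> cpoly.span (?f ` {1..r})"
    using p(2) assms(3) cpoly.span_mono[of "\<Union>i\<in>{1..r}. p i" "cpoly.span (?f ` {1..r})"]
    by (auto simp: cpoly.span_span)
  then obtain c where "F = power_sum d {1..r} c a b"
    using span_image_sum[of "{1..r}" F ?f] by (auto simp: power_sum_def)
  moreover obtain z where "power_sum d {1..r} c a b =
      pure_power_sum d {1..r} (\<lambda>i. z i * a i) (\<lambda>i. z i * b i)"
    by (rule power_sum_pure[OF assms(1)])
  ultimately show ?thesis
    by (intro that) simp
qed

lemma waring_rank_le:
  assumes "F = pure_power_sum d {1..r} a b"
  shows "waring_rank 1 d F \<le> r"
  unfolding waring_rank_def
  by (rule Least_le, rule exI[of _ "\<lambda>i. linear_form (a i) (b i)"])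
    (auto simp: assms power_sum_def linear_form_in_forms[simplified])

definition critical_forms :: "nat \<Rightarrow> nat \<Rightarrow> form set set" where
  "critical_forms d r = {proj_pt F | F. F \<in> forms 1 d - {0} \<and> proj_pt F \<in> open_secant 1 d r \<and>
     waring_locus 1 d F \<inter> eigenpoints 1 F \<noteq> {}}"

lemma critical_waring_variety_eq:
  "critical_waring_variety 1 d r = (zariski 1 d) closure_of critical_forms d r"
  by (simp add: critical_waring_variety_def critical_forms_def)

text \<open>
  The scalars are absorbed into the linear forms by taking \<open>d\<close>-th roots, and the list is padded with zeros
  if the Waring rank is smaller than \<open>r\<close>.  The first linear form is then a multiple of an eigenvector; as
  \<open>twist\<close> is homogeneous in the point, the eigenvector equation holds at the multiple as well, even if it
  is zero.
\<close>

lemma critical_forms_power_sum: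
  assumes "0 < d" "0 < r" and p: "p \<in> critical_forms d r" and "G \<in> p"
  obtains a b where "G = pure_power_sum d {1..r} a b"
    "(\<Sum>i\<in>{2..r}. twist d (a 1) (b 1) (a i) (b i)) = 0"
proof -
  obtain F P where F: "p = proj_pt F" "F \<in> forms 1 d - {0}" "proj_pt F \<in> open_secant 1 d r"
    and P: "P \<in> waring_locus 1 d F" "P \<in> eigenpoints 1 F"
    using p by (auto simp: critical_forms_def)
  obtain k where k: "G = scale k F"
    using assms(4) F(1) by (auto simp: cpoly.span_singleton)
  define R where "R = waring_rank 1 d F"
  obtain a0 b0 where F0: "F = pure_power_sum d {1..r} a0 b0"
    using open_secant_power_sum[OF assms(1) F(3), of F] by (auto intro: cpoly.span_base)
  then have R: "R \<le> r"
    unfolding R_def by (rule waring_rank_le)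
  obtain L M where L: "P = proj_pt L" "L \<in> forms 1 1 - {0}"
    and M: "\<forall>i\<in>{2..R}. M i \<in> forms 1 1"
      "F \<in> cpoly.span (insert (L ^ d) ((\<lambda>i. M i ^ d) ` {2..R}))"
    using P(1) unfolding waring_locus_def R_def by blast
  obtain L' where L': "P = proj_pt L'" "L' \<in> forms 1 1 - {0}"
    and eig: "\<forall>i\<le>1. \<forall>j\<le>1. eval_at (lin_coeff L') (partial_deriv i F) * lin_coeff L' j
      = eval_at (lin_coeff L') (partial_deriv j F) * lin_coeff L' i"
    using P(2) unfolding eigenpoints_def by blast
  obtain u v where uv: "L' = linear_form u v"
    using L'(2) linear_form_cases by blast
  obtain l where l: "L = scale l L'"
    using cpoly.span_base[of L "{L}"] L(1) L'(1) by (auto simp: cpoly.span_singleton)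
  have "\<exists>x y. M i = linear_form x y" if "i \<in> {2..R}" for i
    using M(1) that by (metis linear_form_cases)
  then obtain x y where xy: "\<And>i. i \<in> {2..R} \<Longrightarrow> M i = linear_form (x i) (y i)"
    by metis
  define a1 where "a1 = x(1 := l * u)"
  define b1 where "b1 = y(1 := l * v)"
  let ?f = "\<lambda>i. linear_form (a1 i) (b1 i) ^ d"
  have "insert (L ^ d) ((\<lambda>i. M i ^ d) ` {2..R}) = ?f ` insert 1 {2..R}"
    using xy by (auto simp: a1_def b1_def l uv scale_linear_form image_iff)
  then obtain c where "F = power_sum d (insert 1 {2..R}) c a1 b1"
    using span_image_sum[of "insert 1 {2..R}" F ?f] M(2) by (auto simp: power_sum_def)
  then have "G = power_sum d (insert 1 {2..R}) (\<lambda>i. k * c i) a1 b1"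
    by (simp add: k scale_power_sum)
  also have "\<dots> = power_sum d (insert 1 {2..R})
      (\<lambda>i. if i \<in> insert 1 {2..R} then k * c i else 0) a1 b1"
    by (simp add: power_sum_def)
  also have "\<dots> = power_sum d {1..r} (\<lambda>i. if i \<in> insert 1 {2..R} then k * c i else 0) a1 b1"
    by (rule power_sum_mono_neutral) (use assms(2) R in auto)
  finally have G: "G = power_sum d {1..r} (\<lambda>i. if i \<in> insert 1 {2..R} then k * c i else 0) a1 b1" .
  obtain z where z: "G = pure_power_sum d {1..r} (\<lambda>i. z i * a1 i) (\<lambda>i. z i * b1 i)"
    unfolding G by (rule power_sum_pure[OF assms(1)])
  let ?a = "\<lambda>i. z i * a1 i" and ?b = "\<lambda>i. z i * b1 i"
  have "\<forall>i\<le>1. \<forall>j\<le>1. eval_at (lin_coeff L') (partial_deriv i G) * lin_coeff L' j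
      = eval_at (lin_coeff L') (partial_deriv j G) * lin_coeff L' i"
  proof -
    have "(\<Sum>i\<in>{1..r}. twist d u v (a0 i) (b0 i)) = 0"
      using eig eigenvector_power_sum_iff[OF assms(1), of u v "{1..r}" "\<lambda>_. 1" a0 b0]
      unfolding F0 uv by simp
    then have "(\<Sum>i\<in>{1..r}. k * twist d u v (a0 i) (b0 i)) = 0"
      by (simp flip: sum_distrib_left)
    moreover have "G = power_sum d {1..r} (\<lambda>_. k) a0 b0"
      by (simp add: k F0 scale_power_sum)
    ultimately show ?thesis
      using eigenvector_power_sum_iff[OF assms(1), of u v "{1..r}" "\<lambda>_. k" a0 b0]
      unfolding uv by blast
  qed
  then have "(\<Sum>i\<in>{1..r}. twist d u v (?a i) (?b i)) = 0"
    using eigenvector_power_sum_iff[OF assms(1), of u v "{1..r}" "\<lambda>_. 1" ?a ?b]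
    unfolding z uv by simp
  also have "{1..r} = insert 1 {2..r}"
    using assms(2) by auto
  finally have "twist d u v (?a 1) (?b 1) + (\<Sum>i\<in>{2..r}. twist d u v (?a i) (?b i)) = 0"
    by simp
  moreover have "twist d u v (?a 1) (?b 1) = 0"
    using twist_scale_form[OF assms(1), of u v "z 1 * l" u v]
    by (simp add: a1_def b1_def mult.assoc)
  ultimately have "(\<Sum>i\<in>{2..r}. twist d u v (?a i) (?b i)) = 0"
    by simp
  moreover have "twist d (?a 1) (?b 1) (?a i) (?b i) = (z 1 * l) ^ d * twist d u v (?a i) (?b i)" for i
    using twist_scale_point[OF assms(1), of "z 1 * l" u v "?a i" "?b i"]
    by (simp add: a1_def b1_def mult.assoc)
  ultimately have "(\<Sum>i\<in>{2..r}. twist d (?a 1) (?b 1) (?a i) (?b i)) = 0"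
    by (simp flip: sum_distrib_left)
  then show ?thesis
    using that z by blast
qed


section \<open>Hankel determinants\<close>

text \<open>
  The coefficient of index \<open>k\<close> divided by the binomial coefficient, so that its value at the \<open>d\<close>-th power of
  the linear form \<open>(a, b)\<close> is \<open>a ^ (d - k) * b ^ k\<close>.
\<close>

definition hankel_entry :: "nat \<Rightarrow> nat \<Rightarrow> (nat \<Rightarrow>\<^sub>0 nat) cpoly" where
  "hankel_entry d k =
     Poly_Mapping.single (Poly_Mapping.single (binary_monom d k) 1) (1 / of_nat (d choose k))"

text \<open>
  A minor of the catalecticant matrix, formed from the normalized coefficients of indices \<open>e\<close> to
  \<open>2 * (s - 1) + e\<close>.
\<close>

definition hankel_det :: "nat \<Rightarrow> nat \<Rightarrow> nat \<Rightarrow> (nat \<Rightarrow>\<^sub>0 nat) cpoly" where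
  "hankel_det d s e = Determinant.det (Matrix.mat s s (\<lambda>(i, j). hankel_entry d (i + j + e)))"

lemma eval_hankel_entry:
  assumes "k \<le> d"
  shows "ev (hankel_entry d k) (power_sum d A c a b) =
    (\<Sum>i\<in>A. c i * a i ^ (d - k) * b i ^ k)"
proof -
  have "of_nat (d choose k) \<noteq> (0 :: complex)"
    using assms by simp
  moreover have "ev (hankel_entry d k) (power_sum d A c a b) =
      1 / of_nat (d choose k) * (\<Sum>i\<in>A. c i * (of_nat (d choose k) * a i ^ (d - k) * b i ^ k))"
    unfolding hankel_entry_def eval_at_variable power_sum_def
    by (simp add: lookup_sum lookup_scale lookup_linear_form_power[OF assms])
  ultimately show ?thesis
    by (simp add: sum_distrib_left mult_ac)
qed

lemma eval_hankel_det:
  "ev (hankel_det d s e) F =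
    Determinant.det (Matrix.mat s s (\<lambda>(i, j). ev (hankel_entry d (i + j + e)) F))"
proof -
  interpret comm_ring_hom "\<lambda>G. ev G F"
    by unfold_locales (simp_all add: eval_at_add eval_at_mult)
  have "map_mat (\<lambda>G. ev G F) (Matrix.mat s s (\<lambda>(i, j). hankel_entry d (i + j + e))) =
      Matrix.mat s s (\<lambda>(i, j). ev (hankel_entry d (i + j + e)) F)"
    by (rule eq_matI) auto
  then show ?thesis
    unfolding hankel_det_def by (simp flip: hom_det)
qed

lemma eval_hankel_det_eq_0_iff:
  "ev (hankel_det d s e) F = 0 \<longleftrightarrow>
    (\<exists>v. (\<exists>k<s. v k \<noteq> 0) \<and> (\<forall>j<s. (\<Sum>k<s. ev (hankel_entry d (j + k + e)) F * v k) = 0))"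
    (is "_ \<longleftrightarrow> ?R")
proof -
  let ?M = "Matrix.mat s s (\<lambda>(i, j). ev (hankel_entry d (i + j + e)) F)"
  have row: "vec_index (?M *\<^sub>v v) j = (\<Sum>k<s. ev (hankel_entry d (j + k + e)) F * vec_index v k)"
    if "v \<in> carrier_vec s" "j < s" for v j
    using that by (auto simp: scalar_prod_def lessThan_atLeast0 intro!: sum.cong)
  have "ev (hankel_det d s e) F = 0 \<longleftrightarrow>
      (\<exists>v. v \<in> carrier_vec s \<and> v \<noteq> 0\<^sub>v s \<and> ?M *\<^sub>v v = 0\<^sub>v s)"
    unfolding eval_hankel_det by (rule det_0_iff_vec_prod_zero) simp
  also have "\<dots> \<longleftrightarrow> ?R"
  proof
    assume "\<exists>v. v \<in> carrier_vec s \<and> v \<noteq> 0\<^sub>v s \<and> ?M *\<^sub>v v = 0\<^sub>v s"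
    then obtain v where v: "v \<in> carrier_vec s" "v \<noteq> 0\<^sub>v s" "?M *\<^sub>v v = 0\<^sub>v s"
      by blast
    have "\<exists>k<s. vec_index v k \<noteq> 0"
    proof (rule ccontr)
      assume "\<not> ?thesis"
      then have "v = 0\<^sub>v s"
        using v(1) by (intro eq_vecI) auto
      then show False using v(2) by blast
    qed
    moreover have "(\<Sum>k<s. ev (hankel_entry d (j + k + e)) F * vec_index v k) = 0" if "j < s" for j
      using row[OF v(1) that] v(3) that by simp
    ultimately show ?R
      by (intro exI[of _ "vec_index v"]) blast
  next
    assume ?R
    then obtain v where v: "\<exists>k<s. v k \<noteq> 0"
      "\<forall>j<s. (\<Sum>k<s. ev (hankel_entry d (j + k + e)) F * v k) = 0"
      by blast
    let ?v = "Matrix.vec s v"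
    have "?v \<noteq> 0\<^sub>v s"
      using v(1) by (metis index_vec index_zero_vec(1))
    moreover have "?M *\<^sub>v ?v = 0\<^sub>v s"
    proof (rule eq_vecI)
      fix j assume "j < dim_vec (0\<^sub>v s)"
      then have j: "j < s" by simp
      then show "vec_index (?M *\<^sub>v ?v) j = vec_index (0\<^sub>v s) j"
        using row[of ?v j] v(2) by simp
    qed simp
    ultimately show "\<exists>v. v \<in> carrier_vec s \<and> v \<noteq> 0\<^sub>v s \<and> ?M *\<^sub>v v = 0\<^sub>v s"
      by (intro exI[of _ ?v]) simp
  qed
  finally show ?thesis .
qed

text \<open>
  Multiplying the Hankel matrix of a sum of powers by a vector \<open>v\<close> evaluates the binary form of degree
  \<open>s - 1\<close> with coefficient vector \<open>v\<close> at the linear forms.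
\<close>

lemma hankel_row_power_sum:
  assumes "2 * (s - 1) + e \<le> d" "j < s"
  shows "(\<Sum>k<s. ev (hankel_entry d (j + k + e)) (power_sum d A c a b) * v k) =
    (\<Sum>i\<in>A. c i * b i ^ e * (a i ^ (d - (s - 1) - j - e) * b i ^ j) *
       (\<Sum>k<s. v k * (a i ^ (s - 1 - k) * b i ^ k)))"
proof -
  have "ev (hankel_entry d (j + k + e)) (power_sum d A c a b) * v k =
      (\<Sum>i\<in>A. c i * b i ^ e * (a i ^ (d - (s - 1) - j - e) * b i ^ j) *
         (v k * (a i ^ (s - 1 - k) * b i ^ k)))" if "k < s" for k
  proof -
    have "j + k + e \<le> d"
      using assms that by auto
    moreover have "a i ^ (d - (j + k + e)) = a i ^ (d - (s - 1) - j - e) * a i ^ (s - 1 - k)" for i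
    proof -
      have "d - (j + k + e) = (d - (s - 1) - j - e) + (s - 1 - k)"
        using assms that by auto
      then show ?thesis by (simp only: power_add)
    qed
    ultimately show ?thesis
      by (simp add: eval_hankel_entry power_add sum_distrib_right sum_distrib_left mult_ac)
  qed
  then have "(\<Sum>k<s. ev (hankel_entry d (j + k + e)) (power_sum d A c a b) * v k) =
      (\<Sum>k<s. \<Sum>i\<in>A. c i * b i ^ e * (a i ^ (d - (s - 1) - j - e) * b i ^ j) *
         (v k * (a i ^ (s - 1 - k) * b i ^ k)))"
    by (intro sum.cong) auto
  also have "\<dots> = (\<Sum>i\<in>A. \<Sum>k<s. c i * b i ^ e * (a i ^ (d - (s - 1) - j - e) * b i ^ j) *
         (v k * (a i ^ (s - 1 - k) * b i ^ k)))"
    by (rule sum.swap)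
  finally show ?thesis
    by (simp only: sum_distrib_left)
qed

text \<open>
  The set \<open>A\<close> contains the indices of the powers that contribute to the entries.  There are fewer than \<open>s\<close> of
  them, so some nonzero binary form of degree \<open>s - 1\<close> vanishes at all of them, and its coefficients are in
  the kernel of the matrix.
\<close>

lemma hankel_det_power_sum_eq_0:
  assumes "2 * (s - 1) + e \<le> d" and "finite A" "A \<subseteq> B" "card A < s"
    and "\<And>i. i \<in> B - A \<Longrightarrow> c i * b i ^ e = 0"
  shows "ev (hankel_det d s e) (power_sum d B c a b) = 0"
proof -
  obtain v where v: "\<exists>k\<in>{..<s}. v k \<noteq> 0"
    "\<forall>i\<in>A. (\<Sum>k\<in>{..<s}. v k * (a i ^ (s - 1 - k) * b i ^ k)) = 0"
    using linear_system_nontrivial_solution[of A "{..<s}" "\<lambda>k i. a i ^ (s - 1 - k) * b i ^ k"]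
      assms by auto
  have "(\<Sum>k<s. ev (hankel_entry d (j + k + e)) (power_sum d B c a b) * v k) = 0" if "j < s" for j
    unfolding hankel_row_power_sum[OF assms(1) that]
  proof (rule sum.neutral, rule ballI)
    fix i assume "i \<in> B"
    then show "c i * b i ^ e * (a i ^ (d - (s - 1) - j - e) * b i ^ j) *
       (\<Sum>k<s. v k * (a i ^ (s - 1 - k) * b i ^ k)) = 0"
      using v(2) assms(5)[of i] by (cases "i \<in> A") auto
  qed
  then show ?thesis
    unfolding eval_hankel_det_eq_0_iff using v(1) by blast
qed

lemma hankel_det_0 [simp]:
  assumes "2 * (s - 1) + e \<le> d" "0 < s" shows "ev (hankel_det d s e) 0 = 0"
  using hankel_det_power_sum_eq_0[OF assms(1), of "{}" "{}"] assms(2) by (simp add: power_sum_def)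

text \<open>
  A kernel vector would be the coefficient vector of a polynomial of degree less than \<open>s\<close>.  Pairing the rows
  with the coefficients of the polynomials that vanish at all but one of the \<open>s\<close> points shows that it
  vanishes at every point, hence is zero.
\<close>

lemma hankel_det_power_sum_neq_0:
  assumes d: "2 * (s - 1) + e \<le> d" and A: "finite A" "card A = s"
    and a: "\<And>i. i \<in> A \<Longrightarrow> a i = 1" and b: "inj_on b A"
    and c: "\<And>i. i \<in> A \<Longrightarrow> c i * b i ^ e \<noteq> 0"
  shows "ev (hankel_det d s e) (power_sum d A c a b) \<noteq> 0"
proof
  assume "ev (hankel_det d s e) (power_sum d A c a b) = 0"
  then obtain v where v: "\<exists>k<s. v k \<noteq> 0"
    "\<And>j. j < s \<Longrightarrow> (\<Sum>k<s. ev (hankel_entry d (j + k + e)) (power_sum d A c a b) * v k) = 0"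
    unfolding eval_hankel_det_eq_0_iff by blast
  define P where "P = (\<Sum>k<s. monom (v k) k)"
  have poly_P: "poly P x = (\<Sum>k<s. v k * x ^ k)" for x
    by (simp add: P_def poly_sum poly_monom)
  have coeff_P: "coeff P k = (if k < s then v k else 0)" for k
    by (simp add: P_def coeff_sum)
  have row: "(\<Sum>i\<in>A. c i * b i ^ e * poly P (b i) * b i ^ j) = 0" if "j < s" for j
  proof -
    have "(\<Sum>i\<in>A. c i * b i ^ e * poly P (b i) * b i ^ j) =
        (\<Sum>i\<in>A. c i * b i ^ e * (a i ^ (d - (s - 1) - j - e) * b i ^ j) *
           (\<Sum>k<s. v k * (a i ^ (s - 1 - k) * b i ^ k)))"
      by (intro sum.cong) (auto simp: a poly_P mult_ac)
    then show ?thesis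
      using v(2)[OF that] hankel_row_power_sum[OF d that, of A c a b v] by (simp only:)
  qed
  have root: "poly P (b i0) = 0" if i0: "i0 \<in> A" for i0
  proof -
    define Q where "Q = (\<Prod>i\<in>A - {i0}. [:- b i, 1:])"
    have "degree Q \<le> (\<Sum>i\<in>A - {i0}. degree [:- b i, 1:])"
      unfolding Q_def using degree_prod_sum_le[of "A - {i0}" "\<lambda>i. [:- b i, 1:]"] A(1)
      by (simp add: o_def)
    also have "\<dots> < s"
      using A i0 card_Diff1_less[of A i0] by simp
    finally have deg: "degree Q < s" .
    have poly_Q: "poly Q x = (\<Sum>j<s. coeff Q j * x ^ j)" for x
      unfolding poly_altdef
      by (rule sum.mono_neutral_left) (use deg in \<open>auto simp: coeff_eq_0\<close>)
    have "0 = (\<Sum>j<s. coeff Q j * (\<Sum>i\<in>A. c i * b i ^ e * poly P (b i) * b i ^ j))"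
      using row by simp
    also have "\<dots> = (\<Sum>j<s. \<Sum>i\<in>A. c i * b i ^ e * poly P (b i) * (coeff Q j * b i ^ j))"
      by (simp add: sum_distrib_left mult_ac)
    also have "\<dots> = (\<Sum>i\<in>A. \<Sum>j<s. c i * b i ^ e * poly P (b i) * (coeff Q j * b i ^ j))"
      by (rule sum.swap)
    also have "\<dots> = (\<Sum>i\<in>A. c i * b i ^ e * poly P (b i) * poly Q (b i))"
      by (simp add: poly_Q sum_distrib_left)
    also have "\<dots> = c i0 * b i0 ^ e * poly P (b i0) * poly Q (b i0) +
        (\<Sum>i\<in>A - {i0}. c i * b i ^ e * poly P (b i) * poly Q (b i))"
      using A(1) i0 by (simp add: sum.remove)
    also have "(\<Sum>i\<in>A - {i0}. c i * b i ^ e * poly P (b i) * poly Q (b i)) = 0"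
    proof (rule sum.neutral, rule ballI)
      fix i assume "i \<in> A - {i0}"
      then have "poly Q (b i) = 0"
        unfolding Q_def poly_prod using A(1) by (intro prod_zero) auto
      then show "c i * b i ^ e * poly P (b i) * poly Q (b i) = 0" by simp
    qed
    finally have "c i0 * b i0 ^ e * poly P (b i0) * poly Q (b i0) = 0" by simp
    moreover have "poly Q (b i0) \<noteq> 0"
      unfolding Q_def poly_prod using A(1) b i0 by (auto simp: inj_on_def)
    ultimately show ?thesis
      using c[OF i0] by (metis mult_eq_0_iff)
  qed
  obtain k where k: "k < s" "v k \<noteq> 0"
    using v(1) by blast
  then have "P \<noteq> 0"
    using coeff_P[of k] by auto
  have "s = card (b ` A)"
    using A b by (simp add: card_image)
  also have "\<dots> \<le> card {x. poly P x = 0}"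
    using root by (intro card_mono poly_roots_finite \<open>P \<noteq> 0\<close>) auto
  also have "\<dots> \<le> degree P"
    using \<open>P \<noteq> 0\<close> by (rule card_poly_roots_bound)
  also have "degree P \<le> s - 1"
    using k(1) by (intro degree_le) (auto simp: coeff_P)
  finally show False
    using k(1) by simp
qed


section \<open>Irreducible families in the secant variety\<close>

lemma polyfun_power_sum:
  assumes "\<And>i. i \<in> A \<Longrightarrow> (\<lambda>p. c p i) \<in> polyfun X" "\<And>i. i \<in> A \<Longrightarrow> (\<lambda>p. a p i) \<in> polyfun X"
    "\<And>i. i \<in> A \<Longrightarrow> (\<lambda>p. b p i) \<in> polyfun X"
  shows "(\<lambda>p. Poly_Mapping.lookup (power_sum d A (c p) (a p) (b p)) m) \<in> polyfun X"
  unfolding power_sum_def lookup_sum lookup_scale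
  by (intro polyfun_sum polyfun.mult polyfun_linear_form_power assms)

definition lerp :: "complex \<Rightarrow> ('i \<Rightarrow> complex) \<Rightarrow> ('i \<Rightarrow> complex) \<Rightarrow> 'i \<Rightarrow> complex" where
  "lerp t x y i = (1 - t) * x i + t * y i"

lemma lerp_ends [simp]: "lerp 0 x y = x" "lerp 1 x y = y"
  by (auto simp: lerp_def)

lemma polyfun_lerp: "(\<lambda>t. lerp t x y i) \<in> polyfun {\<lambda>t. t}"
  unfolding lerp_def by (intro polyfun_intros) auto

lemma lerp_const: "x i = z \<Longrightarrow> y i = z \<Longrightarrow> lerp t x y i = z"
  by (simp add: lerp_def algebra_simps)

definition secant_family :: "nat \<Rightarrow> nat \<Rightarrow> form set" where
  "secant_family d s = {power_sum d {1..s} c a b | c a b. True}"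

text \<open>
  The last linear form is fixed to be \<open>x\<^sub>0\<close>; its coefficient is free.
\<close>

definition secant_half_family :: "nat \<Rightarrow> nat \<Rightarrow> form set" where
  "secant_half_family d s =
     {power_sum d {1..Suc s} c a b | c a b. a (Suc s) = 1 \<and> b (Suc s) = 0}"

lemma secant_family_forms: "secant_family d s \<subseteq> forms 1 d"
  using power_sum_in_forms by (auto simp: secant_family_def)

lemma secant_half_family_forms: "secant_half_family d s \<subseteq> forms 1 d"
  using power_sum_in_forms by (auto simp: secant_half_family_def)

lemma secant_family_scale: "F \<in> secant_family d s \<Longrightarrow> scale k F \<in> secant_family d s"
  unfolding secant_family_def using scale_power_sum by blast

lemma secant_half_family_scale:
  "F \<in> secant_half_family d s \<Longrightarrow> scale k F \<in> secant_half_family d s"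
  unfolding secant_half_family_def using scale_power_sum by blast

lemma hankel_det_secant_family:
  assumes "2 * s \<le> d" "F \<in> secant_family d s"
  shows "ev (hankel_det d (Suc s) 0) F = 0"
proof -
  obtain c a b where "F = power_sum d {1..s} c a b"
    using assms(2) by (auto simp: secant_family_def)
  then show ?thesis
    using hankel_det_power_sum_eq_0[of "Suc s" 0 d "{1..s}" "{1..s}"] assms(1) by simp
qed

lemma hankel_det_secant_half_family:
  assumes "2 * s + 1 \<le> d" "F \<in> secant_half_family d s"
  shows "ev (hankel_det d (Suc s) 1) F = 0"
proof -
  obtain c a b where "F = power_sum d {1..Suc s} c a b" "b (Suc s) = 0"
    using assms(2) by (auto simp: secant_half_family_def)
  moreover have "{1..Suc s} - {1..s} = {Suc s}"
    by auto
  ultimately show ?thesis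
    using hankel_det_power_sum_eq_0[of "Suc s" 1 d "{1..s}" "{1..Suc s}" c b a] assms(1) by auto
qed

lemma poly_connected_secant_family: "poly_connected (secant_family d s)"
  unfolding poly_connected_def
proof (intro ballI)
  fix F1 F2 assume "F1 \<in> secant_family d s" "F2 \<in> secant_family d s"
  then obtain c1 a1 b1 c2 a2 b2 where F: "F1 = power_sum d {1..s} c1 a1 b1"
    "F2 = power_sum d {1..s} c2 a2 b2"
    by (auto simp: secant_family_def)
  let ?H = "\<lambda>t. power_sum d {1..s} (lerp t c1 c2) (lerp t a1 a2) (lerp t b1 b2)"
  have "?H t \<in> secant_family d s" for t
    unfolding secant_family_def by blast
  moreover have "(\<lambda>t. Poly_Mapping.lookup (?H t) m) \<in> polyfun {\<lambda>t. t}" for m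
    by (intro polyfun_power_sum polyfun_lerp)
  ultimately show "\<exists>H. (\<forall>t. H t \<in> secant_family d s) \<and> H 0 = F1 \<and> H 1 = F2 \<and>
      (\<forall>m. (\<lambda>t. Poly_Mapping.lookup (H t) m) \<in> polyfun {\<lambda>t. t})"
    by (intro exI[of _ ?H]) (simp add: F)
qed

lemma poly_connected_secant_half_family: "poly_connected (secant_half_family d s)"
  unfolding poly_connected_def
proof (intro ballI)
  fix F1 F2 assume "F1 \<in> secant_half_family d s" "F2 \<in> secant_half_family d s"
  then obtain c1 a1 b1 c2 a2 b2 where F: "F1 = power_sum d {1..Suc s} c1 a1 b1"
    "F2 = power_sum d {1..Suc s} c2 a2 b2" "a1 (Suc s) = 1" "b1 (Suc s) = 0"
    "a2 (Suc s) = 1" "b2 (Suc s) = 0"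
    unfolding secant_half_family_def by blast
  let ?H = "\<lambda>t. power_sum d {1..Suc s} (lerp t c1 c2) (lerp t a1 a2) (lerp t b1 b2)"
  have "lerp t a1 a2 (Suc s) = 1" "lerp t b1 b2 (Suc s) = 0" for t
    by (rule lerp_const, fact, fact)+
  then have "?H t \<in> secant_half_family d s" for t
    unfolding secant_half_family_def by blast
  moreover have "(\<lambda>t. Poly_Mapping.lookup (?H t) m) \<in> polyfun {\<lambda>t. t}" for m
    by (intro polyfun_power_sum polyfun_lerp)
  ultimately show "\<exists>H. (\<forall>t. H t \<in> secant_half_family d s) \<and> H 0 = F1 \<and> H 1 = F2 \<and>
      (\<forall>m. (\<lambda>t. Poly_Mapping.lookup (H t) m) \<in> polyfun {\<lambda>t. t})"
    by (intro exI[of _ ?H]) (simp add: F)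
qed

lemma secant_family_subset_half: "secant_family d s \<subseteq> secant_half_family d s"
proof
  fix F assume "F \<in> secant_family d s"
  then obtain c a b where F: "F = power_sum d {1..s} c a b"
    by (auto simp: secant_family_def)
  let ?c = "c(Suc s := 0)" and ?a = "a(Suc s := 1)" and ?b = "b(Suc s := 0)"
  have "power_sum d {1..s} c a b = power_sum d {1..s} ?c ?a ?b"
    unfolding power_sum_def by (intro sum.cong) auto
  also have "\<dots> = power_sum d {1..Suc s} ?c ?a ?b"
    by (rule power_sum_mono_neutral) auto
  finally show "F \<in> secant_half_family d s"
    unfolding F secant_half_family_def
    by (intro CollectI exI[of _ ?c] exI[of _ ?a] exI[of _ ?b]) simp
qed

lemma secant_half_family_subset: "secant_half_family d s \<subseteq> secant_family d (Suc s)"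
  by (auto simp: secant_half_family_def secant_family_def)

lemma secant_half_family_generic:
  assumes "2 * s \<le> d"
  shows "\<exists>F\<in>secant_half_family d s. ev (hankel_det d (Suc s) 0) F \<noteq> 0"
proof -
  let ?b = "\<lambda>i. if i = Suc s then 0 else of_nat i :: complex"
  let ?F = "power_sum d {1..Suc s} (\<lambda>_. 1) (\<lambda>_. 1) ?b"
  have "inj_on ?b {1..Suc s}"
    by (auto simp: inj_on_def)
  then have "ev (hankel_det d (Suc s) 0) ?F \<noteq> 0"
    using assms by (intro hankel_det_power_sum_neq_0) auto
  moreover have "?F \<in> secant_half_family d s"
    unfolding secant_half_family_def
    by (intro CollectI exI[of _ "\<lambda>_. 1"] exI[of _ ?b]) simp
  ultimately show ?thesis by blast
qed

lemma secant_family_generic: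
  assumes "2 * s + 1 \<le> d"
  shows "\<exists>F\<in>secant_family d (Suc s). ev (hankel_det d (Suc s) 1) F \<noteq> 0"
proof -
  let ?F = "power_sum d {1..Suc s} (\<lambda>_. 1) (\<lambda>_. 1) of_nat"
  have "ev (hankel_det d (Suc s) 1) ?F \<noteq> 0"
    using assms by (intro hankel_det_power_sum_neq_0) (auto simp: inj_on_def)
  moreover have "?F \<in> secant_family d (Suc s)"
    by (auto simp: secant_family_def)
  ultimately show ?thesis by blast
qed

lemma hankel_det_neq_0_form:
  assumes "ev (hankel_det d (Suc s) e) F \<noteq> 0" "2 * s + e \<le> d"
  shows "F \<noteq> 0"
  using assms hankel_det_0[of "Suc s" e d] by auto

text \<open>
  The chains alternate between two kinds of steps.  In the first kind, sums of \<open>s\<close> powers are enlarged by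
  multiples of the fixed power, and the unshifted Hankel determinant separates.
\<close>

lemma chain_add_fixed_power:
  assumes "irreducible_chain 1 d k (proj_closure 1 d K)"
    and "poly_connected K'" "K \<subseteq> K'" "K' \<subseteq> forms 1 d" "K \<subseteq> secant_family d s"
    and d: "2 * s \<le> d" and F: "\<exists>F\<in>K'. ev (hankel_det d (Suc s) 0) F \<noteq> 0"
  shows "irreducible_chain 1 d (Suc k) (proj_closure 1 d K')"
proof -
  obtain F where F: "F \<in> K'" "ev (hankel_det d (Suc s) 0) F \<noteq> 0"
    using F by blast
  moreover have "F \<noteq> 0"
    using hankel_det_neq_0_form[OF F(2)] d by simp
  ultimately show ?thesis
    using secant_family_scale hankel_det_secant_family[OF d]
    by (intro irreducible_chain_extend[OF assms(1-5)])
qed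

text \<open>
  In the second kind, the fixed power becomes an arbitrary one, and the Hankel determinant shifted by one
  separates, since it does not involve the only nonzero coefficient of the fixed power.
\<close>

lemma chain_move_fixed_power:
  assumes "irreducible_chain 1 d k (proj_closure 1 d K)"
    and "poly_connected K'" "K \<subseteq> K'" "K' \<subseteq> forms 1 d" "K \<subseteq> secant_half_family d s"
    and d: "2 * s + 1 \<le> d" and F: "\<exists>F\<in>K'. ev (hankel_det d (Suc s) 1) F \<noteq> 0"
  shows "irreducible_chain 1 d (Suc k) (proj_closure 1 d K')"
proof -
  obtain F where F: "F \<in> K'" "ev (hankel_det d (Suc s) 1) F \<noteq> 0"
    using F by blast
  moreover have "F \<noteq> 0"
    using hankel_det_neq_0_form[OF F(2)] d by simp
  ultimately show ?thesis
    using secant_half_family_scale hankel_det_secant_half_family[OF d]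
    by (intro irreducible_chain_extend[OF assms(1-5)])
qed

lemma chain_fixed_power:
  "irreducible_chain 1 d 0 (proj_closure 1 d (secant_half_family d 0))"
proof -
  obtain F where F: "F \<in> secant_half_family d 0" "ev (hankel_det d (Suc 0) 0) F \<noteq> 0"
    using secant_half_family_generic[of 0 d] by auto
  then have "F \<noteq> 0"
    using hankel_det_neq_0_form[OF F(2)] by simp
  then show ?thesis
    using irreducible_chain_proj_closure poly_connected_secant_half_family
      secant_half_family_forms F(1) by blast
qed

lemma chain_secant_family:
  assumes "2 * s + 1 \<le> d"
  shows "irreducible_chain 1 d (2 * s + 1) (proj_closure 1 d (secant_family d (Suc s)))"
  using assms
proof (induction s)
  case 0
  have "irreducible_chain 1 d (Suc 0) (proj_closure 1 d (secant_family d (Suc 0)))"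
    by (rule chain_move_fixed_power[OF chain_fixed_power poly_connected_secant_family
          secant_half_family_subset secant_family_forms order_refl])
      (use 0 secant_family_generic[of 0 d] in auto)
  then show ?case by simp
next
  case (Suc s)
  have "irreducible_chain 1 d (2 * s + 1) (proj_closure 1 d (secant_family d (Suc s)))"
    using Suc by simp
  then have "irreducible_chain 1 d (Suc (2 * s + 1))
      (proj_closure 1 d (secant_half_family d (Suc s)))"
    by (rule chain_add_fixed_power[OF _ poly_connected_secant_half_family
          secant_family_subset_half secant_half_family_forms order_refl])
      (use Suc.prems secant_half_family_generic[of "Suc s" d] in auto)
  then have "irreducible_chain 1 d (Suc (Suc (2 * s + 1)))
      (proj_closure 1 d (secant_family d (Suc (Suc s))))"
    by (rule chain_move_fixed_power[OF _ poly_connected_secant_family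
          secant_half_family_subset secant_family_forms order_refl])
      (use Suc.prems secant_family_generic[of "Suc s" d] in auto)
  then show ?case by simp
qed


section \<open>Irreducible families in the critical Waring variety\<close>

text \<open>
  A polynomial solution of the eigenvector equation, which is linear in the coefficients of the powers:
  for \<open>i \<ge> 3\<close> the free parameters are multiplied by the weight of the second power in the equation, and
  the coefficient of the second power compensates them.  The first coefficient is free.
\<close>

definition critical_coeff ::
    "nat \<Rightarrow> nat \<Rightarrow> (nat \<Rightarrow> complex) \<Rightarrow> (nat \<Rightarrow> complex) \<Rightarrow> (nat \<Rightarrow> complex) \<Rightarrow> nat \<Rightarrow> complex" where
  "critical_coeff d s c a b i =
     (if i = 1 then c 1
      else if i = 2 then - (\<Sum>j\<in>{3..s}. c j * twist d (a 1) (b 1) (a j) (b j))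
      else c i * twist d (a 1) (b 1) (a 2) (b 2))"

definition critical_family :: "nat \<Rightarrow> nat \<Rightarrow> form set" where
  "critical_family d s = {power_sum d {1..s} (critical_coeff d s c a b) a b | c a b. True}"

definition critical_half_family :: "nat \<Rightarrow> nat \<Rightarrow> form set" where
  "critical_half_family d s =
     {power_sum d {1..Suc s} (critical_coeff d (Suc s) c a b) a b | c a b.
        a (Suc s) = 1 \<and> b (Suc s) = 0}"

text \<open>
  The linear forms \<open>(u, v)\<close> and \<open>(- v, u)\<close> are orthogonal, so the first one is an eigenvector.  The factor \<open>twist d u v 1 0\<close> in the second
  coefficient makes every member a member of the next family, in which the third power is the fixed one.
\<close>

definition orthogonal_family :: "nat \<Rightarrow> form set" where
  "orthogonal_family d =
     {power_sum d {1..2::nat} (\<lambda>i. if i = 1 then k else l * twist d u v 1 0)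
        (\<lambda>i. if i = 1 then u else - v) (\<lambda>i. if i = 1 then v else u) | k l u v. True}"

lemma critical_family_forms: "critical_family d s \<subseteq> forms 1 d"
  using power_sum_in_forms by (auto simp: critical_family_def)

lemma critical_half_family_forms: "critical_half_family d s \<subseteq> forms 1 d"
  using power_sum_in_forms by (auto simp: critical_half_family_def)

lemma orthogonal_family_forms: "orthogonal_family d \<subseteq> forms 1 d"
  using power_sum_in_forms by (auto simp: orthogonal_family_def)

lemma critical_coeff_condition:
  "2 \<le> s \<Longrightarrow>
    (\<Sum>i\<in>{2..s}. critical_coeff d s c a b i * twist d (a 1) (b 1) (a i) (b i)) = 0"
proof -
  assume "2 \<le> s"
  then have "{2..s} = insert 2 {3..s}" by auto
  then have "(\<Sum>i\<in>{2..s}. critical_coeff d s c a b i * twist d (a 1) (b 1) (a i) (b i)) =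
      critical_coeff d s c a b 2 * twist d (a 1) (b 1) (a 2) (b 2) +
      (\<Sum>i\<in>{3..s}. critical_coeff d s c a b i * twist d (a 1) (b 1) (a i) (b i))"
    by simp
  also have "(\<Sum>i\<in>{3..s}. critical_coeff d s c a b i * twist d (a 1) (b 1) (a i) (b i)) =
      (\<Sum>i\<in>{3..s}. c i * twist d (a 1) (b 1) (a i) (b i)) * twist d (a 1) (b 1) (a 2) (b 2)"
    unfolding sum_distrib_right
    by (intro sum.cong) (auto simp: critical_coeff_def)
  finally show ?thesis
    by (simp add: critical_coeff_def)
qed

lemma critical_half_family_subset: "critical_half_family d s \<subseteq> critical_family d (Suc s)"
  by (auto simp: critical_half_family_def critical_family_def)

lemma critical_family_subset_half:
  assumes "2 \<le> s" shows "critical_family d s \<subseteq> critical_half_family d s"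
proof
  fix F assume "F \<in> critical_family d s"
  then obtain c a b where F: "F = power_sum d {1..s} (critical_coeff d s c a b) a b"
    by (auto simp: critical_family_def)
  let ?c = "c(Suc s := 0)" and ?a = "a(Suc s := 1)" and ?b = "b(Suc s := 0)"
  have ev3: "{3..Suc s} = insert (Suc s) {3..s}"
    using assms by auto
  have coeff: "critical_coeff d (Suc s) ?c ?a ?b i = (if i = Suc s then 0 else critical_coeff d s c a b i)"
    if "i \<in> {1..Suc s}" for i
  proof -
    have "(\<Sum>j\<in>{3..s}. ?c j * twist d (a 1) (b 1) (?a j) (?b j)) =
        (\<Sum>j\<in>{3..s}. c j * twist d (a 1) (b 1) (a j) (b j))"
      by (intro sum.cong) auto
    then show ?thesis
      using assms that by (simp add: critical_coeff_def ev3)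
  qed
  have "power_sum d {1..s} (critical_coeff d s c a b) a b =
      power_sum d {1..s} (critical_coeff d (Suc s) ?c ?a ?b) ?a ?b"
    unfolding power_sum_def using coeff by (intro sum.cong) auto
  also have "\<dots> = power_sum d {1..Suc s} (critical_coeff d (Suc s) ?c ?a ?b) ?a ?b"
    by (rule power_sum_mono_neutral) (use coeff in auto)
  finally show "F \<in> critical_half_family d s"
    unfolding F critical_half_family_def
    by (intro CollectI exI[of _ ?c] exI[of _ ?a] exI[of _ ?b]) simp
qed

lemma orthogonal_family_subset_half:
  assumes "2 \<le> d" shows "orthogonal_family d \<subseteq> critical_half_family d 2"
proof
  fix F assume "F \<in> orthogonal_family d"
  then obtain k l u v where
    F: "F = power_sum d {1..2::nat} (\<lambda>i. if i = 1 then k else l * twist d u v 1 0)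
        (\<lambda>i. if i = 1 then u else - v) (\<lambda>i. if i = 1 then v else u)"
    by (auto simp: orthogonal_family_def)
  let ?c = "\<lambda>i::nat. if i = 1 then k else - l"
  let ?a = "\<lambda>i::nat. if i = 1 then u else if i = 2 then - v else 1"
  let ?b = "\<lambda>i::nat. if i = 1 then v else if i = 2 then u else 0"
  have sets: "{1..2} = {1, 2::nat}" "{1..3} = {1, 2, 3::nat}" "{3..3} = {3::nat}"
    by auto
  have "twist d u v (- v) u = 0"
    using assms by (simp add: twist_def mult.commute power_0_left)
  then have "power_sum d {1..3} (critical_coeff d 3 ?c ?a ?b) ?a ?b = F"
    unfolding F power_sum_def sets by (simp add: critical_coeff_def sets)
  then show "F \<in> critical_half_family d 2"
    unfolding critical_half_family_def
    by (intro CollectI exI[of _ ?c] exI[of _ ?a] exI[of _ ?b]) (simp add: numeral_3_eq_3)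
qed

lemma secant_family_1_subset_orthogonal: "secant_family d 1 \<subseteq> orthogonal_family d"
proof
  fix F assume "F \<in> secant_family d 1"
  then obtain c a b where F: "F = power_sum d {1..1::nat} c a b"
    unfolding secant_family_def by blast
  have sets: "{1..2} = {1, 2::nat}"
    by auto
  have "F = power_sum d {1..2::nat} (\<lambda>i. if i = 1 then c 1 else 0 * twist d (a 1) (b 1) 1 0)
        (\<lambda>i. if i = 1 then a 1 else - b 1) (\<lambda>i. if i = 1 then b 1 else a 1)"
    unfolding F power_sum_def sets by simp
  then show "F \<in> orthogonal_family d"
    unfolding orthogonal_family_def by blast
qed

lemma critical_family_subset_secant: "critical_family d s \<subseteq> secant_family d s"
  by (auto simp: critical_family_def secant_family_def)

lemma critical_half_family_subset_secant: "critical_half_family d s \<subseteq> secant_half_family d s"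
  unfolding critical_half_family_def secant_half_family_def by blast

lemma orthogonal_family_subset_secant: "orthogonal_family d \<subseteq> secant_family d 2"
  unfolding orthogonal_family_def secant_family_def by blast

lemma polyfun_twist:
  assumes "u \<in> polyfun X" "v \<in> polyfun X" "a \<in> polyfun X" "b \<in> polyfun X"
  shows "(\<lambda>p. twist d (u p) (v p) (a p) (b p)) \<in> polyfun X"
  unfolding twist_def by (intro polyfun_intros assms)

lemma polyfun_critical_coeff:
  "(\<lambda>t. critical_coeff d s (lerp t c1 c2) (lerp t a1 a2) (lerp t b1 b2) i) \<in> polyfun {\<lambda>t. t}"
proof (cases "i = 1 \<or> i = 2")
  case True
  then show ?thesis
    unfolding critical_coeff_def
    by (auto intro!: polyfun_minus polyfun_sum polyfun.mult polyfun_twist polyfun_lerp)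
next
  case False
  then show ?thesis
    unfolding critical_coeff_def
    by (auto intro!: polyfun.mult polyfun_twist polyfun_lerp)
qed

lemma poly_connected_critical_family: "poly_connected (critical_family d s)"
  unfolding poly_connected_def
proof (intro ballI)
  fix F1 F2 assume "F1 \<in> critical_family d s" "F2 \<in> critical_family d s"
  then obtain c1 a1 b1 c2 a2 b2 where F: "F1 = power_sum d {1..s} (critical_coeff d s c1 a1 b1) a1 b1"
    "F2 = power_sum d {1..s} (critical_coeff d s c2 a2 b2) a2 b2"
    by (auto simp: critical_family_def)
  let ?H = "\<lambda>t. power_sum d {1..s} (critical_coeff d s (lerp t c1 c2) (lerp t a1 a2) (lerp t b1 b2))
    (lerp t a1 a2) (lerp t b1 b2)"
  have "?H t \<in> critical_family d s" for t
    unfolding critical_family_def by blast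
  moreover have "(\<lambda>t. Poly_Mapping.lookup (?H t) m) \<in> polyfun {\<lambda>t. t}" for m
    by (intro polyfun_power_sum polyfun_lerp polyfun_critical_coeff)
  ultimately show "\<exists>H. (\<forall>t. H t \<in> critical_family d s) \<and> H 0 = F1 \<and> H 1 = F2 \<and>
      (\<forall>m. (\<lambda>t. Poly_Mapping.lookup (H t) m) \<in> polyfun {\<lambda>t. t})"
    by (intro exI[of _ ?H]) (simp add: F)
qed

lemma poly_connected_critical_half_family: "poly_connected (critical_half_family d s)"
  unfolding poly_connected_def
proof (intro ballI)
  fix F1 F2 assume "F1 \<in> critical_half_family d s" "F2 \<in> critical_half_family d s"
  then obtain c1 a1 b1 c2 a2 b2 where
    F: "F1 = power_sum d {1..Suc s} (critical_coeff d (Suc s) c1 a1 b1) a1 b1"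
    "F2 = power_sum d {1..Suc s} (critical_coeff d (Suc s) c2 a2 b2) a2 b2"
    "a1 (Suc s) = 1" "b1 (Suc s) = 0" "a2 (Suc s) = 1" "b2 (Suc s) = 0"
    unfolding critical_half_family_def by blast
  let ?H = "\<lambda>t. power_sum d {1..Suc s}
    (critical_coeff d (Suc s) (lerp t c1 c2) (lerp t a1 a2) (lerp t b1 b2))
    (lerp t a1 a2) (lerp t b1 b2)"
  have "lerp t a1 a2 (Suc s) = 1" "lerp t b1 b2 (Suc s) = 0" for t
    by (rule lerp_const, fact, fact)+
  then have "?H t \<in> critical_half_family d s" for t
    unfolding critical_half_family_def by blast
  moreover have "(\<lambda>t. Poly_Mapping.lookup (?H t) m) \<in> polyfun {\<lambda>t. t}" for m
    by (intro polyfun_power_sum polyfun_lerp polyfun_critical_coeff)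
  ultimately show "\<exists>H. (\<forall>t. H t \<in> critical_half_family d s) \<and> H 0 = F1 \<and> H 1 = F2 \<and>
      (\<forall>m. (\<lambda>t. Poly_Mapping.lookup (H t) m) \<in> polyfun {\<lambda>t. t})"
    by (intro exI[of _ ?H]) (simp add: F)
qed

lemma poly_connected_orthogonal_family: "poly_connected (orthogonal_family d)"
  unfolding poly_connected_def
proof (intro ballI)
  fix F1 F2 assume "F1 \<in> orthogonal_family d" "F2 \<in> orthogonal_family d"
  define \<Psi> where "\<Psi> = (\<lambda>x :: nat \<Rightarrow> complex.
     power_sum d {1..2::nat} (\<lambda>i. if i = 1 then x 0 else x 1 * twist d (x 2) (x 3) 1 0)
        (\<lambda>i. if i = 1 then x 2 else - x 3) (\<lambda>i. if i = 1 then x 3 else x 2))"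
  have family: "orthogonal_family d = range \<Psi>"
  proof (intro equalityI subsetI)
    fix F assume "F \<in> orthogonal_family d"
    then obtain k l u v where
      "F = power_sum d {1..2::nat} (\<lambda>i. if i = 1 then k else l * twist d u v 1 0)
        (\<lambda>i. if i = 1 then u else - v) (\<lambda>i. if i = 1 then v else u)"
      by (auto simp: orthogonal_family_def)
    then have "F = \<Psi> (\<lambda>i. if i = 0 then k else if i = 1 then l else if i = 2 then u else v)"
      by (simp add: \<Psi>_def)
    then show "F \<in> range \<Psi>" by blast
  qed (auto simp: orthogonal_family_def \<Psi>_def)
  obtain x y where F: "F1 = \<Psi> x" "F2 = \<Psi> y"
    using \<open>F1 \<in> orthogonal_family d\<close> \<open>F2 \<in> orthogonal_family d\<close> unfolding family by blast
  have "(\<lambda>t. Poly_Mapping.lookup (\<Psi> (lerp t x y)) m) \<in> polyfun {\<lambda>t. t}" for m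
    unfolding \<Psi>_def
  proof (rule polyfun_power_sum)
    fix i :: nat
    show "(\<lambda>t. if i = 1 then lerp t x y 0 else lerp t x y 1 * twist d (lerp t x y 2) (lerp t x y 3) 1 0)
        \<in> polyfun {\<lambda>t. t}"
      by (cases "i = 1") (auto intro!: polyfun.mult polyfun_twist polyfun_lerp polyfun.const)
    show "(\<lambda>t. if i = 1 then lerp t x y 2 else - lerp t x y 3) \<in> polyfun {\<lambda>t. t}"
      by (cases "i = 1") (auto intro!: polyfun_minus polyfun_lerp)
    show "(\<lambda>t. if i = 1 then lerp t x y 3 else lerp t x y 2) \<in> polyfun {\<lambda>t. t}"
      by (cases "i = 1") (auto intro!: polyfun_lerp)
  qed
  then show "\<exists>H. (\<forall>t. H t \<in> orthogonal_family d) \<and> H 0 = F1 \<and> H 1 = F2 \<and>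
      (\<forall>m. (\<lambda>t. Poly_Mapping.lookup (H t) m) \<in> polyfun {\<lambda>t. t})"
    by (intro exI[of _ "\<lambda>t. \<Psi> (lerp t x y)"]) (simp add: F family)
qed

lemma orthogonal_family_generic:
  assumes "2 \<le> d"
  shows "\<exists>F\<in>orthogonal_family d. ev (hankel_det d 2 0) F \<noteq> 0"
proof -
  let ?c = "\<lambda>i::nat. if i = 1 then 1 else 1 * twist d 1 (- 1) 1 0"
  let ?a = "\<lambda>i::nat. if i = 1 then 1 else - (- 1) :: complex"
  let ?b = "\<lambda>i::nat. if i = 1 then - 1 else 1 :: complex"
  have "inj_on ?b {1..2}"
  proof (rule inj_onI)
    fix i j :: nat assume "i \<in> {1..2}" "j \<in> {1..2}" "?b i = ?b j"
    then show "i = j" by (cases "i = 1"; cases "j = 1") auto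
  qed
  then have "ev (hankel_det d 2 0) (power_sum d {1..2::nat} ?c ?a ?b) \<noteq> 0"
    using assms by (intro hankel_det_power_sum_neq_0) (auto simp: twist_def)
  moreover have "power_sum d {1..2::nat} ?c ?a ?b \<in> orthogonal_family d"
    unfolding orthogonal_family_def by blast
  ultimately show ?thesis by blast
qed

text \<open>
  If the points are real and nonnegative and the first one is the largest, all weights in the eigenvector
  equation are positive, so that neither a weight nor a sum of weights vanishes.
\<close>

lemma critical_coeff_generic:
  fixes \<beta> :: "nat \<Rightarrow> real"
  assumes s: "3 \<le> s" and \<beta>: "\<And>i. i \<in> {1..s} \<Longrightarrow> 0 \<le> \<beta> i" "\<And>i. i \<in> {2..s} \<Longrightarrow> \<beta> i < \<beta> 1"
    and i: "i \<in> {1..s}"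
  shows "critical_coeff d s (\<lambda>_. 1) (\<lambda>_. 1) (\<lambda>i. of_real (\<beta> i)) i \<noteq> 0"
proof -
  define \<tau> where "\<tau> = (\<lambda>j. (1 + \<beta> j * \<beta> 1) ^ (d - 1) * (\<beta> 1 - \<beta> j))"
  have \<tau>: "twist d 1 (of_real (\<beta> 1)) 1 (of_real (\<beta> j)) = of_real (\<tau> j)" for j
    by (simp add: twist_def \<tau>_def)
  have pos: "0 < \<tau> j" if "j \<in> {2..s}" for j
  proof -
    have "0 \<le> \<beta> j" "0 \<le> \<beta> 1" "\<beta> j < \<beta> 1"
      using \<beta> that s by auto
    then show ?thesis
      unfolding \<tau>_def by (intro mult_pos_pos zero_less_power add_pos_nonneg) auto
  qed
  have "0 < (\<Sum>j\<in>{3..s}. \<tau> j)"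
    using s by (intro sum_pos pos) auto
  then have "(\<Sum>j\<in>{3..s}. complex_of_real (\<tau> j)) \<noteq> 0"
    by (metis of_real_sum of_real_eq_0_iff less_irrefl)
  moreover have "\<tau> 2 \<noteq> 0"
    using pos[of 2] s by auto
  ultimately show ?thesis
    using i by (auto simp: critical_coeff_def \<tau>[simplified])
qed

lemma critical_half_family_generic:
  assumes "2 \<le> s" "2 * s \<le> d"
  shows "\<exists>F\<in>critical_half_family d s. ev (hankel_det d (Suc s) 0) F \<noteq> 0"
proof -
  define \<beta> :: "nat \<Rightarrow> real" where
    "\<beta> i = (if i = 1 then s + 1 else if i = Suc s then 0 else real i)" for i
  let ?b = "\<lambda>i. complex_of_real (\<beta> i)"
  let ?c = "critical_coeff d (Suc s) (\<lambda>_. 1) (\<lambda>_. 1) ?b"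
  have c: "?c i \<noteq> 0" if "i \<in> {1..Suc s}" for i
    by (rule critical_coeff_generic) (use assms that in \<open>auto simp: \<beta>_def\<close>)
  have "inj_on ?b {1..Suc s}"
    using assms(1) by (auto simp: inj_on_def \<beta>_def split: if_splits)
  then have "ev (hankel_det d (Suc s) 0) (power_sum d {1..Suc s} ?c (\<lambda>_. 1) ?b) \<noteq> 0"
    using assms c by (intro hankel_det_power_sum_neq_0) auto
  moreover have "power_sum d {1..Suc s} ?c (\<lambda>_. 1) ?b \<in> critical_half_family d s"
    unfolding critical_half_family_def
    by (intro CollectI exI[of _ "\<lambda>_. 1"] exI[of _ ?b]) (use assms(1) in \<open>simp add: \<beta>_def\<close>)
  ultimately show ?thesis by blast
qed

lemma critical_family_generic:
  assumes "2 \<le> s" "2 * s + e \<le> d"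
  shows "\<exists>F\<in>critical_family d (Suc s). ev (hankel_det d (Suc s) e) F \<noteq> 0"
proof -
  define \<beta> :: "nat \<Rightarrow> real" where "\<beta> i = (if i = 1 then s + 2 else real i)" for i
  let ?b = "\<lambda>i. complex_of_real (\<beta> i)"
  let ?c = "critical_coeff d (Suc s) (\<lambda>_. 1) (\<lambda>_. 1) ?b"
  have c: "?c i \<noteq> 0" if "i \<in> {1..Suc s}" for i
    by (rule critical_coeff_generic) (use assms that in \<open>auto simp: \<beta>_def\<close>)
  have b: "?b i \<noteq> 0" if "i \<in> {1..Suc s}" for i
    using that by (auto simp: \<beta>_def)
  have "inj_on ?b {1..Suc s}"
    using assms(1) by (auto simp: inj_on_def \<beta>_def split: if_splits)
  then have "ev (hankel_det d (Suc s) e) (power_sum d {1..Suc s} ?c (\<lambda>_. 1) ?b) \<noteq> 0"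
    using assms b c by (intro hankel_det_power_sum_neq_0) auto
  moreover have "power_sum d {1..Suc s} ?c (\<lambda>_. 1) ?b \<in> critical_family d (Suc s)"
    unfolding critical_family_def by blast
  ultimately show ?thesis by blast
qed

lemma chain_orthogonal_family:
  assumes "3 \<le> d"
  shows "irreducible_chain 1 d 2 (proj_closure 1 d (orthogonal_family d))"
proof -
  have "irreducible_chain 1 d 1 (proj_closure 1 d (secant_family d 1))"
    using chain_secant_family[of 0 d] assms by simp
  then have "irreducible_chain 1 d (Suc 1) (proj_closure 1 d (orthogonal_family d))"
    by (rule chain_add_fixed_power[OF _ poly_connected_orthogonal_family
          secant_family_1_subset_orthogonal orthogonal_family_forms order_refl])
      (use assms orthogonal_family_generic[of d] in \<open>auto simp: numeral_2_eq_2\<close>)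
  then show ?thesis by (simp add: numeral_2_eq_2)
qed

lemma chain_critical_half_step:
  assumes "irreducible_chain 1 d k (proj_closure 1 d (critical_half_family d s))"
    and "2 \<le> s" "2 * s + 1 \<le> d"
  shows "irreducible_chain 1 d (Suc k) (proj_closure 1 d (critical_family d (Suc s)))"
  by (rule chain_move_fixed_power[OF assms(1) poly_connected_critical_family
        critical_half_family_subset critical_family_forms critical_half_family_subset_secant])
    (use assms critical_family_generic[of s 1 d] in auto)

text \<open>
  The chain starts with the powers and the orthogonal sums of two powers.  From there on it alternates like
  the chain of secant families.
\<close>

lemma chain_critical_family:
  assumes "2 \<le> s" "2 * s + 1 \<le> d"
  shows "irreducible_chain 1 d (2 * s) (proj_closure 1 d (critical_family d (Suc s)))"
  using assms
proof (induction s rule: dec_induct)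
  case base
  have "irreducible_chain 1 d 2 (proj_closure 1 d (orthogonal_family d))"
    using base by (intro chain_orthogonal_family) simp
  then have "irreducible_chain 1 d (Suc 2) (proj_closure 1 d (critical_half_family d 2))"
    by (rule chain_add_fixed_power[OF _ poly_connected_critical_half_family
          orthogonal_family_subset_half critical_half_family_forms
          orthogonal_family_subset_secant])
      (use base critical_half_family_generic[of 2 d] in auto)
  then have "irreducible_chain 1 d (Suc (Suc 2)) (proj_closure 1 d (critical_family d (Suc 2)))"
    by (rule chain_critical_half_step) (use base in auto)
  then show ?case by simp
next
  case (step s)
  have "irreducible_chain 1 d (2 * s) (proj_closure 1 d (critical_family d (Suc s)))"
    using step by simp
  then have "irreducible_chain 1 d (Suc (2 * s)) (proj_closure 1 d (critical_half_family d (Suc s)))"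
    by (rule chain_add_fixed_power[OF _ poly_connected_critical_half_family
          critical_family_subset_half critical_half_family_forms critical_family_subset_secant])
      (use step critical_half_family_generic[of "Suc s" d] in auto)
  then have "irreducible_chain 1 d (Suc (Suc (2 * s)))
      (proj_closure 1 d (critical_family d (Suc (Suc s))))"
    by (rule chain_critical_half_step) (use step in auto)
  then show ?case by simp
qed


section \<open>The hypersurface of critical parameters\<close>

text \<open>
  Families of polynomials in one variable whose coefficients are polynomial functions of the parameters.
\<close>

definition poly_with_coeffs_in :: "('p \<Rightarrow> complex) set \<Rightarrow> ('p \<Rightarrow> complex poly) \<Rightarrow> bool" where
  "poly_with_coeffs_in X f \<longleftrightarrow> (\<forall>j. (\<lambda>p. coeff (f p) j) \<in> polyfun X)"

lemma poly_with_coeffs_in_intros: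
  "poly_with_coeffs_in X (\<lambda>_. P)"
  "x \<in> polyfun X \<Longrightarrow> poly_with_coeffs_in X f \<Longrightarrow> poly_with_coeffs_in X (\<lambda>p. pCons (x p) (f p))"
  "poly_with_coeffs_in X f \<Longrightarrow> poly_with_coeffs_in X g \<Longrightarrow> poly_with_coeffs_in X (\<lambda>p. f p + g p)"
  "poly_with_coeffs_in X f \<Longrightarrow> poly_with_coeffs_in X g \<Longrightarrow> poly_with_coeffs_in X (\<lambda>p. f p - g p)"
  "poly_with_coeffs_in X f \<Longrightarrow> poly_with_coeffs_in X g \<Longrightarrow> poly_with_coeffs_in X (\<lambda>p. f p * g p)"
proof -
  show "poly_with_coeffs_in X (\<lambda>p. pCons (x p) (f p))"
    if "x \<in> polyfun X" "poly_with_coeffs_in X f"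
    unfolding poly_with_coeffs_in_def
  proof
    fix j show "(\<lambda>p. coeff (pCons (x p) (f p)) j) \<in> polyfun X"
      using that by (cases j) (simp_all add: poly_with_coeffs_in_def)
  qed
qed (auto simp: poly_with_coeffs_in_def coeff_mult
    intro!: polyfun.const polyfun.add polyfun.mult polyfun_diff polyfun_sum)

lemma poly_with_coeffs_in_power:
  "poly_with_coeffs_in X f \<Longrightarrow> poly_with_coeffs_in X (\<lambda>p. f p ^ k)"
  by (induction k) (auto intro: poly_with_coeffs_in_intros)

lemma poly_with_coeffs_in_sum:
  "(\<And>i. i \<in> A \<Longrightarrow> poly_with_coeffs_in X (f i)) \<Longrightarrow> poly_with_coeffs_in X (\<lambda>p. \<Sum>i\<in>A. f i p)"
  by (induction A rule: infinite_finite_induct) (auto intro: poly_with_coeffs_in_intros)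

type_synonym parameters = "nat \<times> bool \<Rightarrow> complex"

definition power_sum_of_parameters :: "nat \<Rightarrow> nat \<Rightarrow> parameters \<Rightarrow> form" where
  "power_sum_of_parameters d r p = pure_power_sum d {1..r} (\<lambda>i. p (i, False)) (\<lambda>i. p (i, True))"

definition critical_parameters :: "nat \<Rightarrow> nat \<Rightarrow> parameters set" where
  "critical_parameters d r =
     {p. (\<Sum>i\<in>{2..r}. twist d (p (1, False)) (p (1, True)) (p (i, False)) (p (i, True))) = 0}"

text \<open>
  Coordinates in which the critical equation becomes monic up to sign in the first coordinate of the first
  linear form: the remaining coordinates are constant along the direction that moves the first linear form
  by \<open>(1, 0)\<close> and the second one by \<open>(1, 1)\<close>, and the left hand side of the equation is nonzero at this
  direction.
\<close>

definition shifted_coordinate :: "nat \<times> bool \<Rightarrow> parameters \<Rightarrow> complex" where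
  "shifted_coordinate k p = (if fst k = 2 then p k - p (1, False) else p k)"

text \<open>
  The same expression as \<open>twist\<close>, with entries that are polynomials in the first coordinate.
\<close>

definition twist_poly :: "nat \<Rightarrow> complex poly \<Rightarrow> complex poly \<Rightarrow> complex poly \<Rightarrow> complex poly \<Rightarrow> complex poly" where
  "twist_poly d U V A B = (A * U + B * V) ^ (d - 1) * (A * V - B * U)"

lemma poly_twist_poly:
  "poly (twist_poly d U V A B) x = twist d (poly U x) (poly V x) (poly A x) (poly B x)"
  by (simp add: twist_poly_def twist_def)

lemma twist_poly_shifted:
  assumes "0 < d"
  shows "degree (twist_poly d [:0, 1:] [:y:] [:a, 1:] [:b, 1:]) = 2 * d"
    and "coeff (twist_poly d [:0, 1:] [:y:] [:a, 1:] [:b, 1:]) (2 * d) = - 1"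
proof -
  let ?X = "[:b * y, a + y, 1:]" and ?W = "[:a * y, y - b, - 1:]"
  have eq: "twist_poly d [:0, 1:] [:y:] [:a, 1:] [:b, 1:] = ?X ^ (d - 1) * ?W"
    by (simp add: twist_poly_def mult.commute add.commute)
  have "degree (?X ^ (d - 1) * ?W) = degree (?X ^ (d - 1)) + degree ?W"
    by (intro degree_mult_eq) auto
  also have "\<dots> = 2 * d"
    using assms by (simp add: degree_power_eq)
  finally show deg: "degree (twist_poly d [:0, 1:] [:y:] [:a, 1:] [:b, 1:]) = 2 * d"
    using eq by simp
  have "lead_coeff (?X ^ (d - 1) * ?W) = - 1"
    by (simp only: lead_coeff_mult lead_coeff_power) simp
  then show "coeff (twist_poly d [:0, 1:] [:y:] [:a, 1:] [:b, 1:]) (2 * d) = - 1"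
    using deg eq by simp
qed

lemma degree_twist_poly_const:
  assumes "0 < d"
  shows "degree (twist_poly d [:0, 1:] [:y:] [:a:] [:b:]) \<le> d"
proof -
  let ?X = "[:b * y, a:]" and ?W = "[:a * y, - b:]"
  have eq: "twist_poly d [:0, 1:] [:y:] [:a:] [:b:] = ?X ^ (d - 1) * ?W"
    by (simp add: twist_poly_def mult.commute add.commute)
  have "degree (?X ^ (d - 1) * ?W) \<le> degree (?X ^ (d - 1)) + degree ?W"
    by (rule degree_mult_le)
  also have "\<dots> \<le> degree ?X * (d - 1) + degree ?W"
    by (intro add_right_mono degree_power_le)
  also have "\<dots> \<le> 1 * (d - 1) + 1"
    by (intro add_mono mult_right_mono) auto
  finally show ?thesis
    using eq assms by simp
qed

text \<open>
  As a polynomial in the first coordinate, the summand of the critical equation for \<open>i = 2\<close> has degree \<open>2 d\<close>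
  and leading coefficient \<open>- 1\<close>, and the other summands have degree at most \<open>d\<close>.
\<close>

lemma critical_parameters_integral:
  assumes d: "0 < d" and r: "2 \<le> r"
  defines "I \<equiv> {1..r} \<times> UNIV - {(1, False)}"
  shows "\<exists>q. (\<forall>j. q j \<in> polyfun (shifted_coordinate ` I)) \<and>
    (\<forall>p\<in>critical_parameters d r.
      p (1, False) ^ (2 * d) = (\<Sum>j<2 * d. q j p * p (1, False) ^ j))"
proof -
  define P where "P = (\<lambda>(i::nat) s p. if i = 2 then [:shifted_coordinate (i, s) p, 1:]
      else [:shifted_coordinate (i, s) p:])"
  define V where "V = (\<lambda>p. [:shifted_coordinate (1, True) p:])"
  define T where "T = (\<lambda>p. \<Sum>i\<in>{2..r}. twist_poly d [:0, 1:] (V p) (P i False p) (P i True p))"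
  have var: "shifted_coordinate k \<in> polyfun (shifted_coordinate ` I)" if "k \<in> I" for k
    using that by (intro polyfun.var) blast
  have V: "poly_with_coeffs_in (shifted_coordinate ` I) V"
    unfolding V_def using r by (intro poly_with_coeffs_in_intros var) (auto simp: I_def)
  have P: "poly_with_coeffs_in (shifted_coordinate ` I) (P i s)" if "i \<in> {2..r}" for i s
  proof -
    have "(i, s) \<in> I" using that by (auto simp: I_def)
    then show ?thesis
      unfolding P_def by (cases "i = 2") (auto intro!: poly_with_coeffs_in_intros var)
  qed
  have "poly_with_coeffs_in (shifted_coordinate ` I) T"
    unfolding T_def twist_poly_def
    by (intro poly_with_coeffs_in_sum poly_with_coeffs_in_intros poly_with_coeffs_in_power V P)
  then have coeffs: "\<forall>j. (\<lambda>p. coeff (T p) j) \<in> polyfun (shifted_coordinate ` I)"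
    by (simp add: poly_with_coeffs_in_def)
  have rel: "p (1, False) ^ (2 * d) = (\<Sum>j<2 * d. coeff (T p) j * p (1, False) ^ j)"
    if p: "p \<in> critical_parameters d r" for p
  proof -
  let ?x = "p (1, False)"
  have "poly (P i s p) ?x = p (i, s)" for i s
    by (simp add: P_def shifted_coordinate_def)
  moreover have "poly (V p) ?x = p (1, True)"
    by (simp add: V_def shifted_coordinate_def)
  ultimately have "poly (T p) ?x = 0"
    using p by (simp add: T_def poly_sum poly_twist_poly critical_parameters_def)
  let ?U = "\<lambda>i. twist_poly d [:0, 1:] (V p) (P i False p) (P i True p)"
  have "{2..r} = insert 2 {3..r}"
    using r by auto
  then have T: "T p = ?U 2 + (\<Sum>i\<in>{3..r}. ?U i)"
    by (simp add: T_def)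
  have deg: "degree (?U i) \<le> d" if "i \<in> {3..r}" for i
    using that degree_twist_poly_const[OF d] by (auto simp: P_def V_def)
  have "degree (\<Sum>i\<in>{3..r}. ?U i) \<le> d"
    using deg by (intro degree_sum_le) auto
  moreover have "degree (?U 2) = 2 * d" "coeff (?U 2) (2 * d) = - 1"
    using twist_poly_shifted[OF d] by (simp_all add: P_def V_def)
  ultimately have "degree (T p) \<le> 2 * d" "coeff (T p) (2 * d) = - 1"
    using d by (auto simp: T coeff_eq_0 intro: degree_add_le)
  have "0 = (\<Sum>j\<le>degree (T p). coeff (T p) j * ?x ^ j)"
    using \<open>poly (T p) ?x = 0\<close> by (simp add: poly_altdef)
  also have "\<dots> = (\<Sum>j\<le>2 * d. coeff (T p) j * ?x ^ j)"
    using \<open>degree (T p) \<le> 2 * d\<close>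
    by (intro sum.mono_neutral_left) (auto simp: coeff_eq_0)
  also have "\<dots> = (\<Sum>j<2 * d. coeff (T p) j * ?x ^ j) - ?x ^ (2 * d)"
    using \<open>coeff (T p) (2 * d) = - 1\<close> by (simp add: lessThan_Suc_atMost[symmetric])
  finally show "?x ^ (2 * d) = (\<Sum>j<2 * d. coeff (T p) j * ?x ^ j)"
    by simp
  qed
  show ?thesis
    using coeffs rel by (intro exI[of _ "\<lambda>j p. coeff (T p) j"]) blast
qed

lemma polyfun_power_sum_of_parameters:
  assumes "\<And>i s. i \<in> {1..r} \<Longrightarrow> (\<lambda>p. p (i, s)) \<in> polyfun X"
  shows "(\<lambda>p. Poly_Mapping.lookup (power_sum_of_parameters d r p) m) \<in> polyfun X"
  unfolding power_sum_of_parameters_def by (intro polyfun_power_sum polyfun.const assms)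

lemma critical_forms_subset: "critical_forms d r \<subseteq> proj_space 1 d"
  by (auto simp: critical_forms_def proj_space_def)

lemma open_secant_subset: "open_secant n d r \<subseteq> proj_space n d"
  by (auto simp: open_secant_def)

theorem zariski_dim_critical_le:
  assumes d: "0 < d" and r: "2 \<le> r"
  shows "zariski_dim 1 d (critical_waring_variety 1 d r) \<le> enat (2 * (r - 1))"
proof -
  define I :: "(nat \<times> bool) set" where "I = {1..r} \<times> UNIV - {(1, False)}"
  obtain q where q: "\<forall>j. q j \<in> polyfun (shifted_coordinate ` I)"
    "\<forall>p\<in>critical_parameters d r.
      p (1, False) ^ (2 * d) = (\<Sum>j<2 * d. q j p * p (1, False) ^ j)"
    using critical_parameters_integral[OF d r] unfolding I_def by blast
  let ?X = "insert (\<lambda>p. p (1, False)) (shifted_coordinate ` I)"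
  have coord: "(\<lambda>p. p (i, s)) \<in> polyfun ?X" if "i \<in> {1..r}" for i s
  proof (cases "(i, s) = (1, False)")
    case True
    then show ?thesis by (auto intro: polyfun.var)
  next
    case False
    then have "shifted_coordinate (i, s) \<in> polyfun ?X"
      using that by (intro polyfun.var) (auto simp: I_def)
    moreover have "(\<lambda>p. p (1, False)) \<in> polyfun ?X"
      by (auto intro: polyfun.var)
    ultimately have "(\<lambda>p. shifted_coordinate (i, s) p + (if i = 2 then 1 else 0) * p (1, False))
        \<in> polyfun ?X"
      by (intro polyfun.add polyfun.mult polyfun.const)
    moreover have "(\<lambda>p. shifted_coordinate (i, s) p + (if i = 2 then 1 else 0) * p (1, False)) =
        (\<lambda>p. p (i, s))"
      by (auto simp: shifted_coordinate_def)
    ultimately show ?thesis by simp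
  qed
  have cover: "\<exists>p\<in>critical_parameters d r. F = power_sum_of_parameters d r p"
    if PF: "P \<in> critical_forms d r" "F \<in> P" for P F
  proof -
    obtain a b where ab: "F = pure_power_sum d {1..r} a b"
      "(\<Sum>i\<in>{2..r}. twist d (a 1) (b 1) (a i) (b i)) = 0"
      using critical_forms_power_sum[OF d _ PF] r by auto
    then show ?thesis
      by (intro bexI[of _ "\<lambda>(i, s). if s then b i else a i"])
        (auto simp: power_sum_of_parameters_def critical_parameters_def)
  qed
  have "zariski_dim 1 d (critical_waring_variety 1 d r) \<le> enat (card I - 1)"
    unfolding critical_waring_variety_eq
    by (rule zariski_dim_parametrized_le[OF critical_forms_subset cover
          polyfun_power_sum_of_parameters[OF coord], where q = q and e = "2 * d"])
      (use d q in \<open>auto simp: I_def\<close>)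
  also have "card I = 2 * r - 1"
    using r by (simp add: I_def card_Diff_singleton card_cartesian_product)
  also have "2 * r - 1 - 1 = 2 * (r - 1)"
    by simp
  finally show ?thesis .
qed

text \<open>
  All \<open>2 r\<close> coordinates are free here; the integral coordinate is the constant \<open>0\<close>.
\<close>

theorem zariski_dim_secant_le:
  assumes d: "0 < d"
  shows "zariski_dim 1 d (secant_variety 1 d r) \<le> enat (2 * r - 1)"
proof -
  let ?I = "{1..r} \<times> (UNIV :: bool set)"
  let ?b = "\<lambda>k (p :: parameters). p k"
  let ?X = "insert (\<lambda>_. 0) (?b ` ?I)"
  have coord: "(\<lambda>p. p (i, s)) \<in> polyfun ?X" if "i \<in> {1..r}" for i s
    using that by (intro polyfun.var) auto
  have cover: "\<exists>p\<in>UNIV. F = power_sum_of_parameters d r p"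
    if PF: "P \<in> open_secant 1 d r" "F \<in> P" for P F
  proof -
    obtain a b where "F = pure_power_sum d {1..r} a b"
      by (rule open_secant_power_sum[OF d PF])
    then show ?thesis
      by (intro bexI[of _ "\<lambda>(i, s). if s then b i else a i"])
        (auto simp: power_sum_of_parameters_def)
  qed
  have "zariski_dim 1 d (secant_variety 1 d r) \<le> enat (card ?I - 1)"
    unfolding secant_variety_def
    by (rule zariski_dim_parametrized_le[where e = 1 and q = "\<lambda>_ _. 0" and t = "\<lambda>_. 0" and b = ?b,
          OF open_secant_subset cover polyfun_power_sum_of_parameters[OF coord]])
      (auto intro: polyfun.const)
  then show ?thesis
    by (simp add: card_cartesian_product mult.commute)
qed


section \<open>The families lie in the varieties\<close>

text \<open>
  Zero linear forms give no point of the Veronese variety and are replaced by \<open>x\<^sub>0\<close>.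
\<close>

lemma power_sum_in_open_secant:
  assumes d: "0 < d" and F: "F = power_sum d {1..r} c a b" "F \<noteq> 0"
  shows "proj_pt F \<in> open_secant 1 d r"
proof -
  define L where "L = (\<lambda>i. if linear_form (a i) (b i) = 0 then linear_form 1 0
      else linear_form (a i) (b i))"
  let ?U = "\<Union>i\<in>{1..r}. proj_pt (L i ^ d)"
  have L: "L i \<in> forms 1 1 - {0}" for i
    by (auto simp: L_def linear_form_in_forms[simplified])
  have "linear_form (a i) (b i) ^ d \<in> cpoly.span ?U" if "i \<in> {1..r}" for i
  proof (cases "linear_form (a i) (b i) = 0")
    case True
    then show ?thesis
      using d by (simp add: power_0_left cpoly.span_zero)
  next
    case False
    then have "linear_form (a i) (b i) ^ d \<in> proj_pt (L i ^ d)"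
      by (auto simp: L_def intro: cpoly.span_base)
    then show ?thesis
      using that by (intro cpoly.span_base) blast
  qed
  then have "F \<in> cpoly.span ?U"
    unfolding F(1) power_sum_def by (intro cpoly.span_sum cpoly.span_scale)
  then have "proj_pt F \<subseteq> cpoly.span ?U"
    by (intro cpoly.span_minimal) auto
  moreover have "proj_pt (L i ^ d) \<in> veronese 1 d" for i
    using L[of i] unfolding veronese_def by blast
  moreover have "proj_pt F \<in> proj_space 1 d"
    unfolding proj_space_def using F power_sum_in_forms by blast
  ultimately show ?thesis
    unfolding open_secant_def mem_Collect_eq
    by (intro conjI exI[of _ "\<lambda>i. proj_pt (L i ^ d)"] ballI)
qed

lemma secant_family_closure_subset:
  assumes "0 < d"
  shows "proj_closure 1 d (secant_family d r) \<subseteq> secant_variety 1 d r"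
  unfolding proj_closure_def secant_variety_def
proof (intro closure_of_mono image_subsetI)
  fix F assume F: "F \<in> secant_family d r - {0}"
  then obtain c a b where "F = power_sum d {1..r} c a b"
    unfolding secant_family_def by blast
  then show "proj_pt F \<in> open_secant 1 d r"
    by (rule power_sum_in_open_secant[OF assms]) (use F in simp)
qed

lemma power_sum_drop_first:
  fixes r :: nat
  assumes "0 < r" "0 < d" "a 1 = 0" "b 1 = 0"
  shows "power_sum d {1..r} c a b = power_sum d {2..r} c a b"
proof -
  have "{1..r} = insert 1 {2..r}"
    using assms(1) by auto
  then show ?thesis
    using assms by (simp add: power_sum_def power_0_left)
qed

lemma waring_rank_eq:
  assumes d: "0 < d" "2 * (r - 1) \<le> d"
    and F: "F = power_sum d {1..r} c a b" "ev (hankel_det d r 0) F \<noteq> 0"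
  shows "waring_rank 1 d F = r"
proof (rule antisym)
  obtain z where z: "F = pure_power_sum d {1..r} (\<lambda>i. z i * a i) (\<lambda>i. z i * b i)"
    unfolding F(1) by (rule power_sum_pure[OF d(1)])
  then show "waring_rank 1 d F \<le> r"
    by (rule waring_rank_le)
  let ?P = "\<lambda>s. \<exists>L. (\<forall>i\<in>{1..s}. L i \<in> forms 1 1) \<and> F = (\<Sum>i\<in>{1..s}. L i ^ d)"
  have "?P r"
    by (rule exI[of _ "\<lambda>i. linear_form (z i * a i) (z i * b i)"])
      (auto simp: z power_sum_def linear_form_in_forms[simplified])
  then have "?P (waring_rank 1 d F)"
    unfolding waring_rank_def by (rule LeastI)
  then obtain L where L: "\<And>i. i \<in> {1..waring_rank 1 d F} \<Longrightarrow> L i \<in> forms 1 1"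
    "F = (\<Sum>i\<in>{1..waring_rank 1 d F}. L i ^ d)"
    by blast
  have "\<exists>x y. L i = linear_form x y" if "i \<in> {1..waring_rank 1 d F}" for i
    using L(1)[OF that] by (metis linear_form_cases)
  then obtain x y where "\<And>i. i \<in> {1..waring_rank 1 d F} \<Longrightarrow> L i = linear_form (x i) (y i)"
    by metis
  then have "(\<Sum>i\<in>{1..waring_rank 1 d F}. L i ^ d) = pure_power_sum d {1..waring_rank 1 d F} x y"
    by (simp add: power_sum_def)
  then have xy: "F = pure_power_sum d {1..waring_rank 1 d F} x y"
    by (rule trans[OF L(2)])
  show "r \<le> waring_rank 1 d F"
  proof (rule ccontr)
    assume "\<not> r \<le> waring_rank 1 d F"
    then have "ev (hankel_det d r 0) (pure_power_sum d {1..waring_rank 1 d F} x y) = 0"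
      using d(2) by (intro hankel_det_power_sum_eq_0[where A = "{1..waring_rank 1 d F}"]) auto
    then show False
      using F(2) unfolding xy[symmetric] by blast
  qed
qed

text \<open>
  The nonzero Hankel determinant of size \<open>r\<close> makes the given decomposition minimal, since it vanishes on
  shorter sums.  Therefore the first linear form is nonzero and belongs to the Waring locus.
\<close>

lemma critical_power_sum_in_critical_forms:
  assumes d: "0 < d" "2 * (r - 1) \<le> d" and r: "0 < r"
    and F: "F = power_sum d {1..r} c a b" "ev (hankel_det d r 0) F \<noteq> 0"
    and crit: "(\<Sum>i\<in>{2..r}. c i * twist d (a 1) (b 1) (a i) (b i)) = 0"
  shows "proj_pt F \<in> critical_forms d r"
proof -
  let ?L = "linear_form (a 1) (b 1)"
  have F0: "F \<noteq> 0"
    using F(2) hankel_det_0[of r 0 d] d r by auto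
  have rank: "waring_rank 1 d F = r"
    by (rule waring_rank_eq[OF d F])
  have "?L \<noteq> 0"
  proof
    assume "?L = 0"
    then have "F = power_sum d {2..r} c a b"
      using power_sum_drop_first[OF r d(1), of a b c] F(1) by simp
    then show False
      using hankel_det_power_sum_eq_0[of r 0 d "{2..r}" "{2..r}" c b a] d(2) F(2) r by simp
  qed
  then have L: "?L \<in> forms 1 1 - {0}"
    by (auto simp: linear_form_in_forms[simplified])
  have r1: "{1..r} = insert 1 {2..r}"
    using r by auto
  have "F \<in> cpoly.span (insert (?L ^ d) ((\<lambda>i. linear_form (a i) (b i) ^ d) ` {2..r}))"
    unfolding F(1) power_sum_def r1
    by (intro cpoly.span_sum cpoly.span_scale cpoly.span_base) auto
  then have "proj_pt ?L \<in> waring_locus 1 d F"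
    unfolding waring_locus_def rank mem_Collect_eq using L linear_form_in_forms
    by (intro exI[of _ ?L] conjI exI[of _ "\<lambda>i. linear_form (a i) (b i)"]) simp_all
  moreover have "(\<Sum>i\<in>{1..r}. c i * twist d (a 1) (b 1) (a i) (b i)) = 0"
    unfolding r1 using crit by simp
  then have "proj_pt ?L \<in> eigenpoints 1 F"
    unfolding eigenpoints_def F(1)
    using eigenvector_power_sum_iff[OF d(1), of "a 1" "b 1" "{1..r}" c a b] L by blast
  moreover have "F \<in> forms 1 d - {0}"
    using F0 F(1) power_sum_in_forms by blast
  moreover have "proj_pt F \<in> open_secant 1 d r"
    by (rule power_sum_in_open_secant[OF d(1) F(1) F0])
  ultimately show ?thesis
    unfolding critical_forms_def by blast
qed

text \<open>
  Only the members with a nonzero Hankel determinant are known to be critical.  A polynomial that vanishes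
  on these vanishes on the whole family, because its product with the determinant does and the family is
  irreducible.
\<close>

lemma critical_closure_subset:
  assumes K: "poly_connected K" "K \<subseteq> forms 1 d"
    and d: "0 < d" "2 * (r - 1) \<le> d" and r: "0 < r"
    and crit: "\<And>F. F \<in> K \<Longrightarrow> \<exists>c a b. F = power_sum d {1..r} c a b \<and>
      (\<Sum>i\<in>{2..r}. c i * twist d (a 1) (b 1) (a i) (b i)) = 0"
    and generic: "\<exists>F\<in>K. ev (hankel_det d r 0) F \<noteq> 0"
  shows "proj_closure 1 d K \<subseteq> critical_waring_variety 1 d r"
proof -
  let ?D = "hankel_det d r 0"
  obtain F1 where F1: "F1 \<in> K - {0}" "ev ?D F1 \<noteq> 0"
    using generic hankel_det_0[of r 0 d] d r by force
  obtain S where S: "\<forall>G\<in>S. \<exists>k. homogeneous k G"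
    "critical_waring_variety 1 d r = zero_locus 1 d S"
    using closedin_closure_of[of "zariski 1 d" "critical_forms d r"]
    unfolding critical_waring_variety_eq closedin_zariski by blast
  have "critical_forms d r \<subseteq> critical_waring_variety 1 d r"
    unfolding critical_waring_variety_eq
    using critical_forms_subset by (intro closure_of_subset) simp
  have "proj_pt F \<in> zero_locus 1 d S" if F: "F \<in> K - {0}" for F
  proof -
    have pp: "proj_pt F \<in> proj_space 1 d"
      using F K(2) by (auto simp: proj_space_def)
    have "ev G F' = 0" if "G \<in> S" "F' \<in> proj_pt F" for G F'
    proof -
      have "ev ?D F2 * ev G F2 = 0" if F2: "F2 \<in> K - {0}" for F2
      proof (cases "ev ?D F2 = 0")
        case False
        have "F2 \<in> K"
          using F2 by blast
        then obtain c a b where "F2 = power_sum d {1..r} c a b"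
          "(\<Sum>i\<in>{2..r}. c i * twist d (a 1) (b 1) (a i) (b i)) = 0"
          using crit[of F2] by blast
        then have "proj_pt F2 \<in> critical_forms d r"
          using critical_power_sum_in_critical_forms[OF d r _ False] by blast
        then have "proj_pt F2 \<in> zero_locus 1 d S"
          using \<open>critical_forms d r \<subseteq> critical_waring_variety 1 d r\<close> S(2) by blast
        then show ?thesis
          using \<open>G \<in> S\<close> by (auto simp: zero_locus_def intro: cpoly.span_base)
      qed simp
      then have G0: "ev G F = 0"
        by (rule poly_connected_prime[OF K(1) _ F1 F])
      obtain k where k: "homogeneous k G"
        using S(1) \<open>G \<in> S\<close> by blast
      have "F \<in> proj_pt F" "F \<noteq> 0"
        using F by (auto intro: cpoly.span_base)
      then show ?thesis
        using vanish_on_line[OF k pp _ _ G0 that(2)] by blast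
    qed
    then show ?thesis
      using pp by (simp add: zero_locus_def)
  qed
  then have "proj_pt ` (K - {0}) \<subseteq> critical_waring_variety 1 d r"
    using S(2) by blast
  then show ?thesis
    unfolding proj_closure_def
    unfolding critical_waring_variety_eq by (rule closure_of_minimal) (rule closedin_closure_of)
qed

lemma critical_waring_variety_chain:
  assumes r: "2 \<le> r" "2 * r \<le> d + 1"
  obtains Z where "irreducible_chain 1 d (2 * (r - 1)) Z" "Z \<subseteq> critical_waring_variety 1 d r"
proof (cases "r = 2")
  case True
  have "\<exists>c a b. F = power_sum d {1..r} c a b \<and>
      (\<Sum>i\<in>{2..r}. c i * twist d (a 1) (b 1) (a i) (b i)) = 0" if "F \<in> orthogonal_family d" for F
  proof -
    obtain k l u v where
      "F = power_sum d {1..2::nat} (\<lambda>i. if i = 1 then k else l * twist d u v 1 0)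
        (\<lambda>i. if i = 1 then u else - v) (\<lambda>i. if i = 1 then v else u)"
      using \<open>F \<in> orthogonal_family d\<close> unfolding orthogonal_family_def by blast
    moreover have "twist d u v (- v) u = 0"
      using r by (simp add: twist_def mult.commute power_0_left)
    ultimately show ?thesis
      unfolding True by (intro exI conjI) (assumption, simp)
  qed
  then have "proj_closure 1 d (orthogonal_family d) \<subseteq> critical_waring_variety 1 d r"
    using r True orthogonal_family_generic[of d]
    by (intro critical_closure_subset poly_connected_orthogonal_family orthogonal_family_forms) auto
  then show ?thesis
    using that chain_orthogonal_family[of d] r True by simp
next
  case False
  then obtain s where s: "r = Suc s" "2 \<le> s"
    using r by (cases r) auto
  have "\<exists>c a b. F = power_sum d {1..r} c a b \<and>
      (\<Sum>i\<in>{2..r}. c i * twist d (a 1) (b 1) (a i) (b i)) = 0" if F: "F \<in> critical_family d r" for F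
  proof -
    obtain c a b where "F = power_sum d {1..r} (critical_coeff d r c a b) a b"
      using F unfolding critical_family_def by blast
    then show ?thesis
      using critical_coeff_condition[OF r(1), of d c a b] by blast
  qed
  then have "proj_closure 1 d (critical_family d r) \<subseteq> critical_waring_variety 1 d r"
    using r s critical_family_generic[of s 0 d]
    by (intro critical_closure_subset poly_connected_critical_family critical_family_forms) auto
  then show ?thesis
    using that chain_critical_family[of s d] r s by simp
qed

theorem theorem4p10:
  fixes d r :: nat
  assumes "2 \<le> r" and "real r \<le> (real d + 1) / 2"
  shows "zariski_dim 1 d (critical_waring_variety 1 d r) = enat (2 * (r - 1)) \<and>
    (closedin (zariski 1 d) (critical_waring_variety 1 d r) \<and>
     critical_waring_variety 1 d r \<subseteq> secant_variety 1 d r \<and>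
     zariski_dim 1 d (secant_variety 1 d r) = zariski_dim 1 d (critical_waring_variety 1 d r) + 1)"
proof -
  have "real (2 * r) \<le> real (d + 1)"
    using assms(2) by simp
  then have rd: "2 * r \<le> d + 1"
    by (simp only: of_nat_le_iff)
  have d: "0 < d"
    using rd assms(1) by linarith
  have closed: "closedin (zariski 1 d) (critical_waring_variety 1 d r)"
    unfolding critical_waring_variety_eq by (rule closedin_closure_of)
  have subset: "critical_waring_variety 1 d r \<subseteq> secant_variety 1 d r"
    unfolding critical_waring_variety_eq secant_variety_def
    by (intro closure_of_mono) (auto simp: critical_forms_def)
  obtain Z where "irreducible_chain 1 d (2 * (r - 1)) Z" "Z \<subseteq> critical_waring_variety 1 d r"
    by (rule critical_waring_variety_chain[OF assms(1) rd])
  then have "enat (2 * (r - 1)) \<le> zariski_dim 1 d (critical_waring_variety 1 d r)"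
    by (rule zariski_dim_ge[OF closed])
  then have dim: "zariski_dim 1 d (critical_waring_variety 1 d r) = enat (2 * (r - 1))"
    using zariski_dim_critical_le[OF d assms(1)] by (rule antisym[rotated])
  have "irreducible_chain 1 d (2 * (r - 1) + 1) (proj_closure 1 d (secant_family d (Suc (r - 1))))"
    using rd assms(1) by (intro chain_secant_family) simp
  then have "irreducible_chain 1 d (2 * r - 1) (proj_closure 1 d (secant_family d r))"
    using assms(1) by (simp add: diff_mult_distrib2 Suc_diff_Suc numeral_2_eq_2)
  moreover have "closedin (zariski 1 d) (secant_variety 1 d r)"
    unfolding secant_variety_def by (rule closedin_closure_of)
  ultimately have "enat (2 * r - 1) \<le> zariski_dim 1 d (secant_variety 1 d r)"
    using secant_family_closure_subset[OF d] by (intro zariski_dim_ge)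
  then have "zariski_dim 1 d (secant_variety 1 d r) = enat (2 * r - 1)"
    using zariski_dim_secant_le[OF d] by (rule antisym[rotated])
  also have "2 * r - 1 = 2 * (r - 1) + 1"
    using assms(1) by simp
  also have "enat (2 * (r - 1) + 1) = enat (2 * (r - 1)) + 1"
    by (simp only: one_enat_def plus_enat_simps)
  finally show ?thesis
    using dim closed subset by simp
qed

end
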